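(* Let $n$ be a positive odd integer, and let $M=(n-1)/2$ or $M=n-1$. Then, with $c,d$ indeterminates, $$\sum_{k=0}^{M}[4k+1]\frac{(q;q^2)_k^4(cq,dq;q^2)_k}{(q^2;q^2)_k^4(q^2/c,q^2/d;q^2)_k}\left(\frac{q}{cd}\right)^k$$ $$\equiv\left\{[n]q^{(1-n)/2}+[n]^3q^{(1-n)/2}\frac{(n^2-1)(1-q)^2}{24}\right\}\sum_{k=0}^{(n-1)/2}\frac{(q;q^2)_k^3(q/cd;q^2)_k}{(q^2;q^2)_k^2(q^2/c,q^2/d;q^2)_k}q^{2k}\pmod{[n]\Phi_n(q)^3}.$$
   Context: For a nonnegative integer $k$, $(x;q)_0=1$ and $(x;q)_k=(1-x)(1-xq)\cdots(1-xq^{k-1})$ for $k\ge 1$; $(x_1,\dots,x_r;q)_k=(x_1;q)_k\cdots(x_r;q)_k$; the same notation is used with base $q$ replaced by $q^2$. $q/cd$ means $q/(cd)$. $[m]=(1-q^m)/(1-q)$, and $\Phi_n(q)$ is the $n$-th cyclotomic polynomial in $q$. The parameters $c,d$ and $q$ are indeterminates. For rational functions $A,B$ and a polynomial $P$, $A\equiv B\pmod P$ means that $A-B$, written in lowest terms, has numerator divisible by $P$ (over the field of rational functions in $c,d$ with rational coefficients, as polynomials in $q$). *)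

theory Defs
  imports "HOL-Computational_Algebra.Computational_Algebra" "HOL-Number_Theory.Totient"
begin

text \<open>The field \<open>\<rat>(c,d)\<close> is the fraction field of \<open>\<rat>[c][d]\<close>; rational functions in
  \<open>q, c, d\<close> are elements of the fraction field of \<open>\<rat>(c,d)[q]\<close>.\<close>

type_synonym coeff_field = "rat poly poly fract"
type_synonym q_poly = "coeff_field poly"
type_synonym q_ratfun = "q_poly fract"

definition ind_c :: q_ratfun where "ind_c = to_fract [:to_fract [:[:0, 1:]:]:]"
definition ind_d :: q_ratfun where "ind_d = to_fract [:to_fract [:0, 1:]:]"
definition ind_q :: q_ratfun where "ind_q = to_fract [:0, 1:]"

definition qpoch :: "'a::comm_ring_1 \<Rightarrow> 'a \<Rightarrow> nat \<Rightarrow> 'a" where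
  "qpoch x q k = (\<Prod>i<k. 1 - x * q ^ i)"

text \<open>In a field the division below is the usual one; in a polynomial ring it is the exact
  quotient of \<open>1 - q\<^sup>m\<close> by \<open>1 - q\<close> (lemma \<open>qnum_eq_sum\<close>). The first reading is used in the terms
  of the congruence, the second in its modulus.\<close>

definition qnum :: "'a::idom_divide \<Rightarrow> nat \<Rightarrow> 'a" where
  "qnum q m = (1 - q ^ m) div (1 - q)"

lemma qnum_eq_sum:
  fixes q :: "'a::idom_divide"
  assumes "q \<noteq> 1"
  shows "qnum q m = (\<Sum>i<m. q ^ i)"
  unfolding qnum_def using assms
  by (simp add: one_diff_power_eq)

text \<open>The cyclotomic polynomial is the integer polynomial whose image in \<open>\<complex>[X]\<close> is the product
  over the primitive \<open>n\<close>-th roots of unity; \<open>of_int_cyclotomic_poly\<close> shows that it exists.\<close>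

definition cyclotomic_complex :: "nat \<Rightarrow> complex poly" where
  "cyclotomic_complex n = (\<Prod>k\<in>totatives n. [:- cis (2 * pi * real k / real n), 1:])"

definition cyclotomic_poly :: "nat \<Rightarrow> int poly" where
  "cyclotomic_poly n = (THE p. map_poly of_int p = cyclotomic_complex n)"

text \<open>Congruence of rational functions over a field modulo a polynomial: the numerator of the
  difference in lowest terms is divisible by the modulus.\<close>

definition ratfun_cong :: "'a::field poly fract \<Rightarrow> 'a poly fract \<Rightarrow> 'a poly \<Rightarrow> bool" where
  "ratfun_cong A B P \<longleftrightarrow>
     (\<exists>a b. b \<noteq> 0 \<and> coprime a b \<and> A - B = Fract a b \<and> P dvd a)"

lemma of_int_poly_mult:
  "map_poly of_int (p * q) = (map_poly of_int p * map_poly of_int q :: complex poly)"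
  by (intro poly_eqI) (simp add: coeff_map_poly coeff_mult)

lemma of_int_poly_add:
  "map_poly of_int (p + q) = (map_poly of_int p + map_poly of_int q :: complex poly)"
  by (intro poly_eqI) (simp add: coeff_map_poly)

lemma of_int_poly_prod:
  "map_poly of_int (\<Prod>i\<in>A. p i) = (\<Prod>i\<in>A. map_poly of_int (p i) :: complex poly)"
  by (induction A rule: infinite_finite_induct) (simp_all add: of_int_poly_mult)

lemma of_int_poly_inj:
  assumes "map_poly of_int p = (map_poly of_int q :: complex poly)"
  shows "p = q"
proof (intro poly_eqI)
  fix n
  have "coeff (map_poly of_int p :: complex poly) n = coeff (map_poly of_int q) n"
    using assms by simp
  then show "coeff p n = coeff q n" by (simp add: coeff_map_poly)
qed

lemma degree_of_int_poly: "degree (map_poly of_int p :: complex poly) = degree p"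
  by (rule degree_map_poly) simp

lemma int_quotient_exists:
  fixes f g :: "int poly" and h :: "complex poly"
  assumes monic: "lead_coeff g = 1" and eq: "map_poly of_int f = map_poly of_int g * h"
  shows "\<exists>h'. h = map_poly of_int h'"
proof -
  obtain q r where qr: "pseudo_divmod f g = (q, r)" by force
  have g0: "g \<noteq> 0" using monic by auto
  have f: "f = g * q + r" using pseudo_divmod(1)[OF g0 qr] monic by simp
  have r: "r = 0 \<or> degree r < degree g" using pseudo_divmod(2)[OF g0 qr] .
  let ?I = "map_poly of_int :: int poly \<Rightarrow> complex poly"
  have Ir: "?I r = ?I g * (h - ?I q)"
    using eq unfolding f of_int_poly_mult of_int_poly_add by (simp add: algebra_simps)
  have Ig0: "?I g \<noteq> 0" using g0 of_int_poly_inj[of g 0] by auto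
  have "h - ?I q = 0"
  proof (rule ccontr)
    assume nz: "h - ?I q \<noteq> 0"
    then have "?I r \<noteq> 0" using Ir Ig0 by simp
    then have "degree r < degree g" using r by auto
    moreover have "degree (?I r) = degree (?I g) + degree (h - ?I q)"
      unfolding Ir by (rule degree_mult_eq[OF Ig0 nz])
    ultimately show False by (simp add: degree_of_int_poly)
  qed
  then show ?thesis by auto
qed

lemma prod_roots_of_unity:
  assumes n: "n > 0"
  shows "(\<Prod>k\<in>{0<..n}. [:- cis (2 * pi * real k / real n), 1:]) = monom 1 n - (1 :: complex poly)"
proof -
  let ?f = "\<lambda>k. cis (2 * pi * real k / real n)"
  have root: "?f k ^ n = 1" for k
  proof -
    have "?f k ^ n = cis (2 * pi) ^ k" using n by (simp add: DeMoivre mult_ac)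
    then show ?thesis by simp
  qed
  have fn: "?f n = ?f 0" using n by simp
  have surj: "\<exists>k\<in>{0<..n}. z = ?f k" if z: "z ^ n = 1" for z
  proof -
    from bij_betw_roots_unity[OF n] z obtain k where k: "k < n" "z = ?f k"
      unfolding bij_betw_def by auto
    show ?thesis
    proof (cases "k = 0")
      case True
      then have "z = ?f n" using k fn by metis
      then show ?thesis using n by (intro bexI[of _ n]) auto
    next
      case False
      then show ?thesis using k by auto
    qed
  qed
  let ?P = "\<Prod>k\<in>{0<..n}. [:- ?f k, 1:]" and ?Q = "monom 1 n - 1 :: complex poly"
  have dP: "degree ?P = n" by (subst degree_prod_eq_sum_degree) auto
  have lP: "lead_coeff ?P = 1" by (subst lead_coeff_prod) simp
  show ?thesis
  proof (rule poly_eqI_degree_lead_coeff[where n = n and A = "{z. z ^ n = 1}"])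
    show "coeff ?P n = coeff ?Q n" using lP n unfolding dP by simp
    show "card {z::complex. z ^ n = 1} \<ge> n" using card_roots_unity_eq[OF n] by simp
    show "degree ?P \<le> n" using dP by simp
    show "degree ?Q \<le> n" by (intro degree_diff_le degree_monom_le) simp
    fix z :: complex assume "z \<in> {z. z ^ n = 1}"
    then have z: "z ^ n = 1" by simp
    from surj[OF z] have "poly ?P z = 0" by (auto simp: poly_prod)
    then show "poly ?P z = poly ?Q z" using z by (simp add: poly_monom)
  qed
qed

lemma prod_cyclotomic_complex:
  assumes n: "n > 0"
  shows "(\<Prod>d | d dvd n. cyclotomic_complex d) = monom 1 n - 1"
proof -
  let ?g = "\<lambda>k. [:- cis (2 * pi * real k / real n), 1:]"
  have fin: "finite {d. d dvd n}" using n by simp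
  have "monom 1 n - 1 = (\<Prod>k\<in>{0<..n}. ?g k)" using prod_roots_of_unity[OF n] by simp
  also have "\<dots> = (\<Prod>d | d dvd n. \<Prod>k | k \<in> {0<..n} \<and> gcd k n = d. ?g k)"
    by (rule prod.group[symmetric]) (use n in auto)
  also have "\<dots> = (\<Prod>d | d dvd n. cyclotomic_complex (n div d))"
  proof (intro prod.cong refl)
    fix d assume "d \<in> {d. d dvd n}"
    then have d: "d dvd n" by simp
    have dpos: "d > 0" using d n by (auto intro: Nat.gr0I)
    have "(\<Prod>k | k \<in> {0<..n} \<and> gcd k n = d. ?g k) = (\<Prod>k\<in>totatives (n div d). ?g (k * d))"
      using prod.reindex_bij_betw[OF bij_betw_totatives_gcd_eq[OF d n], of ?g] by simp
    also have "\<dots> = cyclotomic_complex (n div d)"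
      unfolding cyclotomic_complex_def
    proof (intro prod.cong refl)
      fix k
      have "real (k * d) / real n = real k / real (n div d)"
        using d dpos n by (auto elim!: dvdE simp: field_simps)
      then show "?g (k * d) = [:- cis (2 * pi * real k / real (n div d)), 1:]"
        by (metis times_divide_eq_right)
    qed
    finally show "(\<Prod>k | k \<in> {0<..n} \<and> gcd k n = d. ?g k) = cyclotomic_complex (n div d)" .
  qed
  also have "\<dots> = (\<Prod>d | d dvd n. cyclotomic_complex d)"
    by (rule prod.reindex_bij_witness[of _ "\<lambda>d. n div d" "\<lambda>d. n div d"])
      (use n in \<open>auto elim!: dvdE\<close>)
  finally show ?thesis by simp
qed

lemma lead_coeff_cyclotomic_complex: "lead_coeff (cyclotomic_complex n) = 1"
  unfolding cyclotomic_complex_def by (subst lead_coeff_prod) simp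

lemma cyclotomic_complex_int:
  "n > 0 \<Longrightarrow> \<exists>p. map_poly of_int p = cyclotomic_complex n"
proof (induction n rule: less_induct)
  case (less n)
  let ?D = "{d. d dvd n} - {n}"
  have fin: "finite {d. d dvd n}" using less.prems by simp
  have "\<forall>d\<in>?D. \<exists>p. map_poly of_int p = cyclotomic_complex d"
  proof
    fix d assume "d \<in> ?D"
    then have "d dvd n" "d \<noteq> n" by auto
    then have "d < n" "d > 0" using less.prems by (auto dest: dvd_imp_le intro: Nat.gr0I)
    then show "\<exists>p. map_poly of_int p = cyclotomic_complex d" using less.IH by blast
  qed
  then obtain p where p: "\<And>d. d \<in> ?D \<Longrightarrow> map_poly of_int (p d) = cyclotomic_complex d"
    by metis
  define g where "g = (\<Prod>d\<in>?D. p d)"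
  have Ig: "map_poly of_int g = (\<Prod>d\<in>?D. cyclotomic_complex d)"
    unfolding g_def of_int_poly_prod by (intro prod.cong refl p)
  have "of_int (lead_coeff g) = lead_coeff (map_poly of_int g :: complex poly)"
    by (simp add: degree_of_int_poly coeff_map_poly)
  also have "\<dots> = 1"
    unfolding Ig by (subst lead_coeff_prod) (simp add: lead_coeff_cyclotomic_complex)
  finally have mon: "lead_coeff g = 1" by simp
  have "map_poly of_int (monom 1 n - 1 :: int poly) = (monom 1 n - 1 :: complex poly)"
    by (intro poly_eqI) (simp add: coeff_map_poly)
  also have "\<dots> = (\<Prod>d | d dvd n. cyclotomic_complex d)"
    using prod_cyclotomic_complex[OF less.prems] by simp
  also have "\<dots> = cyclotomic_complex n * (\<Prod>d\<in>?D. cyclotomic_complex d)"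
    using fin by (intro prod.remove) auto
  finally have "map_poly of_int (monom 1 n - 1 :: int poly) = map_poly of_int g * cyclotomic_complex n"
    by (simp add: Ig mult.commute)
  from int_quotient_exists[OF mon this] show ?case by metis
qed

lemma of_int_cyclotomic_poly:
  assumes "n > 0"
  shows "map_poly of_int (cyclotomic_poly n) = cyclotomic_complex n"
proof -
  obtain p where p: "map_poly of_int p = cyclotomic_complex n"
    using cyclotomic_complex_int[OF assms] by blast
  show ?thesis
    unfolding cyclotomic_poly_def
    by (rule theI[of _ p]) (use p of_int_poly_inj in metis)+
qed

end

theory Submission
  imports Defs
begin

text \<open>Deform three of the factors \<open>(q;q\<^sup>2)\<^sub>k\<close> on the left to \<open>(Xq;q\<^sup>2)\<^sub>k\<close>, \<open>(q/X;q\<^sup>2)\<^sub>k\<close>, \<open>(Bq;q\<^sup>2)\<^sub>k\<close>, with the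
  matching change of the denominators, and call the sum up to \<open>(n-1)/2\<close> \<open>S(X,B)\<close>. It is invariant
  under \<open>X \<mapsto> 1/X\<close>, so passing from \<open>X = 1\<close> to \<open>X = q\<^sup>n\<close> is a change of second order in \<open>1 - q\<^sup>n\<close>,
  while passing from \<open>B = 1\<close> to \<open>B = q\<^sup>-\<^sup>n\<close> is one of first order. The mixed difference
  \<open>S(1,1) - S(q\<^sup>n,1) - S(1,q\<^sup>-\<^sup>n) + S(q\<^sup>n,q\<^sup>-\<^sup>n)\<close> therefore has order three, and the antisymmetry
  \<open>k \<mapsto> (n-1)/2 - k\<close> of the summands modulo \<open>1 - q\<^sup>n\<close> raises the order to four. The last three
  values of \<open>S\<close> terminate naturally, so Watson's transformation evaluates them; combining their right
  sides in the same way gives the congruence modulo \<open>\<Phi>\<^sub>n(q)\<^sup>4\<close>, where the second-order term comes from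
  \<open>\<Sum> q\<^sup>2\<^sup>j / (1 - q\<^sup>2\<^sup>j)\<^sup>2 \<equiv> - (n\<^sup>2 - 1) / 24\<close> over \<open>1 \<le> j \<le> (n-1)/2\<close>. For the other divisors \<open>m\<close>
  of \<open>n\<close> both sides vanish modulo \<open>\<Phi>\<^sub>m(q)\<close> by the same antisymmetry, applied to blocks of
  \<open>m\<close> consecutive summands.\<close>

section \<open>Watson's transformation\<close>

text \<open>In the undeformed sum no numerator factor vanishes identically beyond
  \<open>k = (n-1)/2\<close>, so a terminating transformation cannot be applied to it; a parameter
  \<open>q^-n\<close> turns one factor into \<open>(q^(1-n);q^2)_k\<close>, which does vanish there.
  A single such replacement already changes the sum at order one or two, too coarse for a statement
  of order four. In the mixed difference the pure contributions of either deformation cancel. On the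
  right sides every evaluation carries the factor \<open>[n]\<close>, so their combination only has
  to be controlled to order three.

  The parameters \<open>c\<close> and \<open>d\<close> are never deformed; they only have to make
  all \<open>1 - q^j/c\<close> and \<open>1 - q^j/d\<close> invertible, which holds as soon as they
  are not roots of unity.

  Congruences are computed with explicit powers of \<open>1 - q^n\<close>, in a ring where the other
  factors \<open>1 - q^j\<close> are units. The cyclotomic factors of \<open>[n]\<close> are
  pairwise comaximal, so one such ring per divisor is enough. For a proper divisor the summation
  runs past non-invertible denominators; the summands are integral nevertheless, because
  \<open>(q;q^2)_k / (q^2;q^2)_k\<close> is essentially a central Gaussian binomial
  coefficient.\<close>

lemma qpoch_0 [simp]: "qpoch x q 0 = 1"
  by (simp add: qpoch_def)

lemma qpoch_Suc: "qpoch x q (Suc k) = qpoch x q k * (1 - x * q ^ k)"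
  by (simp add: qpoch_def)

lemma qpoch_add: "qpoch x q (j + i) = qpoch x q j * qpoch (x * q ^ j) q i"
  by (induction i) (simp_all add: qpoch_Suc power_add mult_ac)

lemma qpoch_Suc': "qpoch x q (Suc k) = (1 - x) * qpoch (x * q) q k"
  using qpoch_add[of x q 1 k] by (simp add: qpoch_Suc)

lemma qpoch_nonzero:
  fixes x q :: "'a::idom"
  assumes "\<And>i. i < k \<Longrightarrow> x * q ^ i \<noteq> 1"
  shows "qpoch x q k \<noteq> 0"
  using assms by (force simp: qpoch_def)

lemma qpoch_inverse_power_eq_0:
  fixes q :: "'a::field"
  assumes "q \<noteq> 0" "j < k"
  shows "qpoch (1 / q ^ j) q k = 0"
proof -
  have "1 - 1 / q ^ j * q ^ j = 0" using assms by simp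
  then have "\<exists>i\<in>{..<k}. 1 - 1 / q ^ j * q ^ i = 0" using assms(2) by blast
  then show ?thesis unfolding qpoch_def by (intro prod_zero) simp_all
qed

text \<open>In the next two proofs \<open>H\<close> is the certificate of a \<open>q\<close>-Zeilberger recurrence of order one:
  \<open>\<alpha> s(k+1, j) - \<beta> s(k, j) = H(j+1) - H(j)\<close>.\<close>

lemma q_saalschuetz:
  fixes a b c p :: "'a::field"
  assumes nz: "p \<noteq> 0" "b \<noteq> 0" "c \<noteq> 0"
    and p1: "\<And>i. p ^ Suc i \<noteq> 1" and a1: "\<And>i. a * p ^ i \<noteq> 1"
    and b1: "\<And>i. a * p / b * p ^ i \<noteq> 1" and c1: "\<And>i. a * p / c * p ^ i \<noteq> 1"
  shows "(\<Sum>j\<le>k. qpoch (1 / p ^ k) p j * qpoch (a * p ^ k) p j * qpoch (a * p / (b * c)) p j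
            / (qpoch p p j * qpoch (a * p / b) p j * qpoch (a * p / c) p j) * p ^ j)
       = qpoch b p k * qpoch c p k / (qpoch (a * p / b) p k * qpoch (a * p / c) p k)
           * (a * p / (b * c)) ^ k"
proof (induction k)
  case 0
  show ?case by simp
next
  case (Suc k)
  define s where "s k j = qpoch (1 / p ^ k) p j * qpoch (a * p ^ k) p j * qpoch (a * p / (b * c)) p j
            / (qpoch p p j * qpoch (a * p / b) p j * qpoch (a * p / c) p j) * p ^ j" for k j
  define x where "x = p ^ k"
  define \<alpha> where "\<alpha> = (1 - a * p / b * x) * (1 - a * p / c * x)"
  define \<beta> where "\<beta> = (1 - b * x) * (1 - c * x) * (a * p / (b * c))"
  define D where "D j = 1 / (qpoch p p j * qpoch (a * p / b) p j * qpoch (a * p / c) p j)" for j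
  define U where "U j = qpoch (1 / p ^ Suc k) p j" for j
  define V where "V j = qpoch (a * x) p j" for j
  define W where "W j = qpoch (a * p / (b * c)) p j" for j
  define K1 where "K1 = 1 - 1 / (x * p)"
  define K where "K = (1 - a * p * x ^ 2) / ((1 - a * x) * K1)"
  define H where "H j = K * (U j * V j * W j * D j)
      * ((1 - p ^ j) * (1 - a / b * p ^ j) * (1 - a / c * p ^ j))" for j
  have x0: "x \<noteq> 0" and ax: "1 - a * x \<noteq> 0" using nz a1[of k] by (auto simp: x_def)
  have xp: "x * p \<noteq> 1" using p1[of k] by (simp add: x_def mult.commute)
  then have xp': "K1 \<noteq> 0" using x0 nz by (auto simp: K1_def)
  have step: "\<alpha> * s (Suc k) j - \<beta> * s k j = H (Suc j) - H j" for j
  proof -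
    define y where "y = p ^ j"
    define Q where "Q = (1 - p * y) * (1 - a * p / b * y) * (1 - a * p / c * y)"
    have Q0: "Q \<noteq> 0" using p1[of j] b1[of j] c1[of j] by (auto simp: Q_def y_def)
    have Vs: "qpoch (a * p ^ Suc k) p j = V j * (1 - a * x * y) / (1 - a * x)"
    proof -
      have "V j * (1 - a * x * y) = (1 - a * x) * qpoch (a * x * p) p j"
        using qpoch_Suc[of "a * x" p j] qpoch_Suc'[of "a * x" p j] unfolding V_def y_def by simp
      then show ?thesis using ax by (simp add: x_def field_simps)
    qed
    have Us: "qpoch (1 / p ^ k) p j = U j * (1 - y / (x * p)) / K1"
    proof -
      have "U j * (1 - 1 / (x * p) * y) = K1 * qpoch (1 / (x * p) * p) p j"
        using qpoch_Suc[of "1 / (x * p)" p j] qpoch_Suc'[of "1 / (x * p)" p j]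
        unfolding U_def y_def x_def K1_def by (simp add: mult.commute)
      moreover have "1 / (x * p) * p = 1 / p ^ k" using nz by (simp add: x_def)
      ultimately have "U j * (1 - y / (x * p)) = K1 * qpoch (1 / p ^ k) p j"
        by (simp only: times_divide_eq_left mult_1)
      then show ?thesis using xp' by (metis nonzero_mult_div_cancel_left)
    qed
    have DS: "D (Suc j) = D j / Q"
      unfolding D_def Q_def y_def by (simp add: qpoch_Suc mult_ac)
    have US: "U (Suc j) = U j * (1 - y / (x * p))"
      unfolding U_def y_def x_def by (simp add: qpoch_Suc mult_ac)
    have VS: "V (Suc j) = V j * (1 - a * x * y)"
      unfolding V_def y_def by (simp add: qpoch_Suc mult_ac)
    have WS: "W (Suc j) = W j * (1 - a * p / (b * c) * y)"
      unfolding W_def y_def by (simp add: qpoch_Suc mult_ac)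
    have pj: "p ^ Suc j = p * y" "p ^ j = y" by (auto simp: y_def)
    define T where "T = U j * V j * W j * D j / ((1 - a * x) * K1)"
    have e1: "s (Suc k) j = T * ((1 - a * x * y) * K1 * y)"
    proof -
      have "s (Suc k) j = U j * (V j * (1 - a * x * y) / (1 - a * x)) * W j * D j * y"
        unfolding s_def Vs by (simp add: U_def W_def D_def y_def)
      then show ?thesis unfolding T_def using ax xp' by (simp add: mult_ac)
    qed
    have e2: "s k j = T * ((1 - y / (x * p)) * (1 - a * x) * y)"
    proof -
      have "s k j = (U j * (1 - y / (x * p)) / K1) * V j * W j * D j * y"
        unfolding s_def Us by (simp add: V_def W_def D_def y_def x_def)
      then show ?thesis unfolding T_def using ax xp' by (simp add: mult_ac)
    qed
    have e3: "H (Suc j) = T * (1 - a * p * x ^ 2) *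
        ((1 - y / (x * p)) * (1 - a * x * y) * (1 - a * p / (b * c) * y))"
    proof -
      have Qe: "(1 - p * y) * (1 - a / b * (p * y)) * (1 - a / c * (p * y)) = Q"
        by (simp add: Q_def mult.assoc)
      have "H (Suc j) = K * (U j * (1 - y / (x * p)) * (V j * (1 - a * x * y))
          * (W j * (1 - a * p / (b * c) * y))
          * (D j / Q))
          * Q"
        unfolding H_def US VS WS DS pj by (simp only: Qe)
      also have "\<dots> = K * (U j * (1 - y / (x * p)) * (V j * (1 - a * x * y))
          * (W j * (1 - a * p / (b * c) * y)) * D j)"
        using Q0 by simp
      finally show ?thesis unfolding K_def T_def by simp
    qed
    have e4: "H j = T * (1 - a * p * x ^ 2) * ((1 - y) * (1 - a / b * y) * (1 - a / c * y))"
      unfolding H_def pj K_def T_def by simp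
    \<comment> \<open>After division by the common factor \<open>T\<close> the recurrence is an
      identity of rational functions in which \<open>x = p ^ k\<close> and \<open>y = p ^ j\<close>
      are independent variables.\<close>
    have "\<alpha> * ((1 - a * x * y) * K1 * y) - \<beta> * ((1 - y / (x * p)) * (1 - a * x) * y)
       = (1 - a * p * x ^ 2) * ((1 - y / (x * p)) * (1 - a * x * y) * (1 - a * p / (b * c) * y)
          - (1 - y) * (1 - a / b * y) * (1 - a / c * y))"
      unfolding \<alpha>_def \<beta>_def K1_def using nz x0
      by (simp add: divide_simps) (simp add: algebra_simps power2_eq_square)
    then show ?thesis unfolding e1 e2 e3 e4
      by (simp only: mult.left_commute[of _ T] mult.assoc[of T] right_diff_distrib[symmetric])
  qed
  \<comment> \<open>Both sums run to \<open>Suc k\<close>, one term too far for \<open>s k\<close>;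
    that term is zero. The telescoped ends vanish too: \<open>H 0\<close> by its factor
    \<open>1 - p ^ 0\<close>, and \<open>H (Suc (Suc k))\<close> by
    \<open>(p^-(k+1);p)_(k+2)\<close>.\<close>
  have "\<alpha> * (\<Sum>j\<le>Suc k. s (Suc k) j) - \<beta> * (\<Sum>j\<le>Suc k. s k j) = (\<Sum>j\<le>Suc k. H (Suc j) - H j)"
    by (simp only: sum_distrib_left sum_subtractf[symmetric] step)
  also have "\<dots> = H (Suc (Suc k)) - H 0"
    using sum_lessThan_telescope[of H "Suc (Suc k)"] by (simp only: lessThan_Suc_atMost)
  also have "\<dots> = 0"
    using qpoch_inverse_power_eq_0[OF nz(1), of "Suc k" "Suc (Suc k)"] by (simp add: H_def U_def)
  finally have "\<alpha> * (\<Sum>j\<le>Suc k. s (Suc k) j) = \<beta> * (\<Sum>j\<le>Suc k. s k j)" by simp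
  also have "(\<Sum>j\<le>Suc k. s k j) = (\<Sum>j\<le>k. s k j)"
    using qpoch_inverse_power_eq_0[OF nz(1), of k "Suc k"] by (simp add: s_def)
  also have "\<dots> = qpoch b p k * qpoch c p k / (qpoch (a * p / b) p k * qpoch (a * p / c) p k)
           * (a * p / (b * c)) ^ k"
    using Suc.IH unfolding s_def .
  finally have fin: "\<alpha> * (\<Sum>j\<le>Suc k. s (Suc k) j) = \<beta> * \<dots>" .
  have \<alpha>0: "\<alpha> \<noteq> 0" using b1[of k] c1[of k] by (auto simp: \<alpha>_def x_def)
  have "(\<Sum>j\<le>Suc k. s (Suc k) j) = \<beta> * (qpoch b p k * qpoch c p k / (qpoch (a * p / b) p k * qpoch (a * p / c) p k)
           * (a * p / (b * c)) ^ k) / \<alpha>"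
    using fin \<alpha>0 by (metis nonzero_mult_div_cancel_left)
  also have "\<dots> = qpoch b p (Suc k) * qpoch c p (Suc k) / (qpoch (a * p / b) p (Suc k) * qpoch (a * p / c) p (Suc k))
           * (a * p / (b * c)) ^ Suc k"
    unfolding \<alpha>_def \<beta>_def x_def by (simp add: qpoch_Suc mult_ac)
  finally show ?case unfolding s_def .
qed

lemma very_well_poised_6phi5:
  fixes a d e p :: "'a::field"
  assumes nz: "p \<noteq> 0" "d \<noteq> 0" "e \<noteq> 0"
    and p1: "\<And>i. p ^ Suc i \<noteq> 1" and a1: "\<And>i. a * p ^ i \<noteq> 1"
    and d1: "\<And>i. a * p / d * p ^ i \<noteq> 1" and e1: "\<And>i. a * p / e * p ^ i \<noteq> 1"
  shows "(\<Sum>k\<le>N. (1 - a * p ^ (2 * k)) / (1 - a)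
            * (qpoch a p k * qpoch d p k * qpoch e p k * qpoch (1 / p ^ N) p k)
            / (qpoch p p k * qpoch (a * p / d) p k * qpoch (a * p / e) p k * qpoch (a * p ^ Suc N) p k)
            * (a * p ^ Suc N / (d * e)) ^ k)
       = qpoch (a * p) p N * qpoch (a * p / (d * e)) p N / (qpoch (a * p / d) p N * qpoch (a * p / e) p N)"
proof (induction N)
  case 0
  show ?case using a1[of 0] by simp
next
  case (Suc N)
  define s where "s N k = (1 - a * p ^ (2 * k)) / (1 - a)
            * (qpoch a p k * qpoch d p k * qpoch e p k * qpoch (1 / p ^ N) p k)
            / (qpoch p p k * qpoch (a * p / d) p k * qpoch (a * p / e) p k * qpoch (a * p ^ Suc N) p k)
            * (a * p ^ Suc N / (d * e)) ^ k" for N k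
  define x where "x = p ^ N"
  define \<alpha> where "\<alpha> = (1 - a * p / d * x) * (1 - a * p / e * x)"
  define \<beta> where "\<beta> = (1 - a * p * x) * (1 - a * p / (d * e) * x)"
  define D where "D k = qpoch a p k * qpoch d p k * qpoch e p k
      / (qpoch p p k * qpoch (a * p / d) p k * qpoch (a * p / e) p k)" for k
  define U where "U k = qpoch (1 / p ^ Suc N) p k" for k
  define V where "V k = qpoch (a * (x * p)) p k" for k
  define Z where "Z k = (a * (x * p) / (d * e)) ^ k" for k
  define K1 where "K1 = 1 - 1 / (x * p)"
  define K where "K = (1 - a * p * x) / ((1 - a) * K1)"
  define H where "H k = K * (D k * U k / V k * Z k)
      * ((1 - p ^ k) * (1 - a / d * p ^ k) * (1 - a / e * p ^ k))" for k
  have x0: "x \<noteq> 0" and axp: "1 - a * x * p \<noteq> 0" using nz a1[of "Suc N"]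
    by (auto simp: x_def mult_ac)
  have a10: "1 - a \<noteq> 0" using a1[of 0] by simp
  have xp: "x * p \<noteq> 1" using p1[of N] by (simp add: x_def mult.commute)
  then have xp': "K1 \<noteq> 0" using x0 nz by (auto simp: K1_def)
  have V0: "V k \<noteq> 0" for k
    unfolding V_def
  proof (rule qpoch_nonzero)
    show "a * (x * p) * p ^ i \<noteq> 1" for i
      using a1[of "Suc N + i"] by (simp add: x_def power_add mult_ac)
  qed
  have step: "\<alpha> * s (Suc N) k - \<beta> * s N k = H (Suc k) - H k" for k
  proof -
    define y where "y = p ^ k"
    have y0: "y \<noteq> 0" using nz by (simp add: y_def)
    have axpy: "1 - a * x * p * y \<noteq> 0" using a1[of "Suc N + k"]
      by (auto simp: x_def y_def power_add mult_ac)
    define Q where "Q = (1 - p * y) * (1 - a * p / d * y) * (1 - a * p / e * y)"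
    have Q0: "Q \<noteq> 0" using p1[of k] d1[of k] e1[of k] by (auto simp: Q_def y_def)
    have Vs: "qpoch (a * p ^ Suc (Suc N)) p k = V k * (1 - a * x * p * y) / (1 - a * x * p)"
    proof -
      have "V k * (1 - a * x * p * y) = (1 - a * x * p) * qpoch (a * x * p * p) p k"
        using qpoch_Suc[of "a * x * p" p k] qpoch_Suc'[of "a * x * p" p k]
        unfolding V_def y_def by (simp add: mult_ac)
      then show ?thesis using axp by (simp add: x_def field_simps)
    qed
    have Us: "qpoch (1 / p ^ N) p k = U k * (1 - y / (x * p)) / K1"
    proof -
      have "U k * (1 - 1 / (x * p) * y) = K1 * qpoch (1 / (x * p) * p) p k"
        using qpoch_Suc[of "1 / (x * p)" p k] qpoch_Suc'[of "1 / (x * p)" p k]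
        unfolding U_def y_def x_def K1_def by (simp add: mult.commute)
      moreover have "1 / (x * p) * p = 1 / p ^ N" using nz by (simp add: x_def)
      ultimately have "U k * (1 - y / (x * p)) = K1 * qpoch (1 / p ^ N) p k"
        by (simp only: times_divide_eq_left mult_1)
      then show ?thesis using xp' by (metis nonzero_mult_div_cancel_left)
    qed
    have DS: "D (Suc k) = D k * ((1 - a * y) * (1 - d * y) * (1 - e * y))
        / Q"
      unfolding D_def Q_def y_def by (simp add: qpoch_Suc mult_ac)
    have US: "U (Suc k) = U k * (1 - y / (x * p))"
      unfolding U_def y_def x_def by (simp add: qpoch_Suc mult_ac)
    have VS: "V (Suc k) = V k * (1 - a * x * p * y)"
      unfolding V_def y_def by (simp add: qpoch_Suc mult_ac)
    have ZS: "Z (Suc k) = Z k * (a * (x * p) / (d * e))"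
      unfolding Z_def by (simp add: mult_ac)
    have pk: "p ^ Suc k = p * y" "p ^ k = y" "p ^ (2 * k) = y ^ 2"
      by (auto simp: y_def power_mult[symmetric] mult.commute)
    define T where "T = D k * U k / V k * Z k / ((1 - a) * K1 * (1 - a * x * p * y))"
    have e1: "s (Suc N) k = T * ((1 - a * y ^ 2) * (1 - a * x * p) * K1 * y)"
    proof -
      have "s (Suc N) k = (1 - a * y ^ 2) / (1 - a) * D k * U k
          / (V k * (1 - a * x * p * y) / (1 - a * x * p)) * (Z k * y)"
        unfolding s_def Vs pk
        by (simp add: U_def D_def Z_def y_def x_def power_mult_distrib power_divide mult_ac)
      then show ?thesis unfolding T_def using axp xp' axpy by (simp add: mult_ac)
    qed
    have e2: "s N k = T * ((1 - a * y ^ 2) * (1 - y / (x * p)) * (1 - a * x * p * y))"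
    proof -
      have "s N k = (1 - a * y ^ 2) / (1 - a) * D k * (U k * (1 - y / (x * p)) / K1)
          / V k * Z k"
        unfolding s_def Us pk by (simp add: V_def D_def Z_def x_def mult_ac)
      then show ?thesis unfolding T_def using axp xp' axpy by (simp add: mult_ac)
    qed
    have e3: "H (Suc k) = T * (1 - a * p * x) *
        ((1 - y / (x * p)) * (1 - a * y) * (1 - d * y) * (1 - e * y) * (a * (x * p) / (d * e)))"
    proof -
      have Qe: "(1 - p * y) * (1 - a / d * (p * y)) * (1 - a / e * (p * y)) = Q"
        by (simp add: Q_def mult.assoc)
      have "H (Suc k) = K * (D k * ((1 - a * y) * (1 - d * y) * (1 - e * y))
        / Q
          * (U k * (1 - y / (x * p))) / (V k * (1 - a * x * p * y)) * (Z k * (a * (x * p) / (d * e))))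
          * Q"
        unfolding H_def US VS ZS DS pk by (simp only: Qe)
      also have "\<dots> = K * (D k * ((1 - a * y) * (1 - d * y) * (1 - e * y))
          * (U k * (1 - y / (x * p))) / (V k * (1 - a * x * p * y)) * (Z k * (a * (x * p) / (d * e))))"
        using Q0 by (simp add: mult_ac)
      finally show ?thesis unfolding K_def T_def by (simp add: mult_ac)
    qed
    have e4: "H k = T * (1 - a * p * x) * ((1 - y) * (1 - a / d * y) * (1 - a / e * y) * (1 - a * x * p * y))"
      unfolding H_def pk K_def T_def using axpy by (simp add: mult_ac)
    have "\<alpha> * ((1 - a * y ^ 2) * (1 - a * x * p) * K1 * y)
          - \<beta> * ((1 - a * y ^ 2) * (1 - y / (x * p)) * (1 - a * x * p * y))
       = (1 - a * p * x) *
        ((1 - y / (x * p)) * (1 - a * y) * (1 - d * y) * (1 - e * y) * (a * (x * p) / (d * e))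
          - (1 - y) * (1 - a / d * y) * (1 - a / e * y) * (1 - a * x * p * y))"
      unfolding \<alpha>_def \<beta>_def K1_def using nz x0
      by (simp add: divide_simps) (simp add: algebra_simps power2_eq_square)
    then show ?thesis unfolding e1 e2 e3 e4
      by (simp only: mult.left_commute[of _ T] mult.assoc[of T] right_diff_distrib[symmetric])
  qed
  have "\<alpha> * (\<Sum>k\<le>Suc N. s (Suc N) k) - \<beta> * (\<Sum>k\<le>Suc N. s N k) = (\<Sum>k\<le>Suc N. H (Suc k) - H k)"
    by (simp only: sum_distrib_left sum_subtractf[symmetric] step)
  also have "\<dots> = H (Suc (Suc N)) - H 0"
    using sum_lessThan_telescope[of H "Suc (Suc N)"] by (simp only: lessThan_Suc_atMost)
  also have "\<dots> = 0"
    using qpoch_inverse_power_eq_0[OF nz(1), of "Suc N" "Suc (Suc N)"] by (simp add: H_def U_def)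
  finally have "\<alpha> * (\<Sum>k\<le>Suc N. s (Suc N) k) = \<beta> * (\<Sum>k\<le>Suc N. s N k)" by simp
  also have "(\<Sum>k\<le>Suc N. s N k) = (\<Sum>k\<le>N. s N k)"
    using qpoch_inverse_power_eq_0[OF nz(1), of N "Suc N"] by (simp add: s_def)
  also have "\<dots> = qpoch (a * p) p N * qpoch (a * p / (d * e)) p N / (qpoch (a * p / d) p N * qpoch (a * p / e) p N)"
    using Suc.IH unfolding s_def .
  finally have fin: "\<alpha> * (\<Sum>k\<le>Suc N. s (Suc N) k) = \<beta> * \<dots>" .
  have \<alpha>0: "\<alpha> \<noteq> 0" using d1[of N] e1[of N] by (auto simp: \<alpha>_def x_def)
  have "(\<Sum>k\<le>Suc N. s (Suc N) k) = \<beta> * (qpoch (a * p) p N * qpoch (a * p / (d * e)) p N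
      / (qpoch (a * p / d) p N * qpoch (a * p / e) p N)) / \<alpha>"
    using fin \<alpha>0 by (metis nonzero_mult_div_cancel_left)
  also have "\<dots> = qpoch (a * p) p (Suc N) * qpoch (a * p / (d * e)) p (Suc N)
      / (qpoch (a * p / d) p (Suc N) * qpoch (a * p / e) p (Suc N))"
    unfolding \<alpha>_def \<beta>_def x_def by (simp add: qpoch_Suc mult_ac)
  finally show ?case unfolding s_def .
qed

text \<open>By \<open>1 - p^-m = - p^-m (1 - p^m)\<close>, a symbol with negative exponents is a
  sign and a power of \<open>p\<close> times a quotient of ordinary symbols. The signs on both sides
  agree and the powers differ by \<open>p ^ (i * j)\<close>.\<close>

lemma qpoch_inverse_power_shift:
  fixes p :: "'a::field"
  assumes "p \<noteq> 0"
  shows "qpoch (1 / p ^ (j + i)) p j * qpoch p p i * p ^ (i * j) * qpoch p p j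
       = qpoch (1 / p ^ j) p j * qpoch p p (j + i)"
proof (induction i)
  case 0
  show ?case by simp
next
  case (Suc i)
  define x where "x = 1 / p ^ (j + Suc i)"
  define P where "P = p ^ Suc i"
  have P0: "P \<noteq> 0" and pj0: "p ^ j \<noteq> 0" using assms by (auto simp: P_def)
  have x: "x = 1 / (p ^ j * P)" by (simp add: x_def P_def power_add mult_ac)
  have xp: "x * p = 1 / p ^ (j + i)" using assms by (simp add: x_def)
  have "qpoch x p j * (1 - x * p ^ j) = (1 - x) * qpoch (1 / p ^ (j + i)) p j"
    using qpoch_Suc[of x p j] qpoch_Suc'[of x p j] by (simp add: xp)
  then have "(qpoch x p j * (1 - x * p ^ j)) * (p ^ j * P)
      = ((1 - x) * qpoch (1 / p ^ (j + i)) p j) * (p ^ j * P)" by simp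
  moreover have "(1 - x * p ^ j) * (p ^ j * P) = - (1 - P) * p ^ j"
    "(1 - x) * (p ^ j * P) = - (1 - p ^ j * P)"
    using P0 pj0 unfolding x by (simp_all add: field_simps)
  ultimately have "qpoch x p j * ((1 - P) * p ^ j) = (1 - p ^ j * P) * qpoch (1 / p ^ (j + i)) p j"
    by (metis (no_types, opaque_lifting) minus_mult_left minus_mult_right minus_minus mult.assoc
        mult.commute mult.left_commute)
  then have step: "qpoch x p j * (1 - P) * p ^ j = (1 - p ^ j * P) * qpoch (1 / p ^ (j + i)) p j"
    by (simp add: mult_ac)
  have "qpoch x p j * qpoch p p (Suc i) * p ^ (Suc i * j) * qpoch p p j
      = (qpoch x p j * (1 - P) * p ^ j) * (qpoch p p i * p ^ (i * j) * qpoch p p j)"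
    by (simp add: qpoch_Suc P_def power_add mult_ac)
  also have "\<dots> = (1 - p ^ j * P)
      * (qpoch (1 / p ^ (j + i)) p j * qpoch p p i * p ^ (i * j) * qpoch p p j)"
    unfolding step by (simp add: mult_ac)
  also have "\<dots> = qpoch (1 / p ^ j) p j * qpoch p p (j + Suc i)"
    unfolding Suc.IH by (simp add: qpoch_Suc P_def power_add mult_ac)
  finally show ?case unfolding x_def .
qed

text \<open>Reversal of the factors by \<open>1 - v / p^m = - (v / p^m) (1 - p^m / v)\<close>; the
  quotient of \<open>qpoch (1 / p ^ j) p j\<close> by \<open>qpoch p p j\<close> is exactly the
  resulting sign and power of \<open>p\<close>.\<close>

lemma qpoch_reverse:
  fixes p v :: "'a::field"
  assumes "p \<noteq> 0" "v \<noteq> 0"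
  shows "qpoch (v / p ^ j) p j * qpoch p p j = v ^ j * qpoch (1 / p ^ j) p j * qpoch (p / v) p j"
proof (induction j)
  case 0
  show ?case by simp
next
  case (Suc j)
  define P where "P = p ^ Suc j"
  have P0: "P \<noteq> 0" using assms by (auto simp: P_def)
  have s: "qpoch (v / p ^ Suc j) p (Suc j) = (1 - v / P) * qpoch (v / p ^ j) p j" for v
  proof -
    have "v / P * p = v / p ^ j" using assms by (simp add: P_def)
    then show ?thesis using qpoch_Suc'[of "v / P" p j] by (simp add: P_def)
  qed
  have "qpoch (v / p ^ Suc j) p (Suc j) * qpoch p p (Suc j)
      = ((1 - v / P) * (1 - P)) * (qpoch (v / p ^ j) p j * qpoch p p j)"
    unfolding s qpoch_Suc[of p] qpoch_Suc[of "p / v"] by (simp add: P_def mult_ac)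
  also have "(1 - v / P) * (1 - P) = v * (1 - 1 / P) * (1 - P / v)"
    using P0 assms by (simp add: field_simps)
  finally show ?case
    unfolding Suc.IH s qpoch_Suc[of p] qpoch_Suc[of "p / v"] by (simp add: P_def mult_ac)
qed

text \<open>Expand the factors containing \<open>b\<close> and \<open>c\<close> by the Saalschuetz sum and interchange the two
  summations; the inner sum is then a \<open>\<^sub>6\<phi>\<^sub>5\<close>.\<close>

theorem watson_8phi7:
  fixes a b c d e p :: "'a::field"
  assumes nz: "p \<noteq> 0" "a \<noteq> 0" "b \<noteq> 0" "c \<noteq> 0" "d \<noteq> 0" "e \<noteq> 0"
    and p1: "\<And>i. p ^ Suc i \<noteq> 1" and a1: "\<And>i. a * p ^ i \<noteq> 1"
    and b1: "\<And>i. a * p / b * p ^ i \<noteq> 1" and c1: "\<And>i. a * p / c * p ^ i \<noteq> 1"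
    and d1: "\<And>i. a * p / d * p ^ i \<noteq> 1" and e1: "\<And>i. a * p / e * p ^ i \<noteq> 1"
    and f1: "\<And>i. i < N \<Longrightarrow> d * e / (a * p ^ N) * p ^ i \<noteq> 1"
  shows "(\<Sum>k\<le>N. (1 - a * p ^ (2 * k)) / (1 - a)
            * (qpoch a p k * qpoch b p k * qpoch c p k * qpoch d p k * qpoch e p k * qpoch (1 / p ^ N) p k)
            / (qpoch p p k * qpoch (a * p / b) p k * qpoch (a * p / c) p k
                * qpoch (a * p / d) p k * qpoch (a * p / e) p k * qpoch (a * p ^ Suc N) p k)
            * (a ^ 2 * p ^ (N + 2) / (b * c * d * e)) ^ k)
       = qpoch (a * p) p N * qpoch (a * p / (d * e)) p N / (qpoch (a * p / d) p N * qpoch (a * p / e) p N)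
          * (\<Sum>j\<le>N. qpoch (a * p / (b * c)) p j * qpoch d p j * qpoch e p j * qpoch (1 / p ^ N) p j
              / (qpoch p p j * qpoch (a * p / b) p j * qpoch (a * p / c) p j
                  * qpoch (d * e / (a * p ^ N)) p j) * p ^ j)"
    (is "?L = ?P * ?R")
proof -
  define z where "z = a * p ^ Suc N / (d * e)"
  define w where "w = a * p / (d * e)"
  have z0: "z \<noteq> 0" using nz by (simp add: z_def)
  define L where "L k = (1 - a * p ^ (2 * k)) / (1 - a)
      * (qpoch a p k * qpoch d p k * qpoch e p k * qpoch (1 / p ^ N) p k)
      / (qpoch p p k * qpoch (a * p / d) p k * qpoch (a * p / e) p k * qpoch (a * p ^ Suc N) p k) * z ^ k" for k
  define W where "W j = qpoch (a * p / (b * c)) p j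
            / (qpoch p p j * qpoch (a * p / b) p j * qpoch (a * p / c) p j) * p ^ j" for j
  have pp0: "qpoch p p k \<noteq> 0" for k using p1 by (intro qpoch_nonzero) simp
  have pow1: "u * p ^ j * p ^ i = u * p ^ (j + i)" for u i j by (simp add: power_add)
  have d0: "qpoch (a * p / d) p k \<noteq> 0" "qpoch (a * p / d * p ^ j) p k \<noteq> 0" for k j
    using d1 by (intro qpoch_nonzero; simp only: pow1; simp)+
  have e0: "qpoch (a * p / e) p k \<noteq> 0" "qpoch (a * p / e * p ^ j) p k \<noteq> 0" for k j
    using e1 by (intro qpoch_nonzero; simp only: pow1; simp)+
  have aN0: "qpoch (a * p ^ j) p k \<noteq> 0" for j k
    using a1 by (intro qpoch_nonzero; simp only: pow1; simp)
  have f0: "qpoch (d * e / (a * p ^ N)) p j \<noteq> 0" if "j \<le> N" for j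
    using f1 that by (intro qpoch_nonzero) simp
  have a10: "1 - a \<noteq> 0" using a1[of 0] by simp
  define C where "C j = (1 - a * p ^ (2 * j)) / (1 - a) * (qpoch a p (2 * j) * qpoch d p j * qpoch e p j
      * qpoch (1 / p ^ N) p j) / (qpoch (a * p / d) p j * qpoch (a * p / e) p j * qpoch (a * p ^ Suc N) p j)
      * z ^ j * (qpoch (1 / p ^ j) p j / qpoch p p j)" for j
  define t where "t j i = (1 - (a * p ^ (2 * j)) * p ^ (2 * i)) / (1 - a * p ^ (2 * j))
            * (qpoch (a * p ^ (2 * j)) p i * qpoch (d * p ^ j) p i * qpoch (e * p ^ j) p i * qpoch (1 / p ^ (N - j)) p i)
            / (qpoch p p i * qpoch (a * p ^ (2 * j) * p / (d * p ^ j)) p i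
                * qpoch (a * p ^ (2 * j) * p / (e * p ^ j)) p i * qpoch (a * p ^ (2 * j) * p ^ Suc (N - j)) p i)
            * (a * p ^ (2 * j) * p ^ Suc (N - j) / ((d * p ^ j) * (e * p ^ j))) ^ i" for j i
  have ad: "a * p ^ (2 * j) * p / (d * p ^ j) = a * p / d * p ^ j"
    "a * p ^ (2 * j) * p / (e * p ^ j) = a * p / e * p ^ j"
    "a * p ^ (2 * j) * p / (d * p ^ j * (e * p ^ j)) = w" for j
    using nz unfolding mult_2 power_add by (simp_all add: w_def)
  \<comment> \<open>With \<open>k = j + i\<close> the product splits into a factor in
    \<open>j\<close> alone and a \<open>6phi5\<close> summand in \<open>i\<close> whose parameters
    \<open>a, d, e, N\<close> have become \<open>a p^(2j), d p^j, e p^j, N - j\<close>.\<close>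
  have key: "L (j + i) * (qpoch (1 / p ^ (j + i)) p j * qpoch (a * p ^ (j + i)) p j) = C j * t j i"
    if jN: "j \<le> N" for j i
  proof -
    have N: "N = j + (N - j)" using jN by simp
    have e1: "qpoch (1 / p ^ (j + i)) p j = qpoch (1 / p ^ j) p j * qpoch p p (j + i)
        / (qpoch p p i * p ^ (i * j) * qpoch p p j)"
      using qpoch_inverse_power_shift[OF nz(1), of j i] pp0 nz by (simp add: field_simps)
    have e2: "qpoch a p (j + i) * qpoch (a * p ^ (j + i)) p j = qpoch a p (2 * j) * qpoch (a * p ^ (2 * j)) p i"
      using qpoch_add[of a p "j + i" j] qpoch_add[of a p "2 * j" i] by (simp add: mult_2 add_ac)
    have e3: "qpoch (1 / p ^ N) p (j + i) = qpoch (1 / p ^ N) p j * qpoch (1 / p ^ (N - j)) p i"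
    proof -
      have "1 / p ^ N * p ^ j = 1 / p ^ (N - j)"
        by (subst (1) N) (use nz in \<open>simp add: power_add\<close>)
      then show ?thesis by (simp only: qpoch_add)
    qed
    have e4: "qpoch (a * p ^ Suc N) p (j + i) = qpoch (a * p ^ Suc N) p j
        * qpoch (a * p ^ (2 * j) * p ^ Suc (N - j)) p i"
    proof -
      have "a * p ^ Suc N * p ^ j = a * p ^ (2 * j) * p ^ Suc (N - j)"
      proof -
        have "a * p ^ Suc (j + m) * p ^ j = a * p ^ (2 * j) * p ^ Suc m" for m
          unfolding mult_2 power_add power_Suc by (simp only: mult_ac)
        from this[of "N - j"] show ?thesis using jN by simp
      qed
      then show ?thesis by (simp only: qpoch_add)
    qed
    have e5: "a * p ^ (2 * j) * p ^ Suc (N - j) / ((d * p ^ j) * (e * p ^ j)) = z / p ^ j"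
      unfolding z_def by (subst (2) N) (use nz in \<open>simp add: power_add mult_2\<close>)
    have e6: "1 - a * p ^ (2 * (j + i)) = 1 - (a * p ^ (2 * j)) * p ^ (2 * i)"
      by (simp add: power_add algebra_simps)
    have aj: "1 - a * p ^ (2 * j) \<noteq> 0" using a1[of "2 * j"] by simp
    have e7: "z ^ (j + i) = z ^ j * ((z / p ^ j) ^ i * p ^ (i * j))"
      using nz by (simp add: power_add power_divide power_mult[symmetric] mult.commute)
    have "L (j + i) * (qpoch (1 / p ^ (j + i)) p j * qpoch (a * p ^ (j + i)) p j)
        = (1 - (a * p ^ (2 * j)) * p ^ (2 * i)) / (1 - a)
      * ((qpoch a p (j + i) * qpoch (a * p ^ (j + i)) p j) * qpoch d p (j + i) * qpoch e p (j + i)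
           * (qpoch (1 / p ^ N) p j * qpoch (1 / p ^ (N - j)) p i))
      / (qpoch p p (j + i) * qpoch (a * p / d) p (j + i) * qpoch (a * p / e) p (j + i)
           * (qpoch (a * p ^ Suc N) p j * qpoch (a * p ^ (2 * j) * p ^ Suc (N - j)) p i))
      * (z ^ j * ((z / p ^ j) ^ i * p ^ (i * j)))
      * (qpoch (1 / p ^ j) p j * qpoch p p (j + i) / (qpoch p p i * p ^ (i * j) * qpoch p p j))"
      unfolding L_def e1 e3 e4 e6 e7 by (simp only: mult_ac times_divide_eq_left times_divide_eq_right)
    also have "\<dots> = (1 - (a * p ^ (2 * j)) * p ^ (2 * i)) / (1 - a)
      * ((qpoch a p (2 * j) * qpoch (a * p ^ (2 * j)) p i)
           * (qpoch d p j * qpoch (d * p ^ j) p i) * (qpoch e p j * qpoch (e * p ^ j) p i)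
           * (qpoch (1 / p ^ N) p j * qpoch (1 / p ^ (N - j)) p i))
      / ((qpoch (a * p / d) p j * qpoch (a * p / d * p ^ j) p i)
           * (qpoch (a * p / e) p j * qpoch (a * p / e * p ^ j) p i)
           * (qpoch (a * p ^ Suc N) p j * qpoch (a * p ^ (2 * j) * p ^ Suc (N - j)) p i))
      * (z ^ j * (z / p ^ j) ^ i)
      * (qpoch (1 / p ^ j) p j / (qpoch p p i * qpoch p p j))"
      unfolding e2 qpoch_add[of d] qpoch_add[of e] qpoch_add[of "a * p / d"] qpoch_add[of "a * p / e"]
      using pp0[of "j + i"] nz by (simp add: mult_ac)
    also have "\<dots> = C j * t j i"
      unfolding C_def t_def e5 ad using aj by (simp add: mult_ac)
    finally show ?thesis .
  qed
  have inner: "(\<Sum>i\<le>N - j. t j i) = qpoch (a * p ^ (2 * j) * p) p (N - j) * qpoch w p (N - j)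
        / (qpoch (a * p / d * p ^ j) p (N - j) * qpoch (a * p / e * p ^ j) p (N - j))" for j
    unfolding t_def
  proof (subst very_well_poised_6phi5)
    show "a * p ^ (2 * j) * p ^ i \<noteq> 1" for i using a1[of "2 * j + i"] by (simp only: pow1 not_False_eq_True)
    show "a * p ^ (2 * j) * p / (d * p ^ j) * p ^ i \<noteq> 1" for i
      using d1[of "j + i"] by (simp only: ad pow1 not_False_eq_True)
    show "a * p ^ (2 * j) * p / (e * p ^ j) * p ^ i \<noteq> 1" for i
      using e1[of "j + i"] by (simp only: ad pow1 not_False_eq_True)
  qed (use nz p1 in \<open>simp_all only: ad, simp_all\<close>)
  have coef: "C j * (qpoch (a * p ^ (2 * j) * p) p (N - j) * qpoch w p (N - j)
        / (qpoch (a * p / d * p ^ j) p (N - j) * qpoch (a * p / e * p ^ j) p (N - j)))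
      = ?P * (qpoch d p j * qpoch e p j * qpoch (1 / p ^ N) p j / qpoch (d * e / (a * p ^ N)) p j)"
    if jN: "j \<le> N" for j
  proof -
    have N: "N = j + (N - j)" "N = (N - j) + j" using jN by auto
    have c1: "(1 - a * p ^ (2 * j)) / (1 - a) * qpoch a p (2 * j) * qpoch (a * p ^ (2 * j) * p) p (N - j)
        = qpoch (a * p) p N * qpoch (a * p ^ Suc N) p j"
    proof -
      have "(1 - a * p ^ (2 * j)) * qpoch a p (2 * j) * qpoch (a * p ^ (2 * j) * p) p (N - j)
          = qpoch a p (2 * j) * qpoch (a * p ^ (2 * j)) p (Suc (N - j))"
        by (simp add: qpoch_Suc')
      also have "\<dots> = qpoch a p (Suc (N + j))"
        using qpoch_add[of a p "2 * j" "Suc (N - j)"] jN by (simp add: mult_2 add.commute)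
      also have "\<dots> = (1 - a) * (qpoch (a * p) p N * qpoch (a * p ^ Suc N) p j)"
        using qpoch_add[of "a * p" p N j] by (simp add: qpoch_Suc' mult_ac)
      finally show ?thesis using a10 by (simp add: divide_eq_eq mult_ac)
    qed
    have c2: "qpoch (a * p / d) p j * qpoch (a * p / d * p ^ j) p (N - j) = qpoch (a * p / d) p N"
      "qpoch (a * p / e) p j * qpoch (a * p / e * p ^ j) p (N - j) = qpoch (a * p / e) p N"
      using N by (metis qpoch_add)+
    \<comment> \<open>Extending the symbol of \<open>w\<close> from length \<open>N - j\<close> to
      \<open>N\<close> adds \<open>j\<close> factors; read backwards they are the denominator symbol
      with parameter \<open>d * e / (a * p ^ N)\<close> of the balanced series.\<close>
    have c3: "z ^ j * (qpoch (1 / p ^ j) p j / qpoch p p j) * qpoch w p (N - j)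
        = qpoch w p N / qpoch (d * e / (a * p ^ N)) p j"
    proof -
      have pz: "p / z = d * e / (a * p ^ N)" unfolding z_def using nz by simp
      have "w * p ^ (N - j) = z / p ^ j"
        unfolding w_def z_def by (subst (2) N(1)) (use nz in \<open>simp add: power_add\<close>)
      then have "qpoch w p N = qpoch w p (N - j) * qpoch (z / p ^ j) p j"
        using N(2) by (metis qpoch_add)
      also have "qpoch (z / p ^ j) p j = z ^ j * qpoch (1 / p ^ j) p j * qpoch (d * e / (a * p ^ N)) p j / qpoch p p j"
        using qpoch_reverse[OF nz(1) z0, of j] pp0[of j] unfolding pz by (simp add: eq_divide_eq)
      finally show ?thesis using f0[OF jN] by simp
    qed
    have "C j * (qpoch (a * p ^ (2 * j) * p) p (N - j) * qpoch w p (N - j)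
        / (qpoch (a * p / d * p ^ j) p (N - j) * qpoch (a * p / e * p ^ j) p (N - j)))
      = ((1 - a * p ^ (2 * j)) / (1 - a) * qpoch a p (2 * j) * qpoch (a * p ^ (2 * j) * p) p (N - j))
        * (z ^ j * (qpoch (1 / p ^ j) p j / qpoch p p j) * qpoch w p (N - j))
        * (qpoch d p j * qpoch e p j * qpoch (1 / p ^ N) p j)
        / ((qpoch (a * p / d) p j * qpoch (a * p / d * p ^ j) p (N - j))
           * (qpoch (a * p / e) p j * qpoch (a * p / e * p ^ j) p (N - j)) * qpoch (a * p ^ Suc N) p j)"
      unfolding C_def by (simp only: mult_ac times_divide_eq_left times_divide_eq_right
          times_divide_times_eq divide_divide_eq_left)
    also have "\<dots> = ?P * (qpoch d p j * qpoch e p j * qpoch (1 / p ^ N) p j / qpoch (d * e / (a * p ^ N)) p j)"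
      unfolding c1 c2 c3 unfolding w_def using aN0[of "Suc N" j] by (simp add: mult_ac)
    finally show ?thesis .
  qed
  have "?L = (\<Sum>k\<le>N. \<Sum>j\<le>k. L k * (qpoch (1 / p ^ k) p j * qpoch (a * p ^ k) p j) * W j)"
  proof (intro sum.cong refl)
    fix k
    have zz: "a ^ 2 * p ^ (N + 2) / (b * c * d * e) = z * (a * p / (b * c))"
      by (simp add: z_def power2_eq_square mult_ac)
    have "(\<Sum>j\<le>k. L k * (qpoch (1 / p ^ k) p j * qpoch (a * p ^ k) p j) * W j)
        = L k * (\<Sum>j\<le>k. qpoch (1 / p ^ k) p j * qpoch (a * p ^ k) p j * qpoch (a * p / (b * c)) p j
            / (qpoch p p j * qpoch (a * p / b) p j * qpoch (a * p / c) p j) * p ^ j)"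
      unfolding W_def sum_distrib_left by (simp add: mult_ac)
    also have "\<dots> = L k * (qpoch b p k * qpoch c p k / (qpoch (a * p / b) p k * qpoch (a * p / c) p k)
           * (a * p / (b * c)) ^ k)"
      by (subst q_saalschuetz) (use nz p1 a1 b1 c1 in \<open>simp_all only:, simp_all\<close>)
    also have "\<dots> = (1 - a * p ^ (2 * k)) / (1 - a)
            * (qpoch a p k * qpoch b p k * qpoch c p k * qpoch d p k * qpoch e p k * qpoch (1 / p ^ N) p k)
            / (qpoch p p k * qpoch (a * p / b) p k * qpoch (a * p / c) p k
                * qpoch (a * p / d) p k * qpoch (a * p / e) p k * qpoch (a * p ^ Suc N) p k)
            * (a ^ 2 * p ^ (N + 2) / (b * c * d * e)) ^ k"
      unfolding zz power_mult_distrib[of z] L_def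
      by (simp only: mult_ac times_divide_eq_left times_divide_eq_right
          times_divide_times_eq divide_divide_eq_left)
    finally show "(1 - a * p ^ (2 * k)) / (1 - a)
            * (qpoch a p k * qpoch b p k * qpoch c p k * qpoch d p k * qpoch e p k * qpoch (1 / p ^ N) p k)
            / (qpoch p p k * qpoch (a * p / b) p k * qpoch (a * p / c) p k
                * qpoch (a * p / d) p k * qpoch (a * p / e) p k * qpoch (a * p ^ Suc N) p k)
            * (a ^ 2 * p ^ (N + 2) / (b * c * d * e)) ^ k
      = (\<Sum>j\<le>k. L k * (qpoch (1 / p ^ k) p j * qpoch (a * p ^ k) p j) * W j)" by (rule sym)
  qed
  also have "\<dots> = (\<Sum>j\<le>N. \<Sum>i\<le>N - j. L (j + i) * (qpoch (1 / p ^ (j + i)) p j * qpoch (a * p ^ (j + i)) p j) * W j)"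
  proof -
    define F where "F k j = L k * (qpoch (1 / p ^ k) p j * qpoch (a * p ^ k) p j) * W j" for k j
    have "(\<Sum>k\<le>N. \<Sum>j\<le>k. F k j) = (\<Sum>k\<le>N. \<Sum>j\<le>k. F (j + (k - j)) j)"
      by (intro sum.cong) auto
    also have "\<dots> = (\<Sum>(j, i)\<in>{(j, i). j + i \<le> N}. F (j + i) j)"
      by (rule sum.triangle_reindex_eq[symmetric])
    also have "{(j, i). j + i \<le> N} = (SIGMA j:{..N}. {..N - j})" by auto
    also have "(\<Sum>(j, i)\<in>(SIGMA j:{..N}. {..N - j}). F (j + i) j) = (\<Sum>j\<le>N. \<Sum>i\<le>N - j. F (j + i) j)"
      by (rule sum.Sigma[symmetric]) auto
    finally show ?thesis unfolding F_def .
  qed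
  also have "\<dots> = (\<Sum>j\<le>N. C j * (\<Sum>i\<le>N - j. t j i) * W j)"
    by (intro sum.cong refl) (simp add: key sum_distrib_left sum_distrib_right)
  also have "\<dots> = (\<Sum>j\<le>N. ?P * (qpoch d p j * qpoch e p j * qpoch (1 / p ^ N) p j / qpoch (d * e / (a * p ^ N)) p j) * W j)"
    by (intro sum.cong refl) (simp only: inner coef atMost_iff)
  also have "\<dots> = ?P * ?R"
    unfolding W_def sum_distrib_left
    by (intro sum.cong refl) (simp only: mult_ac times_divide_eq_left times_divide_eq_right
          times_divide_times_eq divide_divide_eq_left)
  finally show ?thesis .
qed

section \<open>Power sums and Gaussian binomial coefficients\<close>

lemma sum_lessThan_add: "sum f {..<a + b} = sum f {..<a} + (\<Sum>i<b. f (a + i))"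
  for f :: "nat \<Rightarrow> 'a::comm_monoid_add"
  by (induction b) (simp_all add: add_ac)

lemma one_minus_times_sum_times_power:
  fixes x :: "'a::comm_ring_1"
  shows "(1 - x) * (\<Sum>s<m. of_nat s * x ^ s) = (\<Sum>s<m. x ^ s) - 1 - (of_nat m - 1) * x ^ m"
  by (induction m) (simp_all add: algebra_simps)

lemma one_minus_times_sum_squares_times_power:
  fixes x :: "'a::comm_ring_1"
  shows "(1 - x) * (\<Sum>s<m. of_nat s ^ 2 * x ^ s)
    = 2 * (\<Sum>s<m. of_nat s * x ^ s) - (\<Sum>s<m. x ^ s) + 1 - (of_nat m - 1) ^ 2 * x ^ m"
  by (induction m) (simp_all add: algebra_simps power2_eq_square)

text \<open>The weights \<open>s (n - s)\<close> vanish at \<open>s = 0\<close> and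
  \<open>s = n\<close> and have constant second difference \<open>-2\<close>. Multiplication by
  \<open>(1 - x)^2\<close> therefore leaves a geometric sum and boundary terms.\<close>

lemma one_minus_square_times_sum:
  fixes x :: "'a::comm_ring_1"
  shows "(1 - x) ^ 2 * (\<Sum>s<n. of_nat s * (of_nat n - of_nat s) * x ^ s)
    = (of_nat n + 1) * x + (of_nat n - 1) * x * x ^ n - 2 * x * (\<Sum>s<n. x ^ s)"
proof -
  define E A B m where "E = (\<Sum>s<n. x ^ s)" and "A = (\<Sum>s<n. of_nat s * x ^ s)"
    and "B = (\<Sum>s<n. of_nat s ^ 2 * x ^ s)" and "m = (of_nat n :: 'a)"
  have A: "(1 - x) * A = E - 1 - (m - 1) * x ^ n"
    unfolding A_def E_def m_def by (rule one_minus_times_sum_times_power)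
  have B: "(1 - x) * B = 2 * A - E + 1 - (m - 1) ^ 2 * x ^ n"
    unfolding A_def B_def E_def m_def by (rule one_minus_times_sum_squares_times_power)
  have E: "(1 - x) * E = 1 - x ^ n"
    unfolding E_def by (simp add: one_diff_power_eq)
  have "(\<Sum>s<n. of_nat s * (of_nat n - of_nat s) * x ^ s) = m * A - B"
    unfolding A_def B_def m_def
    by (simp add: sum_distrib_left sum_subtractf[symmetric] algebra_simps power2_eq_square)
  \<comment> \<open>The multipliers come from eliminating \<open>A\<close> and \<open>B\<close>;
    each bracket on the right is one of the three relations above and hence zero.\<close>
  moreover have "(1 - x) ^ 2 * (m * A - B) - ((m + 1) * x + (m - 1) * x * x ^ n - 2 * x * E)
      = (m * (1 - x) - 2) * ((1 - x) * A - (E - 1 - (m - 1) * x ^ n))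
        - (1 - x) * ((1 - x) * B - (2 * A - E + 1 - (m - 1) ^ 2 * x ^ n))
        + (m - 1) * ((1 - x) * E - (1 - x ^ n))"
    by (simp add: algebra_simps power2_eq_square)
  ultimately show ?thesis using A B E unfolding E_def m_def by simp
qed

lemma sum_s_times_n_minus_s:
  "6 * (\<Sum>s<n. of_nat s * (of_nat n - of_nat s)) = (of_nat n ^ 3 - of_nat n :: 'a::comm_ring_1)"
proof -
  have 1: "2 * (\<Sum>s<m. of_nat s) = (of_nat m ^ 2 - of_nat m :: 'a)" for m
    by (induction m) (simp_all add: algebra_simps power2_eq_square)
  have 2: "6 * (\<Sum>s<m. of_nat s ^ 2) = (2 * of_nat m ^ 3 - 3 * of_nat m ^ 2 + of_nat m :: 'a)" for m
    by (induction m) (simp_all add: algebra_simps power2_eq_square power3_eq_cube)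
  have "6 * (\<Sum>s<n. of_nat s * (of_nat n - of_nat s :: 'a))
      = 3 * of_nat n * (2 * (\<Sum>s<n. of_nat s)) - 6 * (\<Sum>s<n. of_nat s ^ 2)"
    by (simp add: sum_subtractf sum_distrib_left right_diff_distrib power2_eq_square mult_ac)
  also have "\<dots> = of_nat n ^ 3 - of_nat n"
    unfolding 1 2 by (simp add: algebra_simps power2_eq_square power3_eq_cube)
  finally show ?thesis .
qed

text \<open>Gaussian binomial coefficients are polynomials in \<open>q\<close> by the
  \<open>q\<close>-Pascal rule, so they lie in every subring containing \<open>q\<close>, even where
  single factors \<open>1 - q^i\<close> are not units.\<close>

lemma qpoch_ratio_in_subring:
  fixes q :: "'a::field" and R :: "'a set"
  assumes R: "1 \<in> R" "\<And>x y. x \<in> R \<Longrightarrow> y \<in> R \<Longrightarrow> x + y \<in> R"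
      "\<And>x y. x \<in> R \<Longrightarrow> y \<in> R \<Longrightarrow> x * y \<in> R"
    and q: "q \<in> R" "\<And>i. q ^ Suc i \<noteq> 1"
  shows "qpoch q q (a + b) / (qpoch q q a * qpoch q q b) \<in> R"
proof -
  have nz: "qpoch q q k \<noteq> 0" for k using q(2) by (intro qpoch_nonzero) simp
  have pow: "q ^ k \<in> R" for k by (induction k) (auto intro: R q)
  show ?thesis
  proof (induction "a + b" arbitrary: a b)
    case 0
    then show ?case using R by simp
  next
    case (Suc m)
    show ?case
    proof (cases "a = 0 \<or> b = 0")
      case True
      then show ?thesis using R(1) nz by auto
    next
      case False
      then obtain a' b' where ab: "a = Suc a'" "b = Suc b'" by (metis not0_implies_Suc)
      have 1: "qpoch q q (a' + b) / (qpoch q q a' * qpoch q q b) \<in> R"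
        by (rule Suc.hyps(1)) (use Suc.hyps(2) ab in auto)
      have 2: "qpoch q q (a + b') / (qpoch q q a * qpoch q q b') \<in> R"
        by (rule Suc.hyps(1)) (use Suc.hyps(2) ab in auto)
      define A B where "A = 1 - q * q ^ a'" and "B = 1 - q * q ^ b'"
      have AB: "A \<noteq> 0" "B \<noteq> 0" using q(2)[of a'] q(2)[of b'] by (auto simp: A_def B_def)
      define P where "P = qpoch q q (Suc (a' + b'))"
      have S: "qpoch q q a = qpoch q q a' * A" "qpoch q q b = qpoch q q b' * B"
        unfolding ab A_def B_def by (simp_all add: qpoch_Suc)
      have "qpoch q q (a + b) = P * (A + q ^ a * B)"
        unfolding P_def ab A_def B_def by (simp add: qpoch_Suc power_add algebra_simps)
      then have "qpoch q q (a + b) / (qpoch q q a * qpoch q q b)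
          = P / (qpoch q q a' * (qpoch q q b' * B)) + q ^ a * (P / (qpoch q q a' * A * qpoch q q b'))"
        unfolding S using AB nz by (simp add: field_simps)
      also have "\<dots> \<in> R"
        unfolding S[symmetric] by (intro R(2,3) pow) (use 1 2 in \<open>simp_all add: P_def ab\<close>)
      finally show ?thesis .
    qed
  qed
qed

definition supercong_lhs where
  "supercong_lhs q c d M = (\<Sum>k=0..M. qnum q (4 * k + 1)
        * (qpoch q (q^2) k ^ 4 * qpoch (c * q) (q^2) k * qpoch (d * q) (q^2) k)
        / (qpoch (q^2) (q^2) k ^ 4 * qpoch (q^2 / c) (q^2) k * qpoch (q^2 / d) (q^2) k)
        * (q / (c * d)) ^ k)"

definition supercong_rhs where
  "supercong_rhs q c d n = (qnum q n * q powi ((1 - int n) div 2)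
        + qnum q n ^ 3 * q powi ((1 - int n) div 2) * (((of_nat n)^2 - 1) * (1 - q)^2 / 24))
      * (\<Sum>k=0..(n - 1) div 2.
          (qpoch q (q^2) k ^ 3 * qpoch (q / (c * d)) (q^2) k)
          / (qpoch (q^2) (q^2) k ^ 2 * qpoch (q^2 / c) (q^2) k * qpoch (q^2 / d) (q^2) k)
          * q ^ (2 * k))"

section \<open>Congruences in a localization\<close>

definition units_in :: "'a::field set \<Rightarrow> 'a set" where
  "units_in R = {u \<in> R. u \<noteq> 0 \<and> inverse u \<in> R}"

text \<open>\<open>R\<close> stands for the localization of the polynomial ring at the \<open>n\<close>-th cyclotomic polynomial.
  There that polynomial is associated to \<open>\<psi> = 1 - q\<^sup>n\<close>, hence \<open>cg e\<close> below is congruence modulo its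
  \<open>e\<close>-th power.\<close>

locale local_subring =
  fixes R :: "'a::field_char_0 set" and q c d :: 'a and n :: nat
  assumes one_R: "1 \<in> R"
    and diff_R: "\<And>x y. x \<in> R \<Longrightarrow> y \<in> R \<Longrightarrow> x - y \<in> R"
    and mult_R: "\<And>x y. x \<in> R \<Longrightarrow> y \<in> R \<Longrightarrow> x * y \<in> R"
    and q_unit: "q \<in> units_in R" and c_unit: "c \<in> units_in R" and d_unit: "d \<in> units_in R"
    and n_odd: "odd n" and n_gt_1: "n > 1"
    and q_not_root: "\<And>i. q ^ Suc i \<noteq> 1"
    and diff_unit: "\<And>j. \<not> n dvd j \<Longrightarrow> 1 - q ^ j \<in> units_in R"
    and c_diff_unit: "\<And>j. 1 - q ^ j / c \<in> units_in R"
    and d_diff_unit: "\<And>j. 1 - q ^ j / d \<in> units_in R"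
    and add_unit: "\<And>j. 1 + q ^ j \<in> units_in R"
    and nat_unit: "\<And>k. of_nat (Suc k) \<in> units_in R"
begin

section \<open>Closure properties of the ring and of its units\<close>

abbreviation U where "U \<equiv> units_in R"

lemma U_R: "x \<in> U \<Longrightarrow> x \<in> R" and U_nz: "x \<in> U \<Longrightarrow> x \<noteq> 0"
  by (auto simp: units_in_def)

lemma zero_R: "0 \<in> R" using diff_R[OF one_R one_R] by simp
lemma minus_R: "x \<in> R \<Longrightarrow> - x \<in> R" using diff_R[OF zero_R, of x] by simp
lemma add_R:
  "x \<in> R \<Longrightarrow> y \<in> R \<Longrightarrow> x + y \<in> R" using diff_R[of x "- y"] minus_R[of y] by simp
lemma power_R: "x \<in> R \<Longrightarrow> x ^ k \<in> R" by (induction k) (auto intro: one_R mult_R)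
lemma sum_R: "(\<And>i. i \<in> A \<Longrightarrow> f i \<in> R) \<Longrightarrow> sum f A \<in> R"
  by (induction A rule: infinite_finite_induct) (auto intro: zero_R add_R)
lemma prod_R: "(\<And>i. i \<in> A \<Longrightarrow> f i \<in> R) \<Longrightarrow> prod f A \<in> R"
  by (induction A rule: infinite_finite_induct) (auto intro: one_R mult_R)
lemma of_nat_R: "of_nat k \<in> R"
  by (induction k) (auto intro: zero_R one_R add_R)
lemma numeral_R: "numeral k \<in> R"
  using of_nat_R[of "numeral k"] by simp
lemma divide_R: "x \<in> R \<Longrightarrow> y \<in> U \<Longrightarrow> x / y \<in> R"
  by (auto simp: units_in_def divide_inverse intro: mult_R)

lemma one_U: "1 \<in> U" by (simp add: units_in_def one_R)
lemma mult_U: "x \<in> U \<Longrightarrow> y \<in> U \<Longrightarrow> x * y \<in> U"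
  by (auto simp: units_in_def intro: mult_R)
lemma inverse_U: "x \<in> U \<Longrightarrow> inverse x \<in> U"
  by (auto simp: units_in_def)
lemma divide_U: "x \<in> U \<Longrightarrow> y \<in> U \<Longrightarrow> x / y \<in> U"
  by (simp add: divide_inverse mult_U inverse_U)
lemma minus_U: "x \<in> U \<Longrightarrow> - x \<in> U"
  by (auto simp: units_in_def intro: minus_R)
lemma power_U: "x \<in> U \<Longrightarrow> x ^ k \<in> U" by (induction k) (auto intro: one_U mult_U)
lemma numeral_U: "numeral k \<in> U"
  using nat_unit[of "pred_numeral k"] by (simp add: numeral_eq_Suc[symmetric] del: of_nat_Suc)
lemma prod_U: "(\<And>i. i \<in> A \<Longrightarrow> f i \<in> U) \<Longrightarrow> prod f A \<in> U"
  by (induction A rule: infinite_finite_induct) (auto intro: one_U mult_U)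

lemmas R_intros = one_R zero_R diff_R mult_R minus_R add_R power_R sum_R prod_R of_nat_R numeral_R
  divide_R one_U mult_U divide_U minus_U power_U numeral_U prod_U q_unit c_unit d_unit
  U_R[OF q_unit] U_R[OF c_unit] U_R[OF d_unit] c_diff_unit d_diff_unit
  U_R[OF c_diff_unit] U_R[OF d_diff_unit] U_R[OF add_unit] add_unit

lemma q0: "q \<noteq> 0" and c0: "c \<noteq> 0" and d0: "d \<noteq> 0"
  using q_unit c_unit d_unit by (auto simp: units_in_def)

section \<open>Calculus of congruences modulo powers of \<open>1 - q^n\<close>\<close>

definition \<psi> where "\<psi> = 1 - q ^ n"

lemma \<psi>_R: "\<psi> \<in> R" unfolding \<psi>_def by (intro R_intros)

definition cg :: "nat \<Rightarrow> 'a \<Rightarrow> 'a \<Rightarrow> bool" where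
  "cg e x y \<longleftrightarrow> (\<exists>z\<in>R. x - y = \<psi> ^ e * z)"

lemma cgI: "x - y = \<psi> ^ e * z \<Longrightarrow> z \<in> R \<Longrightarrow> cg e x y"
  by (auto simp: cg_def)

lemma cg_refl [simp]: "cg e x x"
  using zero_R by (auto simp: cg_def intro: bexI[of _ 0])

lemma cg_sym: "cg e x y \<Longrightarrow> cg e y x"
  unfolding cg_def by (metis minus_R minus_diff_eq mult_minus_right)

lemma cg_add: "cg e x y \<Longrightarrow> cg e x' y' \<Longrightarrow> cg e (x + x') (y + y')"
proof -
  assume "cg e x y" "cg e x' y'"
  then obtain z z' where "x - y = \<psi> ^ e * z" "x' - y' = \<psi> ^ e * z'" "z \<in> R" "z' \<in> R"
    by (auto simp: cg_def)
  then show ?thesis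
    by (intro cgI[of _ _ _ "z + z'"]) (auto simp: algebra_simps intro: add_R)
qed

lemma cg_minus: "cg e x y \<Longrightarrow> cg e (- x) (- y)"
proof -
  assume "cg e x y"
  then obtain z where "x - y = \<psi> ^ e * z" "z \<in> R" by (auto simp: cg_def)
  then show ?thesis
    by (intro cgI[of _ _ _ "- z"]) (auto simp: algebra_simps intro: minus_R)
qed

lemma cg_diff: "cg e x y \<Longrightarrow> cg e x' y' \<Longrightarrow> cg e (x - x') (y - y')"
  using cg_add[of e x y "- x'" "- y'"] cg_minus[of e x' y'] by simp

lemma cg_trans [trans]: "cg e x y \<Longrightarrow> cg e y z \<Longrightarrow> cg e x z"
  using cg_add[of e x y y z] by (auto simp: cg_def algebra_simps)

lemma cg_eq_trans [trans]: "x = y \<Longrightarrow> cg e y z \<Longrightarrow> cg e x z"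
  and cg_trans_eq [trans]: "cg e x y \<Longrightarrow> y = z \<Longrightarrow> cg e x z"
  by simp_all

lemma cg_diff_iff: "cg e (x - y) 0 \<longleftrightarrow> cg e x y"
  by (simp add: cg_def)

lemma cg_mult_0: "cg e x 0 \<Longrightarrow> cg f y 0 \<Longrightarrow> cg (e + f) (x * y) 0"
proof -
  assume "cg e x 0" "cg f y 0"
  then obtain z z' where "x = \<psi> ^ e * z" "y = \<psi> ^ f * z'" "z \<in> R" "z' \<in> R"
    by (auto simp: cg_def)
  then show ?thesis
    by (intro cgI[of _ _ _ "z * z'"]) (auto simp: power_add algebra_simps intro: mult_R)
qed

lemma cg_0_R: "x \<in> R \<Longrightarrow> cg 0 x 0"
  by (auto simp: cg_def)

lemma cg_lmult_0: "x \<in> R \<Longrightarrow> cg e y 0 \<Longrightarrow> cg e (x * y) 0"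
  and cg_rmult_0: "x \<in> R \<Longrightarrow> cg e y 0 \<Longrightarrow> cg e (y * x) 0"
  using cg_mult_0[OF cg_0_R, of x e y] by (simp_all add: mult.commute)

lemma cg_lmult: "x \<in> R \<Longrightarrow> cg e y y' \<Longrightarrow> cg e (x * y) (x * y')"
  and cg_rmult: "x \<in> R \<Longrightarrow> cg e y y' \<Longrightarrow> cg e (y * x) (y' * x)"
  using cg_lmult_0[of x e "y - y'"] cg_diff_iff[of e "x * y" "x * y'"] cg_diff_iff[of e y y']
  by (simp_all add: algebra_simps)

lemma cg_mult:
  "x \<in> R \<Longrightarrow> y' \<in> R \<Longrightarrow> cg e x x' \<Longrightarrow> cg e y y' \<Longrightarrow> cg e (x * y) (x' * y')"
  by (rule cg_trans[OF cg_lmult cg_rmult])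

lemma cg_R: "cg e x y \<Longrightarrow> x \<in> R \<Longrightarrow> y \<in> R"
proof -
  assume "cg e x y" "x \<in> R"
  then obtain z where z: "x - y = \<psi> ^ e * z" "z \<in> R" by (auto simp: cg_def)
  have "x - \<psi> ^ e * z \<in> R" using z \<open>x \<in> R\<close> \<psi>_R by (intro R_intros)
  moreover have "y = x - \<psi> ^ e * z" using z by (simp add: algebra_simps)
  ultimately show ?thesis by simp
qed

lemma cg_power: "x \<in> R \<Longrightarrow> cg e x x' \<Longrightarrow> cg e (x ^ k) (x' ^ k)"
  by (induction k) (auto intro!: cg_mult power_R intro: cg_R)

lemma cg_sum:
  "(\<And>i. i \<in> A \<Longrightarrow> cg e (f i) (g i)) \<Longrightarrow> cg e (sum f A) (sum g A)"
  by (induction A rule: infinite_finite_induct) (auto intro: cg_add)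

lemma cg_sum_0: "(\<And>i. i \<in> A \<Longrightarrow> cg e (f i) 0) \<Longrightarrow> cg e (sum f A) 0"
  using cg_sum[of A e f "\<lambda>_. 0"] by simp

lemma cg_prod:
  "(\<And>i. i \<in> A \<Longrightarrow> f i \<in> R \<and> cg e (f i) (g i)) \<Longrightarrow> cg e (prod f A) (prod g A)"
proof (induction A rule: infinite_finite_induct)
  case (insert a A)
  have "cg e (f a * prod f A) (g a * prod g A)"
    using insert by (intro cg_mult prod_R) (auto intro: cg_R)
  then show ?case using insert by simp
qed auto

lemma cg_le: "cg e x y \<Longrightarrow> f \<le> e \<Longrightarrow> cg f x y"
proof -
  assume "cg e x y" "f \<le> e"
  then obtain z where z: "x - y = \<psi> ^ e * z" "z \<in> R" by (auto simp: cg_def)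
  have "\<psi> ^ e = \<psi> ^ f * \<psi> ^ (e - f)"
    using \<open>f \<le> e\<close> by (simp add: power_add[symmetric])
  then show ?thesis using z \<psi>_R
    by (intro cgI[of _ _ _ "\<psi> ^ (e - f) * z"]) (auto intro!: R_intros)
qed

lemma cg_divide: "cg e x y \<Longrightarrow> u \<in> U \<Longrightarrow> cg e (x / u) (y / u)"
  using cg_rmult[of "inverse u"] by (simp add: divide_inverse units_in_def)

lemma cg_cancel: "u \<in> U \<Longrightarrow> cg e (u * x) (u * y) \<Longrightarrow> cg e x y"
  using cg_divide[of e "u * x" "u * y" u] by (simp add: units_in_def)

lemma cg_inverse:
  "x \<in> U \<Longrightarrow> y \<in> U \<Longrightarrow> cg e x y \<Longrightarrow> cg e (inverse x) (inverse y)"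
proof -
  assume *: "x \<in> U" "y \<in> U" "cg e x y"
  have "cg e (y / (x * y)) (x / (x * y))"
    using * by (intro cg_divide cg_sym[OF *(3)] mult_U)
  then show ?thesis using * by (simp add: units_in_def field_simps)
qed

lemma cg_divide2:
  "x \<in> R \<Longrightarrow> u \<in> U \<Longrightarrow> u' \<in> U \<Longrightarrow> cg e x x' \<Longrightarrow> cg e u u' \<Longrightarrow> cg e (x / u) (x' / u')"
  unfolding divide_inverse by (intro cg_mult cg_inverse) (auto simp: units_in_def)

lemma cg_qn: "cg 1 (q ^ n) 1"
  by (rule cgI[of _ _ _ "-1"]) (auto simp: \<psi>_def intro: R_intros)

lemma cg_qn_power: "cg 1 (q ^ (n * k)) 1"
  using cg_power[OF _ cg_qn, of k] R_intros by (simp add: power_mult)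

lemma cg_\<psi>: "cg e (\<psi> ^ e) 0"
  using one_R by (auto simp: cg_def)

text \<open>First-order expansion for a small \<open>v\<close>. Keeping the remainder in
  \<open>R\<close> is what lets it count as a term of second order in \<open>v\<close>.\<close>

lemma prod_one_plus:
  fixes k :: nat
  assumes "v \<in> R" "\<And>i. i < k \<Longrightarrow> a i \<in> R"
  shows "\<exists>r\<in>R. (\<Prod>i<k. 1 + v * a i) = 1 + v * (\<Sum>i<k. a i) + v ^ 2 * r"
  using assms(2)
proof (induction k)
  case 0
  show ?case using zero_R by auto
next
  case (Suc k)
  then obtain r where r: "r \<in> R" "(\<Prod>i<k. 1 + v * a i) = 1 + v * (\<Sum>i<k. a i) + v ^ 2 * r"
    by auto
  have "(\<Sum>i<k. a i) * a k + r + v * a k * r \<in> R"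
    using Suc.prems r assms(1) by (intro R_intros) auto
  moreover have "(\<Prod>i<Suc k. 1 + v * a i) = 1 + v * (\<Sum>i<Suc k. a i)
      + v ^ 2 * ((\<Sum>i<k. a i) * a k + r + v * a k * r)"
    by (simp add: r) (simp add: algebra_simps power2_eq_square)
  ultimately show ?case by blast
qed

section \<open>Reflection of single factors\<close>

definition N where "N = (n - 1) div 2"

lemma n_eq: "n = 2 * N + 1" using n_odd by (auto simp: N_def elim!: oddE)
lemma N_pos: "N > 0" using n_eq n_gt_1 by simp

definition z1 where "z1 i = q ^ (2 * i + 1)"
definition z2 where "z2 i = q ^ (2 * i + 2)"

lemma z1_U: "z1 i \<in> U" and z2_U: "z2 i \<in> U"
  by (auto simp: z1_def z2_def intro!: R_intros)

lemma not_dvd_between: "0 < j \<Longrightarrow> j < n \<Longrightarrow> \<not> n dvd j"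
  by (auto dest: dvd_imp_le)

lemma z1_unit:
  "i < N \<Longrightarrow> 1 - z1 i \<in> U" and z2_unit: "i < N \<Longrightarrow> 1 - z2 i \<in> U"
  unfolding z1_def z2_def by (intro diff_unit not_dvd_between; use n_eq in simp)+

lemma z_refl:
  "i < N \<Longrightarrow> z1 i * z2 (N - Suc i) = q ^ n" "i < N \<Longrightarrow> z2 i * z1 (N - Suc i) = q ^ n"
proof -
  assume i: "i < N"
  then have "2 * i + 1 + (2 * (N - Suc i) + 2) = n" "2 * i + 2 + (2 * (N - Suc i) + 1) = n"
    using n_eq by auto
  then show "z1 i * z2 (N - Suc i) = q ^ n" "z2 i * z1 (N - Suc i) = q ^ n"
    unfolding z1_def z2_def by (metis power_add)+
qed

text \<open>The source of all reflection congruences: numerator and denominator factors whose \<open>q\<close>-powers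
  multiply to \<open>q\<^sup>n\<close> cancel up to a monomial.\<close>

lemma refl_ratio:
  assumes "z * z' = q ^ n" "1 - z' / y \<in> U" "y \<noteq> 0"
  shows "cg 1 ((1 - y * z) / (1 - z' / y)) (- y * z)"
proof -
  have "(1 - y * z) - (- y * z) * (1 - z' / y) = 1 - z * z'"
    using assms(3) by (simp add: field_simps)
  then have "cg 1 (1 - y * z) ((- y * z) * (1 - z' / y))"
    unfolding assms(1) by (intro cgI[of _ _ _ 1]) (simp_all add: \<psi>_def one_R)
  from cg_divide[OF this assms(2)] show ?thesis
    by (simp only: nonzero_mult_div_cancel_right[OF U_nz[OF assms(2)]])
qed

text \<open>With respect to \<open>z d/dz\<close>, \<open>l\<close> is minus the logarithmic
  derivative of \<open>1 - z\<close>, and \<open>h\<close> is the derivative of \<open>l\<close>.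
  They govern the first-order change of \<open>1 - z\<close> under \<open>z -> z / q^n\<close> and
  the second-order change of its square when the two copies of \<open>z\<close> become
  \<open>q^n z\<close> and \<open>z / q^n\<close>.\<close>

definition h :: "'a \<Rightarrow> 'a" where "h z = z / (1 - z) ^ 2"
definition l :: "'a \<Rightarrow> 'a" where "l z = z / (1 - z)"

lemma h_R:
  "z \<in> R \<Longrightarrow> 1 - z \<in> U \<Longrightarrow> h z \<in> R" and l_R: "z \<in> R \<Longrightarrow> 1 - z \<in> U \<Longrightarrow> l z \<in> R"
  unfolding h_def l_def by (auto intro: divide_R power_U)

text \<open>\<open>h\<close> is invariant under \<open>z -> 1/z\<close>, and \<open>z'\<close> is
  this inverse modulo \<psi>. Under the same inversion \<open>l + 1/2\<close> changes sign, which is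
  the content of \<open>l_refl\<close>.\<close>

lemma h_refl:
  assumes "cg 1 (z * z') 1" "z \<in> U" "z' \<in> U" "1 - z \<in> U" "1 - z' \<in> U"
  shows "cg 1 (h z') (h z)"
proof -
  have z: "z \<noteq> 0" "1 - z \<noteq> 0" "1 - z' \<noteq> 0" using assms U_nz by blast+
  have "h z' - h z = (z' * (1 - z) ^ 2 - z * (1 - z') ^ 2) / ((1 - z) ^ 2 * (1 - z') ^ 2)"
    using z unfolding h_def by (simp add: divide_simps)
  also have "z' * (1 - z) ^ 2 - z * (1 - z') ^ 2 = (z * z' - 1) * (z - z')"
    by (simp add: algebra_simps power2_eq_square)
  finally have "h z' - h z = (z * z' - 1) * ((z - z') / ((1 - z) ^ 2 * (1 - z') ^ 2))" by simp
  moreover have "cg 1 \<dots> 0"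
  proof (rule cg_rmult_0)
    show "(z - z') / ((1 - z) ^ 2 * (1 - z') ^ 2) \<in> R"
      using assms U_R by (intro R_intros) auto
    show "cg 1 (z * z' - 1) 0" using assms(1) by (simp add: cg_diff_iff)
  qed
  ultimately show ?thesis by (metis cg_diff_iff)
qed

lemma l_refl:
  assumes "cg 1 (z * z') 1" "z \<in> U" "z' \<in> U" "1 - z \<in> U" "1 - z' \<in> U"
  shows "cg 1 (l z') (- 1 - l z)"
proof -
  have z: "1 - z \<noteq> 0" "1 - z' \<noteq> 0" using assms U_nz by blast+
  have "l z' - (- 1 - l z) = (1 - z * z') / ((1 - z) * (1 - z'))"
    using z unfolding l_def by (simp add: divide_simps) (simp add: algebra_simps)
  moreover have "cg 1 (1 - z * z') 0"
    using cg_diff[OF cg_refl assms(1), of 1] by simp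
  then have "cg 1 ((1 - z * z') / ((1 - z) * (1 - z'))) 0"
    using cg_divide[OF _ mult_U[OF assms(4) assms(5)], of 1 "1 - z * z'" 0] by simp
  ultimately show ?thesis by (metis cg_diff_iff)
qed

subsection \<open>The deformed sums\<close>

lemma qpoch_z1: "qpoch (x * q) (q ^ 2) k = (\<Prod>i<k. 1 - x * z1 i)"
  and qpoch_z2: "qpoch (x * q ^ 2) (q ^ 2) k = (\<Prod>i<k. 1 - x * z2 i)"
  by (simp_all add: qpoch_def z1_def z2_def power_mult power_add power2_eq_square mult.assoc mult.left_commute)

lemma qpoch_z1': "qpoch q (q ^ 2) k = (\<Prod>i<k. 1 - z1 i)"
  and qpoch_z2': "qpoch (q ^ 2 / x) (q ^ 2) k = (\<Prod>i<k. 1 - z2 i / x)"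
  and qpoch_z2'': "qpoch (q ^ 2) (q ^ 2) k = (\<Prod>i<k. 1 - z2 i)"
  using qpoch_z1[of 1] qpoch_z2[of "1 / x"] qpoch_z2[of 1] by simp_all

lemma q_power_ne_1: "0 < j \<Longrightarrow> q ^ j \<noteq> 1"
  using q_not_root[of "j - 1"] by simp

lemma z_ne_1: "z1 i \<noteq> 1" "z2 i \<noteq> 1"
  unfolding z1_def z2_def by (auto intro!: q_power_ne_1 simp del: power_Suc)

definition r where "r x i = (1 - x * z1 i) / (1 - z2 i / x)"

text \<open>\<open>T X Y B\<close> is the left-hand summand with three of its four factors \<open>(q;q\<^sup>2)\<^sub>k / (q\<^sup>2;q\<^sup>2)\<^sub>k\<close> deformed by
  parameters, and \<open>V X Y B\<close> is the summand that Watson's transformation then produces on the right;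
  the theorem concerns \<open>X = Y = B = 1\<close>.\<close>

definition T where "T X Y B k = qnum q (4 * k + 1)
  * (\<Prod>i<k. r 1 i * r X i * r Y i * r B i * r c i * r d i * (q / (c * d * X * Y * B)))"

definition V where "V X Y B k = (\<Prod>i<k. (1 - q / (c * d) * (q ^ 2) ^ i) * (1 - X * z1 i) * (1 - Y * z1 i)
  * (1 - B * z1 i) / ((1 - z2 i) * (1 - z2 i / c) * (1 - z2 i / d) * (1 - B * z2 i)) * q ^ 2)"

lemma prod_r: "(\<Prod>i<k. r x i) = qpoch (x * q) (q ^ 2) k / qpoch (q ^ 2 / x) (q ^ 2) k"
  by (simp add: r_def qpoch_z1 qpoch_z2' prod_dividef)

lemma T_conv: "T X Y B k = qnum q (4 * k + 1)
    * (qpoch q (q ^ 2) k * qpoch (X * q) (q ^ 2) k * qpoch (Y * q) (q ^ 2) k * qpoch (B * q) (q ^ 2) k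
        * qpoch (c * q) (q ^ 2) k * qpoch (d * q) (q ^ 2) k)
    / (qpoch (q ^ 2) (q ^ 2) k * qpoch (q ^ 2 / X) (q ^ 2) k * qpoch (q ^ 2 / Y) (q ^ 2) k
        * qpoch (q ^ 2 / B) (q ^ 2) k * qpoch (q ^ 2 / c) (q ^ 2) k * qpoch (q ^ 2 / d) (q ^ 2) k)
    * (q / (c * d * X * Y * B)) ^ k"
  unfolding T_def prod.distrib prod_r by (simp add: power_divide)

lemma V_conv: "V X Y B k = qpoch (q / (c * d)) (q ^ 2) k * qpoch (X * q) (q ^ 2) k * qpoch (Y * q) (q ^ 2) k
      * qpoch (B * q) (q ^ 2) k
    / (qpoch (q ^ 2) (q ^ 2) k * qpoch (q ^ 2 / c) (q ^ 2) k * qpoch (q ^ 2 / d) (q ^ 2) k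
      * qpoch (B * q ^ 2) (q ^ 2) k) * q ^ (2 * k)"
  unfolding V_def prod.distrib prod_dividef qpoch_z1 qpoch_z2' qpoch_z2 qpoch_z2''
  by (simp add: qpoch_def power_mult)

text \<open>Watson's transformation with base \<open>q^2\<close>, \<open>a = q\<close>, the never
  deformed pair \<open>cq, dq\<close> in the places \<open>b, c\<close>, and \<open>Dq, Eq\<close>
  in the places \<open>d, e\<close>. The terminating parameter is
  \<open>F q = q^(1-n) = (q^2)^-N\<close>.\<close>

lemma watson_T:
  assumes "D \<noteq> 0" "E \<noteq> 0" and F: "F = 1 / q ^ n"
    and D1: "\<And>i. z2 i \<noteq> D" and E1: "\<And>i. z2 i \<noteq> E"
    and DEF: "\<And>i. i < N \<Longrightarrow> D * E * F * z2 i \<noteq> 1"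
  shows "(\<Sum>k\<le>N. T D E F k) = qpoch (q ^ 3) (q ^ 2) N * qpoch (q / (D * E)) (q ^ 2) N
      / (qpoch (q ^ 2 / D) (q ^ 2) N * qpoch (q ^ 2 / E) (q ^ 2) N)
      * (\<Sum>k\<le>N. qpoch (q / (c * d)) (q ^ 2) k * qpoch (D * q) (q ^ 2) k * qpoch (E * q) (q ^ 2) k
         * qpoch (F * q) (q ^ 2) k / (qpoch (q ^ 2) (q ^ 2) k * qpoch (q ^ 2 / c) (q ^ 2) k
         * qpoch (q ^ 2 / d) (q ^ 2) k * qpoch (D * E * F * q ^ 2) (q ^ 2) k) * q ^ (2 * k))"
proof -
  let ?p = "q ^ 2"
  have zp: "?p * ?p ^ i = z2 i" "q * ?p ^ i = z1 i" for i
    by (simp_all add: z1_def z2_def power_mult power2_eq_square)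
  have qn: "q ^ n = q * ?p ^ N"
    by (subst n_eq) (simp add: power_mult)
  have s: "q * ?p / (x * q) = ?p / x" if "x \<noteq> 0" for x using q0 that by simp
  have s1: "q * ?p / q = ?p" using q0 by simp
  have s2: "q * ?p / (c * q * (d * q)) = q / (c * d)" "q * ?p / (D * q * (E * q)) = q / (D * E)"
    using q0 by (simp_all add: power2_eq_square)
  have s3: "1 / ?p ^ N = F * q" unfolding F qn using q0 by simp
  have s4: "q * ?p ^ Suc N = ?p / F" unfolding F qn using q0 by simp
  have s5: "D * q * (E * q) / (q * ?p ^ N) = D * E * F * ?p"
    unfolding F qn using q0 by (simp add: power2_eq_square)
  have s6: "q ^ 2 * ?p ^ (N + 2) / (c * q * (d * q) * (D * q) * (E * q)) = q / (c * d * D * E * F)"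
    unfolding F qn using q0 c0 d0 assms(1,2)
    by (simp add: power_add field_simps power2_eq_square)
  have s7: "q * ?p = q ^ 3" by (simp add: power2_eq_square power3_eq_cube)
  have zx: "?p / x * ?p ^ i = z2 i / x" for x i using zp by simp
  have cd1: "z2 i / c \<noteq> 1" "z2 i / d \<noteq> 1" for i
    using U_nz[OF c_diff_unit[of "2 * i + 2"]] U_nz[OF d_diff_unit[of "2 * i + 2"]]
    by (auto simp: z2_def)
  have W: "(\<Sum>k\<le>N. (1 - q * ?p ^ (2 * k)) / (1 - q)
            * (qpoch q ?p k * qpoch (c * q) ?p k * qpoch (d * q) ?p k * qpoch (D * q) ?p k * qpoch (E * q) ?p k * qpoch (1 / ?p ^ N) ?p k)
            / (qpoch ?p ?p k * qpoch (q * ?p / (c * q)) ?p k * qpoch (q * ?p / (d * q)) ?p k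
                * qpoch (q * ?p / (D * q)) ?p k * qpoch (q * ?p / (E * q)) ?p k * qpoch (q * ?p ^ Suc N) ?p k)
            * (q ^ 2 * ?p ^ (N + 2) / (c * q * (d * q) * (D * q) * (E * q))) ^ k)
       = qpoch (q * ?p) ?p N * qpoch (q * ?p / (D * q * (E * q))) ?p N / (qpoch (q * ?p / (D * q)) ?p N * qpoch (q * ?p / (E * q)) ?p N)
          * (\<Sum>j\<le>N. qpoch (q * ?p / (c * q * (d * q))) ?p j * qpoch (D * q) ?p j * qpoch (E * q) ?p j * qpoch (1 / ?p ^ N) ?p j
              / (qpoch ?p ?p j * qpoch (q * ?p / (c * q)) ?p j * qpoch (q * ?p / (d * q)) ?p j
                  * qpoch (D * q * (E * q) / (q * ?p ^ N)) ?p j) * ?p ^ j)"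
  proof (rule watson_8phi7)
    show "?p ^ Suc i \<noteq> 1" for i using zp(1)[of i] z_ne_1(2)[of i] by simp
    show "q * ?p ^ i \<noteq> 1" for i using zp(2)[of i] z_ne_1(1)[of i] by simp
    show "q * ?p / (c * q) * ?p ^ i \<noteq> 1" "q * ?p / (d * q) * ?p ^ i \<noteq> 1"
      "q * ?p / (D * q) * ?p ^ i \<noteq> 1" "q * ?p / (E * q) * ?p ^ i \<noteq> 1" for i
      unfolding s[OF c0] s[OF d0] s[OF assms(1)] s[OF assms(2)] zx
      using cd1 D1 E1 assms(1,2) by auto
    show "D * q * (E * q) / (q * ?p ^ N) * ?p ^ i \<noteq> 1" if "i < N" for i
      using DEF[OF that] unfolding s5 by (simp add: zp[symmetric] mult_ac)
  qed (use q0 c0 d0 assms(1,2) in simp_all)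
  have e1: "(1 - q * ?p ^ (2 * k)) / (1 - q) = qnum q (4 * k + 1)" for k
    by (simp add: qnum_def power_mult[symmetric] mult.assoc)
  show ?thesis
    using W unfolding s[OF c0] s[OF d0] s[OF assms(1)] s[OF assms(2)] s2 s3 s4 s5 s6 e1 unfolding s7 T_conv power_mult
    by (simp add: mult_ac)
qed

section \<open>Antisymmetry of the undeformed summands\<close>

definition \<rho> where "\<rho> i = r 1 i ^ 4 * r c i * r d i * (q / (c * d))"
definition u where "u k = (\<Prod>i<k. \<rho> i)"

lemma T_111: "T 1 1 1 k = qnum q (4 * k + 1) * u k"
  by (simp add: T_def u_def \<rho>_def power4_eq_xxxx mult_ac)

lemma qnum_R: "qnum q k \<in> R"
  using q_not_root[of 0] by (subst qnum_eq_sum) (auto intro!: R_intros)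

lemma one_minus_q_U: "1 - q \<in> U"
  using diff_unit[of 1] not_dvd_between[of 1] n_gt_1 by simp

lemma z2_c_unit: "1 - z2 i / c \<in> U" and z2_d_unit: "1 - z2 i / d \<in> U"
  unfolding z2_def by (rule c_diff_unit d_diff_unit)+

lemma z2_unit_gen: "\<not> n dvd Suc i \<Longrightarrow> 1 - z2 i \<in> U"
proof -
  assume "\<not> n dvd Suc i"
  moreover have "coprime n 2" using n_odd by simp
  ultimately have "\<not> n dvd 2 * Suc i" using coprime_dvd_mult_right_iff by blast
  then show ?thesis unfolding z2_def using diff_unit[of "2 * Suc i"] by simp
qed

lemma r_c_R: "r c i \<in> R" and r_d_R: "r d i \<in> R"
  unfolding r_def using z2_c_unit z2_d_unit U_R[OF z1_U] U_R[OF c_unit] U_R[OF d_unit]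
  by (auto intro!: divide_R diff_R one_R mult_R)

lemma r_1_R: "\<not> n dvd Suc i \<Longrightarrow> r 1 i \<in> R"
  unfolding r_def using z2_unit_gen U_R[OF z1_U] by (auto intro!: divide_R diff_R one_R)

lemma \<rho>_R: "\<not> n dvd Suc i \<Longrightarrow> \<rho> i \<in> R"
  unfolding \<rho>_def using r_1_R[of i] r_c_R r_d_R by (intro R_intros) auto

lemma not_dvd_Suc: "i < N \<Longrightarrow> \<not> n dvd Suc i"
  using n_eq by (intro not_dvd_between) auto

lemma u_R: "k \<le> N \<Longrightarrow> u k \<in> R"
  unfolding u_def by (intro prod_R \<rho>_R not_dvd_Suc) auto

lemma r_refl:
  assumes "i < N" "1 - z2 (N - Suc i) / x \<in> U" "x \<noteq> 0"
  shows "cg 1 ((1 - x * z1 i) / (1 - z2 (N - Suc i) / x)) (- x * z1 i)"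
  using refl_ratio[OF z_refl(1)[OF assms(1)] assms(2,3)] .

text \<open>Exchanging the two denominators puts each numerator over the denominator reflected to
  it, and both quotients become monomials.\<close>

lemma r_pair:
  assumes i: "i < N" and x: "x \<in> U" and X: "\<And>i. i < N \<Longrightarrow> 1 - z2 i / x \<in> U"
  shows "cg 1 (r x i * r x (N - Suc i)) (x ^ 2 * (q ^ n / q))"
proof -
  let ?i = "N - Suc i"
  have i': "?i < N" "N - Suc ?i = i" using i by auto
  have "r x i * r x ?i = ((1 - x * z1 i) / (1 - z2 ?i / x)) * ((1 - x * z1 ?i) / (1 - z2 i / x))"
    by (simp add: r_def)
  also have "cg 1 \<dots> ((- x * z1 i) * (- x * z1 ?i))"
    using r_refl[OF i X[OF i'(1)]] r_refl[OF i'(1)] X[OF i] i' U_nz[OF x] X[OF i'(1)] x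
    by (intro cg_mult divide_R diff_R one_R mult_R minus_R U_R[OF z1_U] U_R[OF x]) auto
  also have "(- x * z1 i) * (- x * z1 ?i) = x ^ 2 * (q ^ n / q)"
    using z_refl(1)[OF i] q0 by (simp add: z1_def z2_def power2_eq_square field_simps)
  finally show ?thesis .
qed

lemma cg_combine:
  assumes "cg 1 x x'" "cg 1 y y'" "cg 1 z z'" "x \<in> R" "y \<in> R" "z \<in> R" "t \<in> R"
  shows "cg 1 (x ^ 4 * (y * z) * t) (x' ^ 4 * (y' * z') * t)"
  using assms cg_R[OF assms(2)] cg_R[OF assms(3)]
  by (intro cg_rmult cg_mult cg_power mult_R power_R) auto

lemma \<rho>_pair:
  assumes i: "i < N"
  shows "cg 1 (q ^ 4 * (\<rho> i * \<rho> (N - Suc i))) 1"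
proof -
  let ?i = "N - Suc i"
  have nd: "\<not> n dvd Suc i" "\<not> n dvd Suc ?i" using i by (intro not_dvd_Suc; simp)+
  have 1: "cg 1 (r 1 i * r 1 ?i) (1 ^ 2 * (q ^ n / q))"
    using i z2_unit by (intro r_pair one_U) auto
  have c: "cg 1 (r c i * r c ?i) (c ^ 2 * (q ^ n / q))"
    using i z2_c_unit by (intro r_pair c_unit) auto
  have d: "cg 1 (r d i * r d ?i) (d ^ 2 * (q ^ n / q))"
    using i z2_d_unit by (intro r_pair d_unit) auto
  have "q ^ 4 * (\<rho> i * \<rho> ?i) = (r 1 i * r 1 ?i) ^ 4 * ((r c i * r c ?i) * (r d i * r d ?i))
      * ((q / (c * d)) ^ 2 * q ^ 4)"
    by (simp add: \<rho>_def power_mult_distrib power2_eq_square mult_ac)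
  also have "cg 1 \<dots> ((1 ^ 2 * (q ^ n / q)) ^ 4 * ((c ^ 2 * (q ^ n / q)) * (d ^ 2 * (q ^ n / q)))
      * ((q / (c * d)) ^ 2 * q ^ 4))"
    by (rule cg_combine[OF 1 c d]) (use r_1_R nd r_c_R r_d_R in \<open>auto intro!: R_intros\<close>)
  also have "\<dots> = q ^ (n * 6)"
    using q0 c0 d0
    by (simp add: power_mult power_divide power_mult_distrib field_simps eval_nat_numeral power_add)
  also have "cg 1 \<dots> 1" by (rule cg_qn_power)
  finally show ?thesis .
qed

text \<open>By \<open>\<rho>_pair\<close> the product of the top \<open>k\<close> ratios is inverse
  to that of the bottom \<open>k\<close> ratios up to \<open>q ^ (4 * k)\<close>.\<close>

lemma u_refl: "k \<le> N \<Longrightarrow> cg 1 (u (N - k)) (q ^ (4 * k) * u N * u k)"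
proof (induction k)
  case 0
  show ?case by (simp add: u_def)
next
  case (Suc k)
  let ?k = "N - Suc k"
  have k: "k < N" "N - k = Suc ?k" using Suc.prems by auto
  have nd: "\<not> n dvd Suc k" using k by (intro not_dvd_Suc) auto
  have uR: "u ?k \<in> R" using k by (intro u_R) auto
  have "cg 1 (u ?k * 1) (u ?k * (q ^ 4 * (\<rho> k * \<rho> ?k)))"
    by (rule cg_lmult[OF uR cg_sym[OF \<rho>_pair[OF k(1)]]])
  also have "u ?k * (q ^ 4 * (\<rho> k * \<rho> ?k)) = u (N - k) * (q ^ 4 * \<rho> k)"
    unfolding k(2) by (simp add: u_def mult_ac)
  also have "cg 1 \<dots> ((q ^ (4 * k) * u N * u k) * (q ^ 4 * \<rho> k))"
    using Suc.IH k nd by (intro cg_rmult mult_R power_R U_R[OF q_unit] \<rho>_R) auto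
  also have "\<dots> = q ^ (4 * Suc k) * u N * u (Suc k)"
    by (simp add: u_def power_add mult_ac)
  finally show ?case by simp
qed

lemma prod_z1: "(\<Prod>i<k. z1 i) = q ^ (k ^ 2)"
proof (induction k)
  case (Suc k)
  have "k ^ 2 + (2 * k + 1) = Suc k ^ 2" by (simp add: power2_eq_square)
  then show ?case using Suc.IH by (simp only: prod.lessThan_Suc z1_def power_add[symmetric])
qed simp

lemma prod_r_refl:
  assumes x: "x \<in> U" and X: "\<And>i. i < N \<Longrightarrow> 1 - z2 i / x \<in> U"
  shows "cg 1 (\<Prod>i<N. r x i) ((- x) ^ N * q ^ (N ^ 2))"
proof -
  have "(\<Prod>i<N. r x i) = (\<Prod>i<N. 1 - x * z1 i) / (\<Prod>i<N. 1 - z2 (N - Suc i) / x)"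
    unfolding r_def prod_dividef by (simp add: prod.nat_diff_reindex[of "\<lambda>i. 1 - z2 i / x"])
  also have "\<dots> = (\<Prod>i<N. (1 - x * z1 i) / (1 - z2 (N - Suc i) / x))"
    by (simp add: prod_dividef)
  also have "cg 1 \<dots> (\<Prod>i<N. - x * z1 i)"
  proof (rule cg_prod)
    fix i assume "i \<in> {..<N}"
    then have i: "i < N" "N - Suc i < N" by auto
    show "(1 - x * z1 i) / (1 - z2 (N - Suc i) / x) \<in> R \<and>
      cg 1 ((1 - x * z1 i) / (1 - z2 (N - Suc i) / x)) (- x * z1 i)"
      using r_refl[OF i(1) X[OF i(2)] U_nz[OF x]] X[OF i(2)] U_R[OF x] U_R[OF z1_U]
      by (auto intro!: divide_R diff_R one_R mult_R)
  qed
  also have "(\<Prod>i<N. - x * z1 i) = (- x) ^ N * q ^ (N ^ 2)"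
    unfolding prod.distrib prod_z1 by simp
  finally show ?thesis .
qed

lemma prod_r_R: "(\<Prod>i<N. r 1 i) \<in> R" "(\<Prod>i<k. r c i) \<in> R" "(\<Prod>i<k. r d i) \<in> R"
  by (intro prod_R r_1_R r_c_R r_d_R not_dvd_Suc; simp)+

lemma u_N: "cg 1 (u N) q"
proof -
  have 1: "cg 1 (\<Prod>i<N. r 1 i) ((- 1) ^ N * q ^ (N ^ 2))"
    using z2_unit by (intro prod_r_refl one_U) auto
  have c: "cg 1 (\<Prod>i<N. r c i) ((- c) ^ N * q ^ (N ^ 2))"
    using z2_c_unit by (intro prod_r_refl c_unit) auto
  have d: "cg 1 (\<Prod>i<N. r d i) ((- d) ^ N * q ^ (N ^ 2))"
    using z2_d_unit by (intro prod_r_refl d_unit) auto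
  have "u N = (\<Prod>i<N. r 1 i) ^ 4 * ((\<Prod>i<N. r c i) * (\<Prod>i<N. r d i)) * (q / (c * d)) ^ N"
    unfolding u_def \<rho>_def prod.distrib prod_power_distrib by (simp add: mult_ac)
  also have "cg 1 \<dots> (((- 1) ^ N * q ^ (N ^ 2)) ^ 4 * (((- c) ^ N * q ^ (N ^ 2)) * ((- d) ^ N * q ^ (N ^ 2)))
      * (q / (c * d)) ^ N)"
    by (rule cg_combine[OF 1 c d prod_r_R]) (intro R_intros)
  also have "\<dots> = (q ^ (N ^ 2)) ^ 6 * ((- c) * (- d) * (q / (c * d))) ^ N"
  proof -
    have "((- 1 :: 'a) ^ N) ^ 4 = 1" "X ^ 6 = X ^ 4 * (X * X)" for X :: 'a
      by (simp_all add: eval_nat_numeral flip: power_mult)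
    then show ?thesis by (simp only: power_mult_distrib mult_ac mult_1)
  qed
  also have "\<dots> = q ^ (N ^ 2 * 6 + N)"
    using c0 d0 by (simp add: power_add power_mult)
  \<comment> \<open>The exponent is 1 modulo \<open>n = 2N + 1\<close>; \<open>N > 0\<close> keeps
    the subtraction of natural numbers exact.\<close>
  also have "N ^ 2 * 6 + N = 1 + n * (3 * N - 1)"
    using N_pos by (subst n_eq) (cases N; simp add: power2_eq_square algebra_simps)
  also have "q ^ (1 + n * (3 * N - 1)) = q * q ^ (n * (3 * N - 1))" by simp
  also have "cg 1 \<dots> (q * 1)"
    by (intro cg_lmult cg_qn_power U_R[OF q_unit])
  finally show ?thesis by simp
qed

text \<open>The exponents \<open>4k + 1\<close> and \<open>4(N - k) + 1\<close> add up to
  \<open>2n\<close>, so the linear factor changes sign up to the power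
  \<open>q ^ (4 * k + 1)\<close>. This power is exactly what \<open>u_refl\<close> and
  \<open>u_N\<close> supply.\<close>

lemma T_refl:
  assumes k: "k \<le> N"
  shows "cg 1 (T 1 1 1 (N - k)) (- T 1 1 1 k)"
proof -
  have 1: "q \<noteq> 1" using q_not_root[of 0] by simp
  let ?A = "qnum q (4 * (N - k) + 1)"
  have "T 1 1 1 (N - k) = ?A * u (N - k)" by (rule T_111)
  also have "cg 1 \<dots> (?A * (q ^ (4 * k) * u N * u k))"
    by (intro cg_lmult qnum_R u_refl k)
  also have "cg 1 \<dots> (?A * (q ^ (4 * k) * q * u k))"
    using u_R[OF k] by (intro cg_lmult cg_rmult u_N qnum_R R_intros)
  also have "?A * (q ^ (4 * k) * q * u k) = (q ^ (4 * k + 1) - q ^ (n * 2)) / (1 - q) * u k"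
  proof -
    have "q ^ (n * 2) = q ^ (4 * k + 1) * q ^ (4 * (N - k) + 1)"
      unfolding power_add[symmetric] using k by (subst n_eq) (simp add: algebra_simps)
    then show ?thesis by (simp add: qnum_def right_diff_distrib left_diff_distrib mult_ac)
  qed
  also have "cg 1 \<dots> ((q ^ (4 * k + 1) - 1) / (1 - q) * u k)"
    by (intro cg_rmult cg_divide cg_diff cg_refl cg_qn_power one_minus_q_U u_R k)
  also have "\<dots> = - T 1 1 1 k"
    unfolding T_111 qnum_def minus_mult_left minus_divide_left by simp
  finally show ?thesis .
qed

lemma antisymmetric_sum:
  assumes "\<And>k. k \<le> N \<Longrightarrow> cg 1 (F (N - k)) (- F k)"
  shows "cg 1 (\<Sum>k\<le>N. F k) 0"
proof -
  have "(\<Sum>k\<le>N. F k) = (\<Sum>k\<le>N. F (N - k))"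
    using sum.nat_diff_reindex[of F "Suc N"] by (simp add: lessThan_Suc_atMost)
  also have "cg 1 \<dots> (\<Sum>k\<le>N. - F k)" by (intro cg_sum assms) auto
  finally have "cg 1 (\<Sum>k\<le>N. F k) (- (\<Sum>k\<le>N. F k))" by (simp add: sum_negf)
  from cg_add[OF this cg_refl[of _ "\<Sum>k\<le>N. F k"]] have "cg 1 (2 * (\<Sum>k\<le>N. F k)) (2 * 0)" by simp
  then show ?thesis by (rule cg_cancel[OF numeral_U])
qed

text \<open>\<open>v\<close> is the second-order quantity \<open>q\<^sup>n + q\<^sup>-\<^sup>n - 2\<close>: replacing \<open>(1 - z)\<^sup>2\<close> by
  \<open>(1 - q\<^sup>n z)(1 - z / q\<^sup>n)\<close> multiplies it by \<open>1 - v h(z)\<close>.\<close>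

definition v where "v = \<psi> ^ 2 / q ^ n"
definition w where "w = 1 - 1 / q ^ n"

lemma qn0: "q ^ n \<noteq> 0" using q0 by simp
lemma qn_U: "q ^ n \<in> U" by (intro R_intros)
lemma v_R: "v \<in> R" and w_R: "w \<in> R"
  unfolding v_def w_def by (intro R_intros \<psi>_R qn_U; assumption?)+
lemma v_cg: "cg 2 v 0"
  unfolding v_def by (rule cgI[of _ _ _ "1 / q ^ n"]) (auto intro: R_intros)
lemma w_cg: "cg 1 w 0"
  unfolding w_def
  by (rule cgI[of _ _ _ "- 1 / q ^ n"]) (use qn0 in \<open>auto simp: \<psi>_def field_simps intro: R_intros\<close>)

lemma pair_v: "z \<noteq> 1 \<Longrightarrow> (1 - q ^ n * z) * (1 - z / q ^ n) = (1 - z) ^ 2 * (1 - v * h z)"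
proof -
  assume "z \<noteq> 1"
  then have "(1 - z) ^ 2 * (1 - v * h z) = (1 - z) ^ 2 - v * z"
    by (simp add: h_def right_diff_distrib)
  also have "\<dots> = (1 - q ^ n * z) * (1 - z / q ^ n)"
    using qn0 by (simp add: v_def \<psi>_def field_simps power2_eq_square)
  finally show ?thesis by simp
qed

lemma qn_z2_U: "i < N \<Longrightarrow> 1 - q ^ n * z2 i \<in> U"
proof -
  assume i: "i < N"
  have "\<not> n dvd n + (2 * i + 2)"
    using i n_eq not_dvd_between[of "2 * i + 2"] by (subst dvd_add_right_iff) auto
  from diff_unit[OF this] show ?thesis by (simp add: z2_def power_add mult_ac)
qed

lemma z2_qn_U: "i < N \<Longrightarrow> 1 - z2 i / q ^ n \<in> U"
proof -
  assume i: "i < N"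
  have "q ^ n = z2 i * z1 (N - Suc i)" using z_refl(2)[OF i] by simp
  then have "1 - z2 i / q ^ n = - (1 - z1 (N - Suc i)) / z1 (N - Suc i)"
    using U_nz[OF z1_U] U_nz[OF z2_U] by (simp add: field_simps)
  then show ?thesis using i by (simp only:) (intro divide_U minus_U z1_U z1_unit, simp)
qed

lemma vh_U: "i < N \<Longrightarrow> 1 - v * h (z2 i) \<in> U"
proof -
  assume i: "i < N"
  have "1 - v * h (z2 i) = (1 - q ^ n * z2 i) * (1 - z2 i / q ^ n) / (1 - z2 i) ^ 2"
    using pair_v[OF z_ne_1(2)] z_ne_1(2)[of i] by simp
  then show ?thesis using i qn_z2_U z2_qn_U z2_unit by (auto intro!: divide_U mult_U power_U)
qed

lemma w_U: "i < N \<Longrightarrow> 1 - w / (1 - z2 i) \<in> U"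
proof -
  assume i: "i < N"
  have "1 - w / (1 - z2 i) = (1 - q ^ n * z2 i) / (q ^ n * (1 - z2 i))"
    using z_ne_1(2)[of i] qn0 by (simp add: w_def field_simps)
  then show ?thesis using i qn_z2_U z2_unit by (auto intro!: divide_U mult_U qn_U)
qed

text \<open>Relative changes of the term ratio under the two deformations, divided by
  \<open>v\<close> and by \<open>w\<close>; see \<open>r_XY\<close> and \<open>r_B\<close>. The
  denominators make these factorizations equalities and are 1 modulo \<psi>.\<close>

definition av where "av i = (h (z2 i) - h (z1 i)) / (1 - v * h (z2 i))"
definition bw where "bw i = (l (z1 i) + 1 + l (z2 i)) / (1 - w / (1 - z2 i))"

lemma h_z_R: "i < N \<Longrightarrow> h (z1 i) \<in> R" "i < N \<Longrightarrow> h (z2 i) \<in> R"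
  and l_z_R: "i < N \<Longrightarrow> l (z1 i) \<in> R" "i < N \<Longrightarrow> l (z2 i) \<in> R"
  using U_R[OF z1_U] U_R[OF z2_U] z1_unit z2_unit by (auto intro!: h_R l_R)

lemma av_R: "i < N \<Longrightarrow> av i \<in> R" and bw_R: "i < N \<Longrightarrow> bw i \<in> R"
  unfolding av_def bw_def using h_z_R l_z_R vh_U w_U
  by (auto intro!: divide_R diff_R add_R one_R)

lemma cg_z_refl:
  "i < N \<Longrightarrow> cg 1 (z1 i * z2 (N - Suc i)) 1" "i < N \<Longrightarrow> cg 1 (z2 i * z1 (N - Suc i)) 1"
  by (simp_all only: z_refl cg_qn)

text \<open>Reflection exchanges \<open>z1\<close> and \<open>z2\<close> up to inversion, under
  which \<open>h\<close> is invariant; a difference of the two values therefore changes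
  sign.\<close>

lemma av_refl:
  assumes i: "i < N"
  shows "cg 1 (av (N - Suc i)) (- av i)"
proof -
  let ?i = "N - Suc i"
  have i': "?i < N" using i by auto
  have av: "cg 1 (av i) (h (z2 i) - h (z1 i))" if i: "i < N" for i
  proof -
    have "cg 1 (v * h (z2 i)) 0"
      using cg_le[OF v_cg, of 1] h_z_R(2)[OF i] by (intro cg_rmult_0) auto
    from cg_diff[OF cg_refl this, of 1] have "cg 1 (1 - v * h (z2 i)) 1" by simp
    then have "cg 1 (av i) ((h (z2 i) - h (z1 i)) / 1)"
      unfolding av_def using vh_U[OF i] one_U h_z_R[OF i] by (intro cg_divide2 diff_R cg_refl) auto
    then show ?thesis by simp
  qed
  have "cg 1 (av ?i) (h (z2 ?i) - h (z1 ?i))" by (rule av[OF i'])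
  also have "cg 1 \<dots> (h (z1 i) - h (z2 i))"
    using cg_z_refl[OF i] i i' z1_unit z2_unit
    by (intro cg_diff h_refl z1_U z2_U) auto
  also have "\<dots> = - (h (z2 i) - h (z1 i))" by simp
  also have "cg 1 \<dots> (- av i)" by (rule cg_minus[OF cg_sym[OF av[OF i]]])
  finally show ?thesis .
qed

text \<open>The constant 1 in the numerator belongs half to each \<open>l\<close>, and
  \<open>l + 1/2\<close> is odd under inversion.\<close>

lemma bw_refl:
  assumes i: "i < N"
  shows "cg 1 (bw (N - Suc i)) (- bw i)"
proof -
  let ?i = "N - Suc i"
  have i': "?i < N" using i by auto
  have bw: "cg 1 (bw i) (l (z1 i) + 1 + l (z2 i))" if i: "i < N" for i
  proof -
    have "cg 1 (w / (1 - z2 i)) (0 / (1 - z2 i))"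
      by (rule cg_divide[OF w_cg z2_unit[OF i]])
    from cg_diff[OF cg_refl this, of 1] have "cg 1 (1 - w / (1 - z2 i)) 1" by simp
    then have "cg 1 (bw i) ((l (z1 i) + 1 + l (z2 i)) / 1)"
      unfolding bw_def using w_U[OF i] one_U l_z_R[OF i] by (intro cg_divide2 add_R one_R cg_refl) auto
    then show ?thesis by simp
  qed
  have "cg 1 (bw ?i) (l (z1 ?i) + 1 + l (z2 ?i))" by (rule bw[OF i'])
  also have "cg 1 \<dots> ((- 1 - l (z2 i)) + 1 + (- 1 - l (z1 i)))"
    using cg_z_refl[OF i] i i' z1_unit z2_unit
    by (intro cg_add l_refl z1_U z2_U cg_refl) auto
  also have "\<dots> = - (l (z1 i) + 1 + l (z2 i))" by simp
  also have "cg 1 \<dots> (- bw i)" by (rule cg_minus[OF cg_sym[OF bw[OF i]]])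
  finally show ?thesis .
qed

text \<open>By antisymmetry the last \<open>k\<close> terms sum to the negative of the first
  \<open>k\<close>. For \<open>k = N\<close> this makes the whole sum its own negative, hence zero
  because 2 is a unit; so the head sums are symmetric.\<close>

lemma partial_sum_refl:
  assumes a: "\<And>i. i < N \<Longrightarrow> cg 1 (a (N - Suc i)) (- a i)" and k: "k \<le> N"
  shows "cg 1 (\<Sum>i<N - k. a i) (\<Sum>i<k. a i)"
proof -
  have tail: "cg 1 (\<Sum>i<N. a i) ((\<Sum>i<N - k. a i) - (\<Sum>i<k. a i))" if k: "k \<le> N" for k
  proof -
    have "(\<Sum>i<N. a i) = (\<Sum>i<N - k. a i) + (\<Sum>i<k. a (N - k + i))"
      using sum_lessThan_add[of a "N - k" k] k by simp
    also have "(\<Sum>i<k. a (N - k + i)) = (\<Sum>i<k. a (N - k + (k - Suc i)))"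
      by (rule sum.nat_diff_reindex[symmetric])
    also have "\<dots> = (\<Sum>i<k. a (N - Suc i))" using k by (intro sum.cong) auto
    also have "cg 1 ((\<Sum>i<N - k. a i) + \<dots>) ((\<Sum>i<N - k. a i) + (\<Sum>i<k. - a i))"
      using k a by (intro cg_add cg_refl cg_sum) auto
    finally show ?thesis by (simp add: sum_negf)
  qed
  have "cg 1 (\<Sum>i<N. a i) (- (\<Sum>i<N. a i))" using tail[of N] by simp
  from cg_add[OF this cg_refl[of _ "\<Sum>i<N. a i"]] have "cg 1 (2 * (\<Sum>i<N. a i)) (2 * 0)" by simp
  then have "cg 1 (\<Sum>i<N. a i) 0" by (rule cg_cancel[OF numeral_U])
  from cg_trans[OF cg_sym[OF this] tail[OF k]]
  have "cg 1 ((\<Sum>i<N - k. a i) - (\<Sum>i<k. a i)) 0" by (rule cg_sym)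
  then show ?thesis by (simp only: cg_diff_iff)
qed

abbreviation X where "X \<equiv> q ^ n"
abbreviation Y where "Y \<equiv> 1 / q ^ n"

lemma r_XY: "i < N \<Longrightarrow> r X i * r Y i = r 1 i ^ 2 * (1 + v * av i)"
proof -
  assume i: "i < N"
  have z: "1 - z2 i \<noteq> 0" "1 - v * h (z2 i) \<noteq> 0"
    using U_nz[OF z2_unit[OF i]] U_nz[OF vh_U[OF i]] by auto
  have "r X i * r Y i = ((1 - q ^ n * z1 i) * (1 - z1 i / q ^ n)) / ((1 - q ^ n * z2 i) * (1 - z2 i / q ^ n))"
    by (simp add: r_def mult_ac)
  also have "\<dots> = ((1 - z1 i) ^ 2 * (1 - v * h (z1 i))) / ((1 - z2 i) ^ 2 * (1 - v * h (z2 i)))"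
    by (simp only: pair_v z_ne_1 not_False_eq_True)
  also have "\<dots> = r 1 i ^ 2 * ((1 - v * h (z1 i)) / (1 - v * h (z2 i)))"
    by (simp add: r_def power_divide)
  also have "(1 - v * h (z1 i)) / (1 - v * h (z2 i)) = 1 + v * av i"
    using z(2) by (simp add: av_def field_simps)
  finally show ?thesis .
qed

lemma r_B: "i < N \<Longrightarrow> r Y i / Y = r 1 i * (1 + w * bw i)"
proof -
  assume i: "i < N"
  define a b where "a = 1 - z1 i" and "b = 1 - z2 i"
  have z: "b \<noteq> 0" "a \<noteq> 0" "1 - w / b \<noteq> 0"
    using U_nz[OF z2_unit[OF i]] U_nz[OF z1_unit[OF i]] U_nz[OF w_U[OF i]] by (auto simp: a_def b_def)
  have "1 - z2 i / Y \<noteq> 0" using U_nz[OF qn_z2_U[OF i]] by (simp add: mult.commute)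
  moreover have "(1 - z2 i / Y) * Y = b - w" using qn0 by (simp add: b_def w_def field_simps)
  ultimately have "r Y i / Y = (1 - Y * z1 i) / (b - w)"
    unfolding r_def by (metis divide_divide_eq_left)
  also have "1 - Y * z1 i = a + w * z1 i" by (simp add: a_def w_def algebra_simps)
  also have "(a + w * z1 i) / (b - w) = (a / b) * ((1 + w * (z1 i / a)) / (1 - w / b))"
    using z by (simp add: divide_simps)
  also have "1 + w * (z1 i / a) = (1 - w / b) + w * (z1 i / a + 1 + z2 i / b)"
  proof -
    have "1 + z2 i / b = 1 / b" using z(1) by (simp add: b_def field_simps)
    moreover have "(1 - w / b) + w * (z1 i / a + 1 + z2 i / b)
        = 1 + w * (z1 i / a) + w * ((1 + z2 i / b) - 1 / b)"
      by (simp add: algebra_simps)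
    ultimately show ?thesis by simp
  qed
  also have "\<dots> / (1 - w / b) = 1 + w * bw i"
  proof -
    have "(t + w * S) / t = 1 + w * (S / t)" if "t \<noteq> 0" for t S
      using that by (simp add: add_divide_distrib)
    from this[OF z(3)] show ?thesis unfolding bw_def l_def a_def b_def .
  qed
  finally show ?thesis by (simp add: r_def a_def b_def)
qed

section \<open>The mixed difference of the left-hand sums\<close>

definition \<alpha> where "\<alpha> k = (\<Sum>i<k. av i)"
definition \<beta> where "\<beta> k = (\<Sum>i<k. bw i)"

lemma \<alpha>_R:
  "k \<le> N \<Longrightarrow> \<alpha> k \<in> R" and \<beta>_R: "k \<le> N \<Longrightarrow> \<beta> k \<in> R"
  unfolding \<alpha>_def \<beta>_def by (auto intro!: sum_R av_R bw_R)

lemma T_R: "k \<le> N \<Longrightarrow> T 1 1 1 k \<in> R"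
  unfolding T_111 by (intro mult_R qnum_R u_R)

lemma T_factor:
  assumes "k \<le> N"
  shows "T X Y 1 k = T 1 1 1 k * (\<Prod>i<k. 1 + v * av i)"
    and "T 1 1 Y k = T 1 1 1 k * (\<Prod>i<k. 1 + w * bw i)"
    and "T X Y Y k = T 1 1 1 k * ((\<Prod>i<k. 1 + v * av i) * (\<Prod>i<k. 1 + w * bw i))"
proof -
  \<comment> \<open>Because \<open>X Y = 1\<close>, the power of \<open>q / (c d X Y B)\<close> is
    untouched by the \<open>X\<close>-deformation, while its factor \<open>1/B\<close> joins
    \<open>r B\<close> to form the quotient treated in \<open>r_B\<close>.\<close>
  have XY: "X * Y = 1" using qn0 by simp
  have eq: "r 1 i * r X i * r Y i * r 1 i * r c i * r d i * (q / (c * d * X * Y * 1)) = \<rho> i * (1 + v * av i)" if "i \<in> {..<k}" for i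
  proof -
    have i: "i < N" using that assms by auto
    have "r 1 i * r X i * r Y i * r 1 i * r c i * r d i * (q / (c * d * X * Y * 1))
        = r 1 i * (r X i * r Y i) * r 1 i * r c i * r d i * (q / (c * d * (X * Y)))"
      by (simp only: mult_ac mult_1)
    also have "\<dots> = \<rho> i * (1 + v * av i)"
      unfolding r_XY[OF i] XY by (simp add: \<rho>_def eval_nat_numeral mult_ac)
    finally show ?thesis .
  qed
  have "T X Y 1 k = qnum q (4 * k + 1) * (\<Prod>i<k. \<rho> i * (1 + v * av i))"
    unfolding T_def by (simp only: prod.cong[OF refl eq])
  then show "T X Y 1 k = T 1 1 1 k * (\<Prod>i<k. 1 + v * av i)"
    by (simp add: T_111 u_def prod.distrib)
  have eq: "r 1 i * r 1 i * r 1 i * r Y i * r c i * r d i * (q / (c * d * 1 * 1 * Y)) = \<rho> i * (1 + w * bw i)" if "i \<in> {..<k}" for i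
  proof -
    have i: "i < N" using that assms by auto
    have "r 1 i * r 1 i * r 1 i * r Y i * r c i * r d i * (q / (c * d * 1 * 1 * Y))
        = r 1 i * r 1 i * r 1 i * (r Y i / Y) * r c i * r d i * (q / (c * d))"
      by (simp add: mult_ac)
    also have "\<dots> = \<rho> i * (1 + w * bw i)"
      unfolding r_B[OF i] by (simp add: \<rho>_def eval_nat_numeral mult_ac)
    finally show ?thesis .
  qed
  have "T 1 1 Y k = qnum q (4 * k + 1) * (\<Prod>i<k. \<rho> i * (1 + w * bw i))"
    unfolding T_def by (simp only: prod.cong[OF refl eq])
  then show "T 1 1 Y k = T 1 1 1 k * (\<Prod>i<k. 1 + w * bw i)"
    by (simp add: T_111 u_def prod.distrib)
  have eq: "r 1 i * r X i * r Y i * r Y i * r c i * r d i * (q / (c * d * X * Y * Y))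
        = \<rho> i * ((1 + v * av i) * (1 + w * bw i))" if "i \<in> {..<k}" for i
  proof -
    have i: "i < N" using that assms by auto
    have "r 1 i * r X i * r Y i * r Y i * r c i * r d i * (q / (c * d * X * Y * Y))
        = r 1 i * (r X i * r Y i) * (r Y i / Y) * r c i * r d i * (q / (c * d * (X * Y)))"
      by (simp add: mult_ac)
    also have "\<dots> = \<rho> i * ((1 + v * av i) * (1 + w * bw i))"
      unfolding r_XY[OF i] r_B[OF i] XY by (simp add: \<rho>_def eval_nat_numeral mult_ac)
    finally show ?thesis .
  qed
  have "T X Y Y k = qnum q (4 * k + 1) * (\<Prod>i<k. \<rho> i * ((1 + v * av i) * (1 + w * bw i)))"
    unfolding T_def by (simp only: prod.cong[OF refl eq])
  then show "T X Y Y k = T 1 1 1 k * ((\<Prod>i<k. 1 + v * av i) * (\<Prod>i<k. 1 + w * bw i))"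
    by (simp add: T_111 u_def prod.distrib mult_ac)
qed

text \<open>The two deformations act by multiplication with products \<open>P\<close> and
  \<open>Q\<close>, so the mixed difference is \<open>T 1 1 1 k\<close> times \<open>P - 1\<close>
  times \<open>Q - 1\<close>. These start with \<open>v * \<alpha> k\<close> and
  \<open>w * \<beta> k\<close>; the next terms contribute at order four or higher.\<close>

lemma T_mixed_difference:
  assumes k: "k \<le> N"
  shows "cg 4 (T 1 1 1 k - T X Y 1 k - T 1 1 Y k + T X Y Y k) (v * w * (T 1 1 1 k * \<alpha> k * \<beta> k))"
proof -
  obtain r where r: "r \<in> R" "(\<Prod>i<k. 1 + v * av i) = 1 + v * \<alpha> k + v ^ 2 * r"
    using prod_one_plus[OF v_R, of k av] av_R k unfolding \<alpha>_def by auto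
  obtain s where s: "s \<in> R" "(\<Prod>i<k. 1 + w * bw i) = 1 + w * \<beta> k + w ^ 2 * s"
    using prod_one_plus[OF w_R, of k bw] bw_R k unfolding \<beta>_def by auto
  have "T 1 1 1 k - T X Y 1 k - T 1 1 Y k + T X Y Y k - v * w * (T 1 1 1 k * \<alpha> k * \<beta> k)
      = (v * (w * w)) * (T 1 1 1 k * \<alpha> k * s) + (v * v) * (w * T 1 1 1 k * r * (\<beta> k + w * s))"
    unfolding T_factor[OF k] r s by (simp add: algebra_simps power2_eq_square)
  also have "cg 4 \<dots> (0 + 0)"
  proof (rule cg_add)
    have "cg (2 + (1 + 1)) (v * (w * w)) 0" by (intro cg_mult_0 v_cg w_cg)
    then show "cg 4 ((v * (w * w)) * (T 1 1 1 k * \<alpha> k * s)) 0"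
      using T_R[OF k] \<alpha>_R[OF k] s by (intro cg_rmult_0[of _ _ "v * (w * w)"] mult_R) simp_all
    have "cg (2 + 2) (v * v) 0" by (intro cg_mult_0 v_cg)
    then show "cg 4 ((v * v) * (w * T 1 1 1 k * r * (\<beta> k + w * s))) 0"
      using T_R[OF k] \<beta>_R[OF k] s r w_R by (intro cg_rmult_0[of _ _ "v * v"] mult_R add_R) simp_all
  qed
  finally show ?thesis by (simp add: cg_diff_iff)
qed

text \<open>Under \<open>k -> N - k\<close> and modulo \<psi> the summand is odd while \<alpha> and
  \<beta> are even, so the coefficient of the order-three term is itself divisible by
  \<psi>.\<close>

lemma T_sum_mixed_difference:
  "cg 4 (\<Sum>k\<le>N. T 1 1 1 k) ((\<Sum>k\<le>N. T X Y 1 k) + (\<Sum>k\<le>N. T 1 1 Y k) - (\<Sum>k\<le>N. T X Y Y k))"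
proof -
  have R: "T 1 1 1 k * \<alpha> k * \<beta> k \<in> R" if "k \<le> N" for k
    using that by (intro mult_R T_R \<alpha>_R \<beta>_R)
  have "cg 1 (\<Sum>k\<le>N. T 1 1 1 k * \<alpha> k * \<beta> k) 0"
  proof (rule antisymmetric_sum)
    fix k assume k: "k \<le> N"
    have "cg 1 (T 1 1 1 (N - k) * \<alpha> (N - k) * \<beta> (N - k)) (- T 1 1 1 k * \<alpha> k * \<beta> k)"
      using k partial_sum_refl[of av, OF av_refl k] partial_sum_refl[of bw, OF bw_refl k]
      by (intro cg_mult T_refl mult_R T_R \<alpha>_R \<beta>_R) (auto simp: \<alpha>_def \<beta>_def intro!: sum_R av_R bw_R)
    then show "cg 1 (T 1 1 1 (N - k) * \<alpha> (N - k) * \<beta> (N - k)) (- (T 1 1 1 k * \<alpha> k * \<beta> k))"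
      by simp
  qed
  from cg_mult_0[OF cg_mult_0[OF v_cg w_cg] this]
  have "cg (2 + 1 + 1) (v * w * (\<Sum>k\<le>N. T 1 1 1 k * \<alpha> k * \<beta> k)) 0" .
  then have 0: "cg 4 (v * w * (\<Sum>k\<le>N. T 1 1 1 k * \<alpha> k * \<beta> k)) 0" by simp
  have "(\<Sum>k\<le>N. T 1 1 1 k) - ((\<Sum>k\<le>N. T X Y 1 k) + (\<Sum>k\<le>N. T 1 1 Y k) - (\<Sum>k\<le>N. T X Y Y k))
      = (\<Sum>k\<le>N. T 1 1 1 k - T X Y 1 k - T 1 1 Y k + T X Y Y k)"
    by (simp add: sum.distrib sum_subtractf)
  also have "cg 4 \<dots> (\<Sum>k\<le>N. v * w * (T 1 1 1 k * \<alpha> k * \<beta> k))"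
    by (intro cg_sum T_mixed_difference) auto
  also have "\<dots> = v * w * (\<Sum>k\<le>N. T 1 1 1 k * \<alpha> k * \<beta> k)"
    by (simp only: sum_distrib_left)
  also note 0
  finally show ?thesis by (simp only: cg_diff_iff)
qed

section \<open>Comparison of the right-hand sums\<close>

abbreviation G where "G x y b \<equiv> (\<Sum>k\<le>N. V x y b k)"

text \<open>On the right side \<open>X\<close> and \<open>Y\<close> occur in numerators only, so
  \<open>pair_v\<close> for the odd powers accounts for the whole deformation.\<close>

lemma V_factor: "V X Y b k = V 1 1 b k * (\<Prod>i<k. 1 - v * h (z1 i))"
  unfolding V_def prod.distrib[symmetric]
proof (intro prod.cong refl)
  fix i
  have "(1 - X * z1 i) * (1 - Y * z1 i) = (1 - z1 i) * (1 - z1 i) * (1 - v * h (z1 i))"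
    using pair_v[OF z_ne_1(1)] by (simp add: power2_eq_square)
  then show "(1 - q / (c * d) * (q ^ 2) ^ i) * (1 - X * z1 i) * (1 - Y * z1 i) * (1 - b * z1 i)
      / ((1 - z2 i) * (1 - z2 i / c) * (1 - z2 i / d) * (1 - b * z2 i)) * q ^ 2
    = (1 - q / (c * d) * (q ^ 2) ^ i) * (1 - 1 * z1 i) * (1 - 1 * z1 i) * (1 - b * z1 i)
      / ((1 - z2 i) * (1 - z2 i / c) * (1 - z2 i / d) * (1 - b * z2 i)) * q ^ 2 * (1 - v * h (z1 i))"
    by (simp only: mult_1 mult.assoc) (simp add: mult_ac)
qed

definition V0 where "V0 i = (1 - q / (c * d) * (q ^ 2) ^ i) * (1 - z1 i) ^ 2
      / ((1 - z2 i) * (1 - z2 i / c) * (1 - z2 i / d)) * q ^ 2"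

lemma V_V0: "V 1 1 b k = (\<Prod>i<k. V0 i * ((1 - b * z1 i) / (1 - b * z2 i)))"
  unfolding V_def V0_def by (intro prod.cong refl) (simp add: power2_eq_square mult_ac)

lemma V0_R: "i < N \<Longrightarrow> V0 i \<in> R"
  unfolding V0_def using z2_unit U_R[OF z1_U] z2_c_unit z2_d_unit by (intro R_intros) auto

lemma Y_R: "Y \<in> R" by (intro R_intros)

lemma cg_Y: "cg 1 Y 1"
  using cg_divide[OF cg_sym[OF cg_qn] qn_U] by (simp only: divide_self[OF qn0])

lemma z2_Y_U: "i < N \<Longrightarrow> 1 - Y * z2 i \<in> U"
  using z2_qn_U by simp

lemma V_R: "k \<le> N \<Longrightarrow> V 1 1 1 k \<in> R" "k \<le> N \<Longrightarrow> V 1 1 Y k \<in> R"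
  unfolding V_V0 using z2_Y_U z2_unit V0_R U_R[OF z1_U] Y_R
  by (auto intro!: prod_R mult_R divide_R diff_R one_R simp del: times_divide_eq_left divide_minus_left)

lemma V_cg: "k \<le> N \<Longrightarrow> cg 1 (V 1 1 Y k) (V 1 1 1 k)"
  unfolding V_V0
proof (intro cg_prod conjI)
  fix i assume "k \<le> N" "i \<in> {..<k}"
  then have i: "i < N" by auto
  show "V0 i * ((1 - Y * z1 i) / (1 - Y * z2 i)) \<in> R"
    using z2_Y_U[OF i] V0_R[OF i] mult_R[OF Y_R U_R[OF z1_U]]
    by (intro mult_R[of "V0 i"] divide_R diff_R one_R) auto
  have "cg 1 (1 - Y * z) (1 - 1 * z)" if "z \<in> R" for z
    using that by (intro cg_diff cg_refl cg_rmult cg_Y)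
  then show "cg 1 (V0 i * ((1 - Y * z1 i) / (1 - Y * z2 i))) (V0 i * ((1 - 1 * z1 i) / (1 - 1 * z2 i)))"
    using z2_Y_U[OF i] V0_R[OF i] U_R[OF z1_U] U_R[OF z2_U] Y_R z2_unit[OF i]
    by (intro cg_lmult cg_divide2 diff_R one_R mult_R) auto
qed

lemma prod_vh: "k \<le> N \<Longrightarrow> cg 2 ((\<Prod>i<k. 1 - v * h (z1 i)) - 1) 0"
proof -
  assume k: "k \<le> N"
  obtain r where "r \<in> R" "(\<Prod>i<k. 1 + v * (- h (z1 i))) = 1 + v * (\<Sum>i<k. - h (z1 i)) + v ^ 2 * r"
    using prod_one_plus[OF v_R, of k "\<lambda>i. - h (z1 i)"] h_z_R k minus_R by auto
  then have "(\<Prod>i<k. 1 - v * h (z1 i)) - 1 = v * ((\<Sum>i<k. - h (z1 i)) + v * r)" "r \<in> R"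
    by (simp_all add: algebra_simps power2_eq_square)
  moreover have "(\<Sum>i<k. - h (z1 i)) + v * r \<in> R"
    using \<open>r \<in> R\<close> k h_z_R(1) by (intro add_R sum_R minus_R mult_R v_R) auto
  ultimately show ?thesis using v_cg by (simp add: cg_rmult_0)
qed

lemma G_R: "G 1 1 1 \<in> R" "G 1 1 Y \<in> R"
  by (auto intro!: sum_R V_R)

lemma G_cg_1: "cg 1 (G 1 1 Y) (G 1 1 1)"
  by (intro cg_sum V_cg) auto

lemma G_cg_2: "cg 2 (G 1 1 Y) (G X Y Y)"
proof (rule cg_sym, rule cg_sum)
  fix k assume "k \<in> {..N}"
  then have k: "k \<le> N" by auto
  have "cg 2 (V 1 1 Y k * ((\<Prod>i<k. 1 - v * h (z1 i)) - 1)) 0"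
    by (intro cg_lmult_0 V_R k prod_vh)
  moreover have "V X Y Y k - V 1 1 Y k = V 1 1 Y k * ((\<Prod>i<k. 1 - v * h (z1 i)) - 1)"
    unfolding V_factor by (simp add: right_diff_distrib)
  ultimately show "cg 2 (V X Y Y k) (V 1 1 Y k)" by (metis cg_diff_iff)
qed

text \<open>A mixed difference again: termwise it is, up to sign, the first-order change caused by
  \<open>Y\<close> in the last place times the relative second-order change caused by the pair
  \<open>X, Y\<close>.\<close>

lemma G_cg_3: "cg 3 (G X Y 1 - G X Y Y) (G 1 1 1 - G 1 1 Y)"
  unfolding sum_subtractf[symmetric]
proof (rule cg_sum)
  fix k assume "k \<in> {..N}"
  then have k: "k \<le> N" by auto
  have "cg (1 + 2) ((V 1 1 Y k - V 1 1 1 k) * ((\<Prod>i<k. 1 - v * h (z1 i)) - 1)) 0"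
    using V_cg[OF k] by (intro cg_mult_0 prod_vh k) (simp add: cg_diff_iff)
  then have "cg 3 (- ((V 1 1 Y k - V 1 1 1 k) * ((\<Prod>i<k. 1 - v * h (z1 i)) - 1))) (- 0)"
    by (intro cg_minus) (simp add: numeral_3_eq_3)
  moreover have "(V X Y 1 k - V X Y Y k) - (V 1 1 1 k - V 1 1 Y k)
      = - ((V 1 1 Y k - V 1 1 1 k) * ((\<Prod>i<k. 1 - v * h (z1 i)) - 1))"
    unfolding V_factor by (simp add: algebra_simps)
  ultimately show "cg 3 (V X Y 1 k - V X Y Y k) (V 1 1 1 k - V 1 1 Y k)" by (metis cg_diff_iff minus_zero)
qed

section \<open>Evaluation of the three terminating sums\<close>

lemma q_power_ne: "i \<noteq> j \<Longrightarrow> q ^ i \<noteq> q ^ j"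
proof (induction i j rule: linorder_wlog)
  case (le i j)
  then have "q ^ j = q ^ i * q ^ (j - i)" by (simp add: power_add[symmetric])
  then show ?case using q_power_ne_1[of "j - i"] le q0 by auto
qed (metis)

lemma z2_ne_X: "z2 i \<noteq> X" unfolding z2_def by (rule q_power_ne) (use n_odd in presburger)

lemma z2_ne_Y: "z2 i \<noteq> Y"
  using q_power_ne_1[of "2 * i + 2 + n"] qn0 unfolding z2_def power_add by (auto simp: field_simps)

lemma Y_z2_ne_1: "Y * z2 i \<noteq> 1"
  using z2_ne_X[of i] qn0 by (auto simp: field_simps)

text \<open>At \<open>k = N\<close> the extra factor is \<open>[n]\<close>; this is how every right
  side acquires it.\<close>

lemma qpoch_q3: "qpoch (q ^ 3) (q ^ 2) k = (\<Prod>i<k. 1 - z1 i) * qnum q (2 * k + 1)"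
proof -
  have "(1 - q) * qpoch (q ^ 3) (q ^ 2) k = qpoch q (q ^ 2) (Suc k)"
    by (simp add: qpoch_Suc' flip: power_Suc)
  also have "\<dots> = (\<Prod>i<k. 1 - z1 i) * (1 - q ^ (2 * k + 1))"
    by (simp add: qpoch_Suc qpoch_z1' power_mult)
  finally show ?thesis using q_not_root[of 0] by (simp add: qnum_def field_simps)
qed

lemma prod_nz:
  "(\<Prod>i<k. 1 - z1 i) \<noteq> 0" "(\<Prod>i<k. 1 - z2 i) \<noteq> 0" "(\<Prod>i<k. z1 i) \<noteq> 0" "(\<Prod>i<k. z2 i) \<noteq> 0"
  using z_ne_1 U_nz[OF z1_U] U_nz[OF z2_U] by (auto dest: z_ne_1[THEN notE, OF sym])

text \<open>\<open>T\<close> is symmetric in its deformed parameters, so \<open>Y\<close> may take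
  the terminating place. For \<open>X = q^n\<close> the reflection of odd and even powers is exact:
  numerator and denominator of the prefactor exchange roles, the signs cancel, and the quotient of
  the products of \<open>z1\<close> and \<open>z2\<close> remains, which is \<open>q^-N\<close>. The
  product \<open>D E F\<close> on Watson's right side equals the parameter \<open>B\<close> of
  \<open>V\<close> here and in the two evaluations below.\<close>

lemma T_sum_XY1: "(\<Sum>k\<le>N. T X Y 1 k) = qnum q n * (1 / q ^ N) * G X Y 1"
proof -
  have XY: "X * 1 * Y = 1" using qn0 by simp
  have "(\<Sum>k\<le>N. T X Y 1 k) = (\<Sum>k\<le>N. T X 1 Y k)"
    unfolding T_def by (simp add: mult_ac)
  also have "\<dots> = qpoch (q ^ 3) (q ^ 2) N * qpoch (q / (X * 1)) (q ^ 2) N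
      / (qpoch (q ^ 2 / X) (q ^ 2) N * qpoch (q ^ 2 / 1) (q ^ 2) N) * G X Y 1"
    unfolding V_conv
    by (subst watson_T[of X 1 Y]) (use qn0 z2_ne_X z_ne_1 XY in \<open>simp_all add: mult_ac\<close>)
  also have "qpoch (q / (X * 1)) (q ^ 2) N = (\<Prod>i<N. - ((1 - z2 i) / z2 i))"
  proof -
    have "qpoch (q / (X * 1)) (q ^ 2) N = (\<Prod>i<N. 1 - z1 i / q ^ n)"
      using qpoch_z1[of "1 / q ^ n" N] by simp
    also have "\<dots> = (\<Prod>i<N. - ((1 - z2 (N - Suc i)) / z2 (N - Suc i)))"
    proof (intro prod.cong refl)
      fix i assume "i \<in> {..<N}"
      then have "q ^ n = z1 i * z2 (N - Suc i)" using z_refl(1)[of i] by simp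
      then show "1 - z1 i / q ^ n = - ((1 - z2 (N - Suc i)) / z2 (N - Suc i))"
        using U_nz[OF z1_U] U_nz[OF z2_U] by (simp add: field_simps)
    qed
    finally show ?thesis by (simp only: prod.nat_diff_reindex[of "\<lambda>i. - ((1 - z2 i) / z2 i)"])
  qed
  also have "qpoch (q ^ 2 / X) (q ^ 2) N = (\<Prod>i<N. - ((1 - z1 i) / z1 i))"
  proof -
    have "qpoch (q ^ 2 / X) (q ^ 2) N = (\<Prod>i<N. 1 - z2 i / q ^ n)" by (rule qpoch_z2')
    also have "\<dots> = (\<Prod>i<N. - ((1 - z1 (N - Suc i)) / z1 (N - Suc i)))"
    proof (intro prod.cong refl)
      fix i assume "i \<in> {..<N}"
      then have "q ^ n = z2 i * z1 (N - Suc i)" using z_refl(2)[of i] by simp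
      then show "1 - z2 i / q ^ n = - ((1 - z1 (N - Suc i)) / z1 (N - Suc i))"
        using U_nz[OF z1_U] U_nz[OF z2_U] by (simp add: field_simps)
    qed
    finally show ?thesis by (simp only: prod.nat_diff_reindex[of "\<lambda>i. - ((1 - z1 i) / z1 i)"])
  qed
  also have "qpoch (q ^ 2 / 1) (q ^ 2) N = (\<Prod>i<N. 1 - z2 i)" by (simp add: qpoch_z2'')
  also have "(\<Prod>i<N. - ((1 - z2 i) / z2 i)) = (- 1) ^ N * ((\<Prod>i<N. 1 - z2 i) / (\<Prod>i<N. z2 i))"
    by (simp add: prod_uminus prod_dividef)
  also have "(\<Prod>i<N. - ((1 - z1 i) / z1 i)) = (- 1) ^ N * ((\<Prod>i<N. 1 - z1 i) / (\<Prod>i<N. z1 i))"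
    by (simp add: prod_uminus prod_dividef)
  also have "(\<Prod>i<N. z2 i) = (\<Prod>i<N. z1 i) * q ^ N"
  proof -
    have "(\<Prod>i<N. z2 i) = (\<Prod>i<N. z1 i * q)" by (simp add: z1_def z2_def mult_ac)
    then show ?thesis by (simp add: prod.distrib)
  qed
  finally show ?thesis
    unfolding qpoch_q3 n_eq[symmetric] using prod_nz[of N] q0 by (simp add: mult_ac)
qed

text \<open>\<open>Q1\<close> and \<open>Q2\<close> are the prefactors of the other two evaluations
  without their factor \<open>[n]\<close>.\<close>

definition Q1 where "Q1 = (\<Prod>i<N. r 1 i) ^ 2"
definition Q2 where "Q2 = Q1 / (\<Prod>i<N. 1 - v * h (z2 i))"

lemma T_sum_11Y: "(\<Sum>k\<le>N. T 1 1 Y k) = qnum q n * Q1 * G 1 1 Y"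
proof -
  have "(\<Sum>k\<le>N. T 1 1 Y k) = qpoch (q ^ 3) (q ^ 2) N * qpoch (q / (1 * 1)) (q ^ 2) N
      / (qpoch (q ^ 2 / 1) (q ^ 2) N * qpoch (q ^ 2 / 1) (q ^ 2) N) * G 1 1 Y"
    unfolding V_conv
    by (subst watson_T[of 1 1 Y]) (use qn0 z_ne_1 Y_z2_ne_1 in \<open>simp_all add: mult_ac\<close>)
  also have "\<dots> = qnum q n * Q1 * G 1 1 Y"
    unfolding qpoch_q3 n_eq[symmetric] Q1_def r_def prod_dividef mult_1 div_by_1 qpoch_z1' qpoch_z2''
    by (simp add: power2_eq_square mult_ac)
  finally show ?thesis .
qed

lemma T_sum_XYY: "(\<Sum>k\<le>N. T X Y Y k) = qnum q n * Q2 * G X Y Y"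
proof -
  have XY: "X * Y = 1" using qn0 by simp
  have "(\<Sum>k\<le>N. T X Y Y k) = qpoch (q ^ 3) (q ^ 2) N * qpoch (q / (X * Y)) (q ^ 2) N
      / (qpoch (q ^ 2 / X) (q ^ 2) N * qpoch (q ^ 2 / Y) (q ^ 2) N) * G X Y Y"
    unfolding V_conv
    by (subst watson_T[of X Y Y]) (use qn0 z2_ne_X z2_ne_Y Y_z2_ne_1 in \<open>simp_all add: mult_ac\<close>)
  also have "qpoch (q ^ 2 / X) (q ^ 2) N * qpoch (q ^ 2 / Y) (q ^ 2) N
      = (\<Prod>i<N. 1 - z2 i) ^ 2 * (\<Prod>i<N. 1 - v * h (z2 i))"
  proof -
    have "qpoch (q ^ 2 / X) (q ^ 2) N * qpoch (q ^ 2 / Y) (q ^ 2) N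
        = (\<Prod>i<N. (1 - q ^ n * z2 i) * (1 - z2 i / q ^ n))"
      unfolding qpoch_z2' by (simp add: prod.distrib mult_ac)
    also have "\<dots> = (\<Prod>i<N. (1 - z2 i) ^ 2 * (1 - v * h (z2 i)))"
      by (intro prod.cong refl pair_v z_ne_1)
    finally show ?thesis by (simp add: prod.distrib prod_power_distrib)
  qed
  finally show ?thesis
    unfolding qpoch_q3 n_eq[symmetric] Q2_def Q1_def r_def prod_dividef XY mult_1 div_by_1 qpoch_z1'
    by (simp add: power2_eq_square mult_ac)
qed

section \<open>The sum of \<open>h\<close> over the even powers\<close>

lemma geometric_sum_cg_0:
  assumes "x \<in> R" "1 - x \<in> U" "cg 1 (x ^ n) 1"
  shows "cg 1 (\<Sum>s<n. x ^ s) 0"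
proof (rule cg_cancel[OF assms(2)])
  have "(1 - x) * (\<Sum>s<n. x ^ s) = 1 - x ^ n" by (simp add: one_diff_power_eq)
  also have "cg 1 \<dots> (1 - 1)" by (intro cg_diff cg_refl assms)
  finally show "cg 1 ((1 - x) * (\<Sum>s<n. x ^ s)) ((1 - x) * 0)" by simp
qed

text \<open>Modulo \<open>1 - q\<^sup>n\<close> the rational function \<open>h\<close> is a polynomial in \<open>x\<close>, so that it can be summed
  over the powers of \<open>q\<close> by orthogonality.\<close>

lemma h_cg:
  assumes "x \<in> R" "1 - x \<in> U" "cg 1 (x ^ n) 1"
  shows "cg 1 (2 * of_nat n * h x) (\<Sum>s<n. of_nat s * (of_nat n - of_nat s) * x ^ s)" (is "cg 1 _ ?S")
proof (rule cg_cancel[OF power_U[OF assms(2), of 2]])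
  have "(1 - x) ^ 2 * ?S = (of_nat n + 1) * x + (of_nat n - 1) * x * x ^ n - 2 * x * (\<Sum>s<n. x ^ s)"
    by (rule one_minus_square_times_sum)
  also have "cg 1 \<dots> ((of_nat n + 1) * x + (of_nat n - 1) * x * 1 - 2 * x * 0)"
    using assms by (intro cg_diff cg_add cg_lmult cg_refl geometric_sum_cg_0 mult_R add_R diff_R one_R
        of_nat_R numeral_R) auto
  also have "\<dots> = (1 - x) ^ 2 * (2 * of_nat n * h x)"
    using U_nz[OF assms(2)] by (simp add: h_def algebra_simps)
  finally show "cg 1 ((1 - x) ^ 2 * (2 * of_nat n * h x)) ((1 - x) ^ 2 * ?S)" by (rule cg_sym)
qed

definition \<epsilon> where "\<epsilon> = ((of_nat n) ^ 2 - 1) / (24 :: 'a)"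

lemma n_U: "of_nat n \<in> U"
  using nat_unit[of "n - 1"] n_gt_1 by simp

lemma \<epsilon>_R: "\<epsilon> \<in> R"
  unfolding \<epsilon>_def by (intro R_intros)

lemma even_power_unit: "0 < s \<Longrightarrow> s < n \<Longrightarrow> 1 - q ^ (2 * s) \<in> U"
  using z2_unit_gen[of "s - 1"] not_dvd_between[of s] by (cases s) (simp_all add: z2_def)

lemma even_power_cg: "cg 1 ((q ^ (2 * s)) ^ n) 1"
  using cg_qn_power[of "2 * s"] by (simp add: power_mult[symmetric] mult_ac)

text \<open>The symmetry \<open>j -> n - j\<close> doubles the sum to all \<open>0 < j < n\<close>.
  After insertion of the polynomial form of \<open>h\<close> and exchange of the sums, the powers of
  \<open>q^(2s)\<close> add up to \<open>-1\<close> for \<open>0 < s < n\<close>. So the doubled sum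
  is minus the sum of \<open>s (n - s)\<close> divided by \<open>2n\<close>, that is
  \<open>- (n^2 - 1) / 12\<close>, and halving gives the denominator 24.\<close>

lemma sum_h: "cg 1 (\<Sum>i<N. h (z2 i)) (- \<epsilon>)"
proof -
  let ?h = "\<lambda>j. h (q ^ (2 * j))"
  let ?c = "\<lambda>s. of_nat s * (of_nat n - of_nat s) :: 'a"
  have refl: "cg 1 (?h (n - j)) (?h j)" if "0 < j" "j < n" for j
  proof (rule h_refl)
    have "q ^ (2 * j) * q ^ (2 * (n - j)) = q ^ (n * 2)"
      unfolding power_add[symmetric] using that by (intro arg_cong[of _ _ "power q"]) auto
    then show "cg 1 (q ^ (2 * j) * q ^ (2 * (n - j))) 1" by (simp only: cg_qn_power)
  qed (use that in \<open>auto intro!: even_power_unit power_U q_unit\<close>)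
  have half: "(\<Sum>i<N. ?h (n - Suc i)) = (\<Sum>i<N. ?h (Suc (N + i)))"
  proof -
    have "(\<Sum>i<N. ?h (n - Suc i)) = (\<Sum>i<N. ?h (n - Suc (N - Suc i)))"
      by (rule sum.nat_diff_reindex[symmetric])
    also have "\<dots> = (\<Sum>i<N. ?h (Suc (N + i)))"
      using n_eq by (intro sum.cong refl arg_cong[of _ _ ?h]) auto
    finally show ?thesis .
  qed
  have z2: "z2 i = q ^ (2 * Suc i)" for i by (simp add: z2_def)
  have "2 * (\<Sum>i<N. h (z2 i)) = (\<Sum>i<N. ?h (Suc i)) + (\<Sum>i<N. ?h (Suc i))"
    by (simp add: z2_def)
  also have "cg 1 \<dots> ((\<Sum>i<N. ?h (Suc i)) + (\<Sum>i<N. ?h (n - Suc i)))"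
    using n_eq by (intro cg_add cg_refl cg_sum cg_sym[OF refl]) auto
  also have "\<dots> = (\<Sum>i<N + N. ?h (Suc i))"
    unfolding half sum_lessThan_add by simp
  also have "N + N = n - 1" using n_eq by simp
  finally have 1: "cg 1 (2 * (\<Sum>i<N. h (z2 i))) (\<Sum>i<n - 1. ?h (Suc i))" .
  have col: "cg 1 (\<Sum>i<n - 1. (q ^ (2 * Suc i)) ^ s) (- 1)" if s: "0 < s" "s < n" for s
  proof -
    have "cg 1 0 (\<Sum>i<n. (q ^ (2 * s)) ^ i)"
      using s by (intro cg_sym[OF geometric_sum_cg_0] even_power_unit even_power_cg power_R U_R[OF q_unit])
    also have "(\<Sum>i<n. (q ^ (2 * s)) ^ i) = 1 + (\<Sum>i<n - 1. (q ^ (2 * s)) ^ Suc i)"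
      using sum.lessThan_Suc_shift[of "\<lambda>i. (q ^ (2 * s)) ^ i" "n - 1"] n_gt_1 by simp
    finally have "cg 1 (1 + (\<Sum>i<n - 1. (q ^ (2 * s)) ^ Suc i)) 0" by (rule cg_sym)
    from cg_diff[OF this cg_refl[of _ 1]] show ?thesis
      by (simp add: power_mult[symmetric] mult_ac del: power_Suc mult_Suc mult_Suc_right)
  qed
  have "cg 1 ((2 * of_nat n) * (2 * (\<Sum>i<N. h (z2 i)))) ((2 * of_nat n) * (\<Sum>i<n - 1. ?h (Suc i)))"
    by (intro cg_lmult 1 mult_R of_nat_R numeral_R)
  also have "\<dots> = (\<Sum>i<n - 1. 2 * of_nat n * ?h (Suc i))" by (rule sum_distrib_left)
  also have "cg 1 \<dots> (\<Sum>i<n - 1. \<Sum>s<n. ?c s * (q ^ (2 * Suc i)) ^ s)"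
    by (intro cg_sum h_cg even_power_unit even_power_cg power_R U_R[OF q_unit]) auto
  also have "\<dots> = (\<Sum>s<n. \<Sum>i<n - 1. ?c s * (q ^ (2 * Suc i)) ^ s)" by (rule sum.swap)
  also have "\<dots> = (\<Sum>s<n. ?c s * (\<Sum>i<n - 1. (q ^ (2 * Suc i)) ^ s))"
    by (simp only: sum_distrib_left)
  also have "cg 1 \<dots> (\<Sum>s<n. ?c s * (- 1))"
  proof (rule cg_sum)
    fix s assume s: "s \<in> {..<n}"
    show "cg 1 (?c s * (\<Sum>i<n - 1. (q ^ (2 * Suc i)) ^ s)) (?c s * (- 1))"
    \<comment> \<open>For \<open>s = 0\<close> the inner sum is \<open>n - 1\<close> and not
      \<open>-1\<close>, but its weight is zero.\<close>
    proof (cases "s = 0")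
      case False
      then show ?thesis using s by (intro cg_lmult col mult_R diff_R of_nat_R) auto
    qed simp
  qed
  also have "\<dots> = - (\<Sum>s<n. ?c s)" by (simp add: sum_negf)
  also have "\<dots> = 2 * of_nat n * (2 * (- \<epsilon>))"
  proof -
    have "6 * (\<Sum>s<n. ?c s) = 6 * (2 * of_nat n * (2 * \<epsilon>))"
      unfolding sum_s_times_n_minus_s \<epsilon>_def by (simp add: field_simps power2_eq_square power3_eq_cube)
    then show ?thesis by simp
  qed
  finally have "cg 1 ((2 * of_nat n * 2) * (\<Sum>i<N. h (z2 i))) ((2 * of_nat n * 2) * (- \<epsilon>))"
    by (simp only: mult.assoc)
  then show ?thesis by (rule cg_cancel[rotated]) (intro mult_U numeral_U n_U)
qed

section \<open>Comparison of the prefactors\<close>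

abbreviation \<kappa> where "\<kappa> \<equiv> 1 / q ^ N"

lemma \<kappa>_R: "\<kappa> \<in> R" by (intro R_intros)

lemma Q1_cg: "cg 1 Q1 \<kappa>"
proof -
  have "cg 1 (\<Prod>i<N. r 1 i) ((- 1) ^ N * q ^ (N ^ 2))"
    using z2_unit by (intro prod_r_refl one_U) auto
  then have "cg 1 Q1 (((- 1) ^ N * q ^ (N ^ 2)) ^ 2)"
    unfolding Q1_def by (intro cg_power prod_r_R)
  also have "((- 1) ^ N * q ^ (N ^ 2)) ^ 2 = q ^ (N ^ 2 * 2)"
    by (simp add: power_mult_distrib flip: power_mult)
  also have "\<dots> = q ^ (n * N) / q ^ N"
  proof -
    \<comment> \<open>The exponent differs from a multiple of \<open>n\<close> by \<open>-N\<close>,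
      so only \<open>q^-N\<close> survives modulo \<psi>.\<close>
    have "N ^ 2 * 2 + N = n * N" by (subst n_eq) (simp add: power2_eq_square)
    then have "q ^ (N ^ 2 * 2) * q ^ N = q ^ (n * N)" by (simp only: power_add[symmetric])
    then show ?thesis using q0 by (simp add: field_simps)
  qed
  also have "cg 1 \<dots> \<kappa>" by (intro cg_divide cg_qn_power power_U q_unit)
  finally show ?thesis .
qed

lemma prod_vh2: "\<exists>s\<in>R. (\<Prod>i<N. 1 - v * h (z2 i)) = 1 - v * (\<Sum>i<N. h (z2 i)) + v ^ 2 * s"
proof -
  obtain s where "s \<in> R" "(\<Prod>i<N. 1 + v * (- h (z2 i))) = 1 + v * (\<Sum>i<N. - h (z2 i)) + v ^ 2 * s"
    using prod_one_plus[OF v_R, of N "\<lambda>i. - h (z2 i)"] h_z_R minus_R by auto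
  then show ?thesis by (auto simp: sum_negf)
qed

lemma prod_vh2_U: "(\<Prod>i<N. 1 - v * h (z2 i)) \<in> U"
  by (intro prod_U vh_U) auto

lemma Q1_R: "Q1 \<in> R" and Q2_R: "Q2 \<in> R"
  unfolding Q2_def Q1_def by (intro divide_R power_R prod_r_R prod_vh2_U)+

lemma Q2_cg: "cg 1 Q2 \<kappa>"
proof -
  obtain s where s: "s \<in> R" "(\<Prod>i<N. 1 - v * h (z2 i)) = 1 - v * (\<Sum>i<N. h (z2 i)) + v ^ 2 * s"
    using prod_vh2 by auto
  have "cg 1 (v * (- (\<Sum>i<N. h (z2 i)) + v * s)) 0"
    using cg_le[OF v_cg, of 1] s h_z_R v_R by (intro cg_rmult_0 add_R minus_R sum_R mult_R) auto
  from cg_add[OF cg_refl this, of 1] have "cg 1 (\<Prod>i<N. 1 - v * h (z2 i)) 1"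
    unfolding s(2) by (simp add: algebra_simps power2_eq_square)
  then have "cg 1 Q2 (\<kappa> / 1)"
    unfolding Q2_def by (intro cg_divide2 Q1_R prod_vh2_U one_U Q1_cg)
  then show ?thesis by simp
qed

text \<open>\<open>Q1 / Q2\<close> is the product of the factors \<open>1 - v * h (z2 i)\<close>,
  which by \<open>sum_h\<close> is \<open>1 + v * \<epsilon>\<close> to order three. As
  \<open>v\<close> already has order two, \<open>Q2\<close> and \<open>v / \<psi> ^ 2\<close> enter
  only through their residues \<kappa> and 1.\<close>

lemma Q_diff_cg: "cg 3 (Q1 - Q2) (\<kappa> * \<psi> ^ 2 * \<epsilon>)"
proof -
  obtain s where s: "s \<in> R" "(\<Prod>i<N. 1 - v * h (z2 i)) = 1 - v * (\<Sum>i<N. h (z2 i)) + v ^ 2 * s"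
    using prod_vh2 by auto
  let ?H = "- (\<Sum>i<N. h (z2 i))"
  have HR: "?H \<in> R" using h_z_R by (intro minus_R sum_R) auto
  have "Q1 = Q2 * (1 - v * (\<Sum>i<N. h (z2 i)) + v ^ 2 * s)"
    unfolding Q2_def s(2)[symmetric] using U_nz[OF prod_vh2_U] by simp
  then have eq: "Q1 - Q2 = v * (Q2 * (?H + v * s))"
    by (simp add: algebra_simps power2_eq_square)
  define K where "K = Q2 * (?H + v * s)"
  have eq': "Q1 - Q2 = v * K" using eq by (simp only: K_def)
  have "cg 1 (?H + v * s) (\<epsilon> + 0)"
    using cg_minus[OF sum_h] cg_le[OF v_cg, of 1] s(1) by (intro cg_add cg_rmult_0) auto
  then have "cg 1 K (\<kappa> * \<epsilon>)"
    unfolding K_def using Q2_R Q2_cg \<epsilon>_R by (intro cg_mult) auto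
  then have "cg 1 (K / q ^ n) (\<kappa> * \<epsilon> / q ^ n)"
    by (intro cg_divide qn_U)
  also have "cg 1 \<dots> (\<kappa> * \<epsilon>)"
    using cg_lmult[OF mult_R[OF \<kappa>_R \<epsilon>_R] cg_Y] by simp
  finally have "cg 1 (K / q ^ n - \<kappa> * \<epsilon>) 0" by (simp only: cg_diff_iff)
  from cg_mult_0[OF cg_\<psi>[of 2] this]
  have "cg 3 (\<psi> ^ 2 * (K / q ^ n - \<kappa> * \<epsilon>)) 0" by (simp add: numeral_3_eq_3)
  moreover have "\<psi> ^ 2 * (K / q ^ n - \<kappa> * \<epsilon>) = (Q1 - Q2) - \<kappa> * \<psi> ^ 2 * \<epsilon>"
    unfolding eq' v_def by (simp add: right_diff_distrib mult_ac)
  ultimately show ?thesis by (metis cg_diff_iff)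
qed

section \<open>The congruence to fourth order\<close>

lemma qnum_cg: "cg 1 (qnum q (n * k)) 0"
proof -
  have "cg 1 (qnum q (n * k)) ((1 - 1) / (1 - q))"
    unfolding qnum_def by (intro cg_divide cg_diff cg_refl cg_qn_power one_minus_q_U)
  then show ?thesis by simp
qed

lemma main_congruence:
  "cg 4 (\<Sum>k\<le>N. T 1 1 1 k) (qnum q n * \<kappa> * (1 + \<psi> ^ 2 * \<epsilon>) * G 1 1 1)"
proof -
  let ?L = "qnum q n" and ?G11 = "G 1 1 1" and ?G1 = "G X Y 1" and ?Gb = "G 1 1 Y" and ?Gab = "G X Y Y"
  \<comment> \<open>The combined right sides, stripped of \<open>[n]\<close>, are regrouped so that
    each summand is a product of known small quantities, of orders 3, 3, 1 + 2 and 2 + 1. The factor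
    \<open>[n]\<close> contributes the fourth order afterwards.\<close>
  have "cg 3 (\<kappa> * ((?G1 - ?Gab) - (?G11 - ?Gb)) + (Q1 - Q2 - \<kappa> * \<psi> ^ 2 * \<epsilon>) * ?Gb
      + (Q2 - \<kappa>) * (?Gb - ?Gab) + \<kappa> * \<epsilon> * (\<psi> ^ 2 * (?Gb - ?G11))) (0 + 0 + 0 + 0)"
  proof (intro cg_add)
    show "cg 3 (\<kappa> * ((?G1 - ?Gab) - (?G11 - ?Gb))) 0"
      using G_cg_3 by (intro cg_lmult_0 \<kappa>_R) (simp only: cg_diff_iff)
    show "cg 3 ((Q1 - Q2 - \<kappa> * \<psi> ^ 2 * \<epsilon>) * ?Gb) 0"
      using Q_diff_cg by (intro cg_rmult_0 G_R) (simp only: cg_diff_iff)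
    have "cg (1 + 2) ((Q2 - \<kappa>) * (?Gb - ?Gab)) 0"
      using Q2_cg G_cg_2 by (intro cg_mult_0) (simp_all only: cg_diff_iff)
    then show "cg 3 ((Q2 - \<kappa>) * (?Gb - ?Gab)) 0" by (simp add: numeral_3_eq_3)
    have "cg (2 + 1) (\<psi> ^ 2 * (?Gb - ?G11)) 0"
      using G_cg_1 by (intro cg_mult_0 cg_\<psi>) (simp only: cg_diff_iff)
    then have "cg 3 (\<psi> ^ 2 * (?Gb - ?G11)) 0" by (simp add: numeral_3_eq_3)
    then show "cg 3 (\<kappa> * \<epsilon> * (\<psi> ^ 2 * (?Gb - ?G11))) 0"
      by (rule cg_lmult_0[OF mult_R[OF \<kappa>_R \<epsilon>_R]])
  qed
  also have "\<kappa> * ((?G1 - ?Gab) - (?G11 - ?Gb)) + (Q1 - Q2 - \<kappa> * \<psi> ^ 2 * \<epsilon>) * ?Gb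
      + (Q2 - \<kappa>) * (?Gb - ?Gab) + \<kappa> * \<epsilon> * (\<psi> ^ 2 * (?Gb - ?G11))
    = \<kappa> * ?G1 + Q1 * ?Gb - Q2 * ?Gab - \<kappa> * (1 + \<psi> ^ 2 * \<epsilon>) * ?G11"
    by (simp only: algebra_simps mult_1)
  finally have 3: "cg 3 (\<kappa> * ?G1 + Q1 * ?Gb - Q2 * ?Gab - \<kappa> * (1 + \<psi> ^ 2 * \<epsilon>) * ?G11) 0"
    by simp
  have "cg 1 ?L 0" using qnum_cg[of 1] by simp
  from cg_mult_0[OF this 3]
  have 4: "cg 4 (?L * (\<kappa> * ?G1 + Q1 * ?Gb - Q2 * ?Gab - \<kappa> * (1 + \<psi> ^ 2 * \<epsilon>) * ?G11)) 0"
    by (simp add: eval_nat_numeral)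
  have "?L * (\<kappa> * ?G1 + Q1 * ?Gb - Q2 * ?Gab - \<kappa> * (1 + \<psi> ^ 2 * \<epsilon>) * ?G11)
     = ((\<Sum>k\<le>N. T X Y 1 k) + (\<Sum>k\<le>N. T 1 1 Y k) - (\<Sum>k\<le>N. T X Y Y k))
        - ?L * \<kappa> * (1 + \<psi> ^ 2 * \<epsilon>) * ?G11"
    unfolding T_sum_XY1 T_sum_11Y T_sum_XYY by (simp only: algebra_simps)
  with 4 have "cg 4 ((\<Sum>k\<le>N. T X Y 1 k) + (\<Sum>k\<le>N. T 1 1 Y k) - (\<Sum>k\<le>N. T X Y Y k))
      (?L * \<kappa> * (1 + \<psi> ^ 2 * \<epsilon>) * ?G11)" by (metis cg_diff_iff)
  with T_sum_mixed_difference show ?thesis by (rule cg_trans)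
qed

section \<open>Vanishing of the upper half of the sum\<close>

lemma prod_r_1_cg_0: "N < k \<Longrightarrow> k < n \<Longrightarrow> cg 1 (\<Prod>i<k. r 1 i) 0"
proof -
  assume k: "N < k" "k < n"
  have nd: "\<not> n dvd Suc i" if "i < k" for i using that k by (intro not_dvd_between) auto
  have "z1 N = q ^ n" unfolding z1_def by (subst n_eq) simp
  then have "r 1 N = \<psi> / (1 - z2 N)" by (simp add: r_def \<psi>_def)
  moreover have "cg 1 (\<psi> / (1 - z2 N)) (0 / (1 - z2 N))"
    using cg_\<psi>[of 1] z2_unit_gen[OF nd] k by (intro cg_divide) auto
  ultimately have "cg 1 (r 1 N) 0" by simp
  then have "cg 1 (r 1 N * (\<Prod>i\<in>{..<k} - {N}. r 1 i)) 0"
    using nd by (intro cg_rmult_0 prod_R r_1_R) auto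
  also have "r 1 N * (\<Prod>i\<in>{..<k} - {N}. r 1 i) = (\<Prod>i<k. r 1 i)"
    using k by (intro prod.remove[symmetric]) auto
  finally show ?thesis .
qed

lemma u_split: "u k = (\<Prod>i<k. r 1 i) ^ 4 * ((\<Prod>i<k. r c i) * (\<Prod>i<k. r d i) * (q / (c * d)) ^ k)"
  unfolding u_def \<rho>_def prod.distrib prod_power_distrib by (simp add: mult_ac)

text \<open>From \<open>k = N + 1\<close> on the numerator \<open>(q;q^2)_k\<close> contains
  \<open>1 - q^n\<close>, and up to \<open>k = n - 1\<close> the denominators are still units. The
  symbol occurs to the fourth power.\<close>

lemma T_upper_half: "N < k \<Longrightarrow> k < n \<Longrightarrow> cg 4 (T 1 1 1 k) 0"
proof -
  assume k: "N < k" "k < n"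
  have 1: "cg 1 (\<Prod>i<k. r 1 i) 0" using k by (intro prod_r_1_cg_0) auto
  have "cg (1 + 1 + (1 + 1)) (((\<Prod>i<k. r 1 i) * (\<Prod>i<k. r 1 i)) * ((\<Prod>i<k. r 1 i) * (\<Prod>i<k. r 1 i))) 0"
    by (intro cg_mult_0 1)
  then have "cg 4 ((\<Prod>i<k. r 1 i) ^ 4) 0" by (simp add: eval_nat_numeral mult_ac)
  then show ?thesis
    unfolding T_111 u_split by (intro cg_lmult_0 cg_rmult_0 qnum_R mult_R prod_r_R) (auto intro!: R_intros)
qed

lemma T_sum_full: "cg 4 (\<Sum>k<n. T 1 1 1 k) (\<Sum>k\<le>N. T 1 1 1 k)"
proof -
  have "(\<Sum>k<n. T 1 1 1 k) = (\<Sum>k\<le>N. T 1 1 1 k) + (\<Sum>i<N. T 1 1 1 (Suc N + i))"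
  proof -
    have "{..<n} = {..<Suc N + N}" using n_eq by (simp add: mult_2)
    then show ?thesis by (simp only: sum_lessThan_add lessThan_Suc_atMost)
  qed
  also have "cg 4 \<dots> ((\<Sum>k\<le>N. T 1 1 1 k) + 0)"
    using n_eq by (intro cg_add cg_refl cg_sum_0 T_upper_half) auto
  finally show ?thesis by simp
qed

text \<open>For \<open>k >= n\<close> the denominator contains non-units. The quotient is integral
  because it is the central Gaussian binomial coefficient divided by the square of
  \<open>(1 + q) ... (1 + q^k)\<close>, whose factors are units by \<open>add_unit\<close>.\<close>

lemma prod_r_1_R: "(\<Prod>i<k. r 1 i) \<in> R"
proof -
  have even_odd: "qpoch q (q ^ 2) k * qpoch (q ^ 2) (q ^ 2) k = qpoch q q (2 * k)" for k
  proof (induction k)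
    case (Suc k)
    have "qpoch q q (2 * Suc k) = (qpoch q (q ^ 2) k * qpoch (q ^ 2) (q ^ 2) k)
        * ((1 - q * (q ^ 2) ^ k) * (1 - q ^ 2 * (q ^ 2) ^ k))"
      unfolding Suc.IH by (simp add: qpoch_Suc power_mult power2_eq_square mult.assoc)
    then show ?case by (simp only: qpoch_Suc[of _ "q ^ 2"] mult_ac)
  qed simp
  have square: "qpoch (q ^ 2) (q ^ 2) k = qpoch q q k * (\<Prod>i<k. 1 + q ^ Suc i)" for k
    unfolding qpoch_def prod.distrib[symmetric]
    by (intro prod.cong refl) (simp add: power2_eq_square power_mult_distrib algebra_simps)
  have nz: "qpoch (q ^ 2) (q ^ 2) k \<noteq> 0" "qpoch q q k \<noteq> 0"
    using prod_nz[of k] q_not_root by (auto simp: qpoch_z2'' intro!: qpoch_nonzero)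
  have U: "(\<Prod>i<k. 1 + q ^ Suc i) \<in> U" by (intro prod_U add_unit)
  have "(\<Prod>i<k. r 1 i) = qpoch q (q ^ 2) k / qpoch (q ^ 2) (q ^ 2) k"
    using prod_r[of 1 k] by simp
  also have "\<dots> = qpoch q q (2 * k) / (qpoch (q ^ 2) (q ^ 2) k * qpoch (q ^ 2) (q ^ 2) k)"
    unfolding even_odd[symmetric] using nz by simp
  also have "\<dots> = qpoch q q (k + k) / (qpoch q q k * qpoch q q k) / (\<Prod>i<k. 1 + q ^ Suc i) ^ 2"
    unfolding square mult_2 by (simp add: power2_eq_square mult_ac)
  also have "\<dots> \<in> R"
    using U q_not_root U_R[OF q_unit]
    by (intro divide_R power_U qpoch_ratio_in_subring) (auto intro: R_intros)
  finally show ?thesis .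
qed

lemma u_R_all: "u k \<in> R"
  unfolding u_split by (intro mult_R power_R prod_r_1_R prod_r_R divide_R) (auto intro!: R_intros)

lemma V_R_all: "V 1 1 1 k \<in> R"
proof -
  have "V 1 1 1 k = (\<Prod>i<k. r 1 i) ^ 2 * (\<Prod>i<k. (1 - z1 i) * (1 - q / (c * d) * (q ^ 2) ^ i)
      / ((1 - z2 i / c) * (1 - z2 i / d)) * q ^ 2)"
    unfolding V_def r_def prod_power_distrib prod.distrib[symmetric]
    by (intro prod.cong refl) (simp add: power2_eq_square mult_ac)
  moreover have "\<dots> \<in> R"
    using z2_c_unit z2_d_unit U_R[OF z1_U]
    by (intro mult_R power_R prod_r_1_R prod_R divide_R) (auto intro!: R_intros)
  ultimately show ?thesis by simp
qed

text \<open>A proper divisor of the theorem's \<open>n\<close> now plays the role of the locale parameter \<open>n\<close>: modulo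
  \<open>1 - q\<^sup>n\<close> the sum splits into blocks of length \<open>n\<close>, each a multiple of the first one.\<close>

lemma z_block: "cg 1 (z1 (n * t + s)) (z1 s)" "cg 1 (z2 (n * t + s)) (z2 s)"
proof -
  have "z1 (n * t + s) = q ^ (n * (2 * t)) * z1 s" "z2 (n * t + s) = q ^ (n * (2 * t)) * z2 s"
    unfolding z1_def z2_def power_add[symmetric] by (simp_all add: algebra_simps)
  then show "cg 1 (z1 (n * t + s)) (z1 s)" "cg 1 (z2 (n * t + s)) (z2 s)"
    using cg_rmult[OF U_R[OF z1_U] cg_qn_power[of "2 * t"]] cg_rmult[OF U_R[OF z2_U] cg_qn_power[of "2 * t"]]
    by simp_all
qed

lemma r_block:
  assumes "x \<in> U" "1 - z2 (n * t + s) / x \<in> U" "1 - z2 s / x \<in> U"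
  shows "cg 1 (r x (n * t + s)) (r x s)"
  unfolding r_def using assms U_R[OF z1_U] U_R[OF assms(1)]
  by (intro cg_divide2 cg_diff cg_refl cg_lmult cg_divide z_block diff_R one_R mult_R) auto

lemma \<rho>_block:
  assumes "Suc s < n"
  shows "cg 1 (\<rho> (n * t + s)) (\<rho> s)"
proof -
  have nd: "\<not> n dvd Suc s" using assms by (intro not_dvd_between) auto
  then have nd': "\<not> n dvd Suc (n * t + s)"
    by (metis add_Suc_right dvd_add_right_iff dvd_triv_left)
  have \<rho>: "\<rho> i = r 1 i ^ 4 * (r c i * r d i) * (q / (c * d))" for i
    by (simp add: \<rho>_def mult_ac)
  show ?thesis unfolding \<rho>
    using z2_unit_gen[OF nd] z2_unit_gen[OF nd'] z2_c_unit z2_d_unit r_1_R[OF nd'] r_c_R r_d_R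
    by (intro cg_combine r_block one_U c_unit d_unit) (auto intro!: R_intros)
qed

text \<open>Inside a block only ratios with unit denominators are compared. The ratio closing a
  block has a denominator divisible by \<psi>; it stays inside \<open>u (n * t)\<close>, which is
  integral by \<open>u_R_all\<close>.\<close>

lemma u_block: "s < n \<Longrightarrow> cg 1 (u (n * t + s)) (u (n * t) * u s)"
proof (induction s)
  case 0
  show ?case by (simp add: u_def)
next
  case (Suc s)
  have "\<rho> s \<in> R" using Suc.prems by (intro \<rho>_R not_dvd_between) auto
  then have "cg 1 (u (n * t + s) * \<rho> (n * t + s)) (u (n * t) * u s * \<rho> s)"
    using Suc by (intro cg_mult u_R_all \<rho>_block) auto
  then show ?case by (simp add: u_def mult_ac)
qed

lemma T_block: "s < n \<Longrightarrow> cg 1 (T 1 1 1 (n * t + s)) (u (n * t) * T 1 1 1 s)"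
proof -
  assume s: "s < n"
  have "qnum q (4 * (n * t + s) + 1) = (1 - q ^ (n * (4 * t)) * q ^ (4 * s + 1)) / (1 - q)"
    unfolding qnum_def power_add[symmetric] by (simp add: algebra_simps)
  also have "cg 1 \<dots> ((1 - 1 * q ^ (4 * s + 1)) / (1 - q))"
    by (intro cg_divide cg_diff cg_refl cg_rmult cg_qn_power one_minus_q_U power_R U_R[OF q_unit])
  also have "\<dots> = qnum q (4 * s + 1)" by (simp add: qnum_def)
  finally have "cg 1 (T 1 1 1 (n * t + s)) (qnum q (4 * s + 1) * (u (n * t) * u s))"
    unfolding T_111 by (intro cg_mult qnum_R mult_R u_R_all u_block s)
  then show ?thesis by (simp add: T_111 mult_ac)
qed

lemma T_sum_block:
  "m \<le> n \<Longrightarrow> cg 1 (\<Sum>s<m. T 1 1 1 (n * t + s)) (u (n * t) * (\<Sum>s<m. T 1 1 1 s))"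
  unfolding sum_distrib_left by (intro cg_sum T_block) auto

lemma T_sum_half_cg_0: "cg 1 (\<Sum>k\<le>N. T 1 1 1 k) 0"
  by (intro antisymmetric_sum T_refl)

lemma T_sum_blocks_cg_0: "cg 1 (\<Sum>k<n * t. T 1 1 1 k) 0"
proof (induction t)
  case (Suc t)
  have "cg 1 (\<Sum>k<n. T 1 1 1 k) 0"
    using cg_le[OF T_sum_full, of 1] by (rule cg_trans[OF _ T_sum_half_cg_0]) simp
  then have "cg 1 (u (n * t) * (\<Sum>k<n. T 1 1 1 k)) 0" by (intro cg_lmult_0 u_R_all)
  with T_sum_block[of n t] have "cg 1 (\<Sum>s<n. T 1 1 1 (n * t + s)) 0" by (blast intro: cg_trans)
  from cg_add[OF Suc.IH this] show ?case
  proof -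
    have "{..<n * Suc t} = {..<n * t + n}" by (simp add: add.commute)
    then show ?thesis using \<open>cg 1 (_ + _) (0 + 0)\<close> by (simp only: sum_lessThan_add add_0_right)
  qed
qed simp

lemma T_sum_blocks_half_cg_0: "cg 1 (\<Sum>k\<le>n * t + N. T 1 1 1 k) 0"
proof -
  have "cg 1 (u (n * t) * (\<Sum>k<Suc N. T 1 1 1 k)) 0"
    unfolding lessThan_Suc_atMost by (intro cg_lmult_0 u_R_all T_sum_half_cg_0)
  with T_sum_block[of "Suc N" t] have "cg 1 (\<Sum>s<Suc N. T 1 1 1 (n * t + s)) 0"
    using n_eq by (auto intro: cg_trans)
  from cg_add[OF T_sum_blocks_cg_0[of t] this] show ?thesis
  proof -
    have "{..n * t + N} = {..<n * t + Suc N}" by (simp add: lessThan_Suc_atMost)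
    then show ?thesis using \<open>cg 1 (_ + _) (0 + 0)\<close> by (simp only: sum_lessThan_add add_0_right)
  qed
qed

section \<open>Both sides of the theorem in the localization\<close>

lemma lhs_eq: "supercong_lhs q c d M = (\<Sum>k\<le>M. T 1 1 1 k)"
  unfolding supercong_lhs_def T_conv atMost_atLeast0
  by (intro sum.cong refl) (simp add: eval_nat_numeral mult_ac)

lemma rhs_sum_eq: "(\<Sum>k=0..M.
          (qpoch q (q^2) k ^ 3 * qpoch (q / (c * d)) (q^2) k)
          / (qpoch (q^2) (q^2) k ^ 2 * qpoch (q^2 / c) (q^2) k * qpoch (q^2 / d) (q^2) k)
          * q ^ (2 * k)) = (\<Sum>k\<le>M. V 1 1 1 k)"
  unfolding V_conv atMost_atLeast0
  by (intro sum.cong refl) (simp add: eval_nat_numeral mult_ac)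

lemma powi_eq: "odd m \<Longrightarrow> q powi ((1 - int m) div 2) = 1 / q ^ ((m - 1) div 2)"
proof -
  assume "odd m"
  then obtain k where m: "m = 2 * k + 1" by (elim oddE)
  then have "(1 - int m) div 2 = - int k" by simp
  then show ?thesis using m by (simp add: power_int_minus field_simps)
qed

lemma supercongruence_at_n:
  assumes "M = (n - 1) div 2 \<or> M = n - 1"
  shows "cg 4 (supercong_lhs q c d M) (supercong_rhs q c d n)"
proof -
  have rhs: "supercong_rhs q c d n = qnum q n * \<kappa> * (1 + \<psi> ^ 2 * \<epsilon>) * G 1 1 1"
  proof -
    \<comment> \<open>This turns \<open>[n]^3 (1 - q)^2 (n^2 - 1) / 24\<close> into
      \<open>[n]\<close> times \<open>\<psi> ^ 2 * \<epsilon>\<close>.\<close>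
    have L: "\<psi> = qnum q n * (1 - q)" using q_not_root[of 0] by (simp add: qnum_def \<psi>_def)
    have "(l * k + l ^ 3 * k * (E * x ^ 2 / 24)) * S = l * k * (1 + (l * x) ^ 2 * (E / 24)) * S"
      for l k E x S :: 'a
      by (simp add: algebra_simps power2_eq_square power3_eq_cube)
    then show ?thesis
      unfolding supercong_rhs_def rhs_sum_eq powi_eq[OF n_odd] N_def[symmetric] L \<epsilon>_def .
  qed
  have "cg 4 (\<Sum>k\<le>M. T 1 1 1 k) (\<Sum>k\<le>N. T 1 1 1 k)"
  proof (cases "M = N")
    case False
    then have "{..M} = {..<n}" using assms n_gt_1 by (auto simp: N_def)
    then show ?thesis using T_sum_full by simp
  qed simp
  then show ?thesis unfolding lhs_eq rhs using main_congruence by (rule cg_trans)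
qed

text \<open>To first order both sides vanish: the left one blockwise, the right one through
  \<open>[m]\<close>, whose cofactor lies in \<open>R\<close> by \<open>V_R_all\<close>.\<close>

lemma supercongruence_at_divisor:
  assumes "m = n * t" "odd m" "M = (m - 1) div 2 \<or> M = m - 1"
  shows "cg 1 (supercong_lhs q c d M) (supercong_rhs q c d m)"
proof -
  have "t \<noteq> 0" using assms(2) unfolding assms(1) by (cases t) auto
  have "cg 1 (\<Sum>k\<le>M. T 1 1 1 k) 0"
  proof (cases "M = m - 1")
    case True
    then have "{..M} = {..<n * t}" using assms(1) \<open>t \<noteq> 0\<close> n_gt_1 by (cases "n * t") auto
    then show ?thesis using T_sum_blocks_cg_0[of t] by simp
  next
    case False
    have "odd t" using assms(1,2) by simp
    then obtain s where "t = 2 * s + 1" by (elim oddE)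
    \<comment> \<open>Half of the range consists of \<open>s\<close> full blocks followed by half a
      block.\<close>
    moreover have "n * (2 * s + 1) = 2 * (n * s + N) + 1"
      using n_eq by (simp add: distrib_left)
    ultimately have "M = n * s + N" using False assms(1,3) by simp
    then show ?thesis using T_sum_blocks_half_cg_0[of s] by simp
  qed
  moreover have "cg 1 (supercong_rhs q c d m) 0"
  proof -
    have "supercong_rhs q c d m = qnum q m * ((1 / q ^ ((m - 1) div 2)
        + qnum q m ^ 2 * (1 / q ^ ((m - 1) div 2)) * (((of_nat m)^2 - 1) * (1 - q)^2 / 24))
        * (\<Sum>k\<le>(m - 1) div 2. V 1 1 1 k))"
    proof -
      have "(l * k + l ^ 3 * k * E) * S = l * ((k + l ^ 2 * k * E) * S)" for l k E S :: 'a
        by (simp add: algebra_simps power2_eq_square power3_eq_cube)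
      then show ?thesis unfolding supercong_rhs_def rhs_sum_eq powi_eq[OF assms(2)] .
    qed
    also have "cg 1 \<dots> 0"
      unfolding assms(1) using V_R_all qnum_R
      by (intro cg_rmult_0 qnum_cg mult_R sum_R add_R divide_R) (auto intro!: R_intros)
    finally show ?thesis .
  qed
  ultimately show ?thesis unfolding lhs_eq using cg_sym cg_trans by blast
qed

end

section \<open>Localization at a cyclotomic polynomial\<close>

text \<open>Coprimality in Bezout form: it passes to congruent elements, products and divisors by
  manipulating the one identity.\<close>

definition comaximal :: "'a::comm_ring_1 \<Rightarrow> 'a \<Rightarrow> bool" where
  "comaximal a b \<longleftrightarrow> (\<exists>u w. a * u + b * w = 1)"

lemma comaximal_sym: "comaximal a b \<Longrightarrow> comaximal b a"
  unfolding comaximal_def by (metis add.commute)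

lemma comaximal_1: "comaximal 1 b"
  unfolding comaximal_def by (intro exI[of _ 1] exI[of _ 0]) simp

lemma comaximal_cong:
  assumes "comaximal a b" "b dvd a - a'"
  shows "comaximal a' b"
proof -
  obtain u w where 1: "a * u + b * w = 1" using assms(1) by (auto simp: comaximal_def)
  obtain k where "a - a' = b * k" using assms(2) by (auto elim: dvdE)
  then have "a = a' + b * k" by (simp add: algebra_simps)
  then have "a' * u + b * (k * u + w) = 1" using 1 by (simp add: algebra_simps)
  then show ?thesis unfolding comaximal_def by blast
qed

lemma comaximal_mult:
  assumes "comaximal a b" "comaximal a' b"
  shows "comaximal (a * a') b"
proof -
  obtain u w where 1: "a * u + b * w = 1" using assms(1) by (auto simp: comaximal_def)
  obtain u' w' where 2: "a' * u' + b * w' = 1" using assms(2) by (auto simp: comaximal_def)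
  have "(a * u + b * w) * (a' * u' + b * w') = 1" unfolding 1 2 by simp
  then have "(a * a') * (u * u') + b * (w * (a' * u' + b * w') + a * u * w') = 1"
    by (simp add: algebra_simps)
  then show ?thesis unfolding comaximal_def by blast
qed

lemma comaximal_dvd: "comaximal a b \<Longrightarrow> a' dvd a \<Longrightarrow> comaximal a' b"
  unfolding comaximal_def by (metis dvdE mult.assoc)

lemma comaximal_power: "comaximal a b \<Longrightarrow> comaximal (a ^ k) b"
  by (induction k) (auto intro: comaximal_1 comaximal_mult)

lemma comaximal_prod:
  "(\<And>i. i \<in> A \<Longrightarrow> comaximal (f i) b) \<Longrightarrow> comaximal (prod f A) b"
  by (induction A rule: infinite_finite_induct) (auto intro: comaximal_1 comaximal_mult)

lemma comaximal_dvd_mult: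
  assumes "comaximal a b" "b dvd c * a"
  shows "b dvd c"
proof -
  obtain u w where 1: "a * u + b * w = 1" using assms(1) by (auto simp: comaximal_def)
  have "c = c * (a * u + b * w)" unfolding 1 by simp
  also have "\<dots> = (c * a) * u + b * (c * w)" by (simp add: algebra_simps)
  finally show ?thesis using assms(2) by (metis dvd_add dvd_mult2 dvd_triv_left)
qed

lemma comaximal_power_dvd_mult:
  fixes a b c :: "'a::idom"
  assumes "comaximal a b" "b ^ e dvd c * a"
  shows "b ^ e dvd c"
  using comaximal_dvd_mult[OF comaximal_sym[OF comaximal_power[OF comaximal_sym[OF assms(1)]]] assms(2)] .

text \<open>The next factor is comaximal to the product already split off, so it divides the
  cofactor.\<close>

lemma comaximal_prod_dvd:
  fixes f :: "'i \<Rightarrow> 'a::idom"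
  assumes "finite S" "P dvd a" "\<And>i. i \<in> S \<Longrightarrow> f i dvd a" "\<And>i. i \<in> S \<Longrightarrow> comaximal P (f i)"
    "\<And>i j. i \<in> S \<Longrightarrow> j \<in> S \<Longrightarrow> i \<noteq> j \<Longrightarrow> comaximal (f i) (f j)"
  shows "P * prod f S dvd a"
  using assms
proof (induction S rule: finite_induct)
  case (insert i S)
  then have "P * prod f S dvd a" by blast
  then obtain a' where a': "a = P * prod f S * a'" by (elim dvdE)
  have "comaximal (P * prod f S) (f i)"
    using insert.prems insert.hyps by (intro comaximal_mult comaximal_prod) auto
  moreover have "f i dvd a' * (P * prod f S)" using insert.prems(2)[of i] a' by (simp add: mult.commute)
  ultimately have "f i dvd a'" by (rule comaximal_dvd_mult)
  then show ?case using insert.hyps unfolding a' by (simp add: mult_dvd_mono mult_ac)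
qed simp

section \<open>Cyclotomic polynomials over a field of characteristic zero\<close>

abbreviation (input) cyc :: "nat \<Rightarrow> 'k::field_char_0 poly" where
  "cyc m \<equiv> map_poly of_int (cyclotomic_poly m)"

abbreviation (input) var :: "'k::field_char_0 poly" where
  "var \<equiv> [:0, 1:]"

text \<open>The factorization over the complex numbers descends to the integers by injectivity of
  the coefficient map and from there maps into the given field.\<close>

lemma prod_cyc:
  assumes "m > 0"
  shows "(\<Prod>d | d dvd m. cyc d) = (var ^ m - 1 :: 'k::field_char_0 poly)"
proof -
  have mult: "map_poly of_int (p * q) = (map_poly of_int p * map_poly of_int q :: 'k poly)" for p q :: "int poly"
    by (intro poly_eqI) (simp add: coeff_map_poly coeff_mult)
  have prod: "map_poly of_int (\<Prod>i\<in>A. p i) = (\<Prod>i\<in>A. map_poly of_int (p i) :: 'k poly)"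
    for p :: "nat \<Rightarrow> int poly" and A
    by (induction A rule: infinite_finite_induct) (simp_all add: mult)
  have "map_poly of_int (\<Prod>d | d dvd m. cyclotomic_poly d) = (\<Prod>d | d dvd m. cyclotomic_complex d)"
    unfolding of_int_poly_prod using assms
    by (intro prod.cong refl of_int_cyclotomic_poly) (auto intro: dvd_pos_nat)
  also have "\<dots> = map_poly of_int (monom 1 m - 1)"
    unfolding prod_cyclotomic_complex[OF assms] by (intro poly_eqI) (simp add: coeff_map_poly)
  finally have "(\<Prod>d | d dvd m. cyclotomic_poly d) = monom 1 m - 1" by (rule of_int_poly_inj)
  then have "(\<Prod>d | d dvd m. cyc d) = (map_poly of_int (monom 1 m - 1) :: 'k poly)"
    by (simp only: prod[symmetric])
  also have "\<dots> = monom 1 m - 1" by (intro poly_eqI) (simp add: coeff_map_poly)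
  finally show ?thesis by (simp add: monom_altdef)
qed

lemma degree_cyc:
  assumes "m > 0"
  shows "degree (cyc m :: 'k::field_char_0 poly) > 0"
proof -
  have "degree (cyc m :: 'k poly) = degree (cyclotomic_poly m)" by (rule degree_map_poly) simp
  also have "\<dots> = degree (cyclotomic_complex m)"
    using degree_of_int_poly[of "cyclotomic_poly m"] of_int_cyclotomic_poly[OF assms] by simp
  also have "\<dots> = card (totatives m)"
    unfolding cyclotomic_complex_def by (subst degree_prod_eq_sum_degree) auto
  also have "\<dots> > 0" using assms by (simp add: totient_def[symmetric])
  finally show ?thesis .
qed

lemma cyc_dvd: "m > 0 \<Longrightarrow> cyc m dvd (1 - var ^ m :: 'k::field_char_0 poly)"
proof -
  assume m: "m > 0"
  have "(cyc m :: 'k poly) dvd (\<Prod>d | d dvd m. cyc d)" using m by (intro dvd_prodI) auto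
  then show ?thesis unfolding prod_cyc[OF m] by (metis dvd_minus_iff minus_diff_eq)
qed

lemma comaximal_const: "a \<noteq> 0 \<Longrightarrow> comaximal [:a:] (p :: 'k::field poly)"
  unfolding comaximal_def by (intro exI[of _ "[:1 / a:]"] exI[of _ 0]) simp

lemma comaximal_cyc_nonzero:
  "m > 0 \<Longrightarrow> comaximal p (cyc m :: 'k::field_char_0 poly) \<Longrightarrow> p \<noteq> 0"
proof
  assume m: "m > 0" and "comaximal p (cyc m)" "p = 0"
  then have "(cyc m :: 'k poly) dvd 1" by (auto simp: comaximal_def intro: dvdI[OF sym])
  then show False using degree_cyc[OF m, where 'k = 'k] by (auto simp: is_unit_poly_iff)
qed

lemma var_power_cong: "m > 0 \<Longrightarrow> cyc m dvd (1 - var ^ (m * k) :: 'k::field_char_0 poly)"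
proof -
  assume m: "m > 0"
  have "(1 - var ^ m :: 'k poly) dvd 1 - (var ^ m) ^ k"
    by (simp add: one_diff_power_eq)
  from dvd_trans[OF cyc_dvd[OF m] this] show ?thesis by (simp only: power_mult)
qed

text \<open>Let \<open>g = gcd m j\<close>, which is less than \<open>m\<close>. Then
  \<open>cyc m\<close> divides \<open>(x^m - 1) / (x^g - 1)\<close>, and this geometric sum is the
  nonzero constant \<open>m / g\<close> modulo \<open>1 - x^g\<close>; so \<open>1 - x^g\<close> is
  comaximal to \<open>cyc m\<close>. Modulo \<open>cyc m\<close> it is also a multiple of
  \<open>1 - x^j\<close>.\<close>

lemma comaximal_one_minus_power:
  assumes m: "m > 0" and j: "\<not> m dvd j"
  shows "comaximal (1 - var ^ j) (cyc m :: 'k::field_char_0 poly)"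
proof -
  let ?x = "var :: 'k poly"
  define g where "g = gcd m j"
  have g: "g dvd m" "g > 0" using m by (auto simp: g_def)
  have "g \<noteq> m" using j gcd_dvd2[of m j] unfolding g_def by metis
  obtain k where k: "m = g * k" using g by (elim dvdE)
  have sub: "{d. d dvd g} \<subseteq> {d. d dvd m} - {m}"
    using g \<open>g \<noteq> m\<close> m by (auto dest: dvd_imp_le nat_dvd_not_less intro: dvd_trans)
  define r where "r = (\<Prod>d\<in>{d. d dvd m} - {m} - {d. d dvd g}. cyc d :: 'k poly)"
  have "?x ^ m - 1 = cyc m * (\<Prod>d\<in>{d. d dvd m} - {m}. cyc d)"
    unfolding prod_cyc[OF m, symmetric] using m by (intro prod.remove) auto
  also have "(\<Prod>d\<in>{d. d dvd m} - {m}. cyc d :: 'k poly) = r * (?x ^ g - 1)"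
    unfolding r_def prod_cyc[OF g(2), symmetric] using m sub by (intro prod.subset_diff) auto
  finally have 1: "(?x ^ g - 1) * (cyc m * r) = ?x ^ m - 1" by (simp add: mult_ac)
  have "(?x ^ g - 1) * (\<Sum>i<k. (?x ^ g) ^ i) = ?x ^ m - 1"
    unfolding k power_mult by (rule power_diff_1_eq[symmetric])
  with 1 have "(?x ^ g - 1) * (cyc m * r) = (?x ^ g - 1) * (\<Sum>i<k. (?x ^ g) ^ i)" by simp
  moreover have "?x ^ g - 1 \<noteq> 0"
  proof
    assume "?x ^ g - 1 = 0"
    then have "degree (?x ^ g) = 0" by simp
    then show False using g(2) by (simp add: degree_power_eq)
  qed
  ultimately have h: "cyc m * r = (\<Sum>i<k. (?x ^ g) ^ i)" by simp
  have "(1 - ?x ^ g) dvd (\<Sum>i<k. 1 - (?x ^ g) ^ i)"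
    by (intro dvd_sum) (simp add: one_diff_power_eq)
  then obtain e where e: "of_nat k - cyc m * r = (1 - ?x ^ g) * e"
    unfolding h by (auto elim!: dvdE simp: sum_subtractf)
  have k0: "k > 0" using k m by (cases k) auto
  have "comaximal (of_nat k) (cyc m :: 'k poly)"
    using comaximal_const[of "of_nat k :: 'k" "cyc m"] k0 by (simp add: of_nat_poly)
  then have "comaximal (of_nat k - cyc m * r) (cyc m)" by (rule comaximal_cong) simp
  then have cg: "comaximal (1 - ?x ^ g) (cyc m)" unfolding e by (rule comaximal_dvd) simp
  \<comment> \<open>Since \<open>x^(m s)\<close> is 1 modulo \<open>cyc m\<close>, this form of
    Bezout's identity makes \<open>1 - x^g\<close> congruent to
    \<open>- x^g (1 - x^(j t))\<close>.\<close>
  obtain s t where st: "m * s = j * t + g" using bezout_nat[of m j] m unfolding g_def by auto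
  have "(1 - ?x ^ g) - (1 - ?x ^ (j * t)) * (- (?x ^ g)) = 1 - ?x ^ (m * s)"
    unfolding st power_add by (simp add: algebra_simps)
  then have "cyc m dvd (1 - ?x ^ g) - (1 - ?x ^ (j * t)) * (- (?x ^ g))"
    by (simp only: var_power_cong[OF m])
  then have "comaximal ((1 - ?x ^ (j * t)) * (- (?x ^ g))) (cyc m)" by (rule comaximal_cong[OF cg])
  moreover have "(1 - ?x ^ j) dvd (1 - ?x ^ (j * t)) * (- (?x ^ g))"
    unfolding power_mult by (intro dvd_mult2) (simp add: one_diff_power_eq)
  ultimately show ?thesis by (rule comaximal_dvd)
qed

lemma comaximal_cyc:
  assumes "i > 0" "j > 0" "i \<noteq> j"
  shows "comaximal (cyc i) (cyc j :: 'k::field_char_0 poly)"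
proof -
  have *: "comaximal (cyc i) (cyc j :: 'k poly)" if "\<not> j dvd i" "i > 0" "j > 0" for i j
    using comaximal_dvd[OF comaximal_one_minus_power cyc_dvd] that by blast
  have "\<not> j dvd i \<or> \<not> i dvd j" using assms(3) dvd_antisym by blast
  then show ?thesis using * comaximal_sym assms by blast
qed

text \<open>\<open>a - x^j\<close> divides \<open>a^m - x^(j m)\<close>, which modulo
  \<open>cyc m\<close> is the nonzero constant \<open>a^m - 1\<close>.\<close>

lemma comaximal_const_minus_power:
  assumes m: "m > 0" and a: "a ^ m \<noteq> 1"
  shows "comaximal ([:a:] - var ^ j) (cyc m :: 'k::field_char_0 poly)"
proof -
  have "comaximal [:a ^ m - 1:] (cyc m :: 'k poly)" using a by (intro comaximal_const) simp
  moreover have "cyc m dvd ([:a ^ m - 1:] - ([:a:] ^ m - (var ^ j) ^ m) :: 'k poly)"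
  proof -
    have "[:a ^ m - 1:] - ([:a:] ^ m - (var ^ j) ^ m) = - (1 - var ^ (m * j))"
      by (simp add: poly_const_pow power_mult[symmetric] mult.commute one_pCons)
    then show ?thesis using var_power_cong[OF m, of j, where 'k = 'k] by (metis dvd_minus_iff)
  qed
  ultimately have "comaximal ([:a:] ^ m - (var ^ j) ^ m) (cyc m :: 'k poly)" by (rule comaximal_cong)
  moreover have "[:a:] - var ^ j dvd ([:a:] ^ m - (var ^ j) ^ m :: 'k poly)"
    by (simp add: power_diff_sumr2)
  ultimately show ?thesis by (rule comaximal_dvd)
qed

text \<open>For odd \<open>m\<close>, \<open>1 + x^j\<close> divides \<open>1 + x^(j m)\<close>,
  which is 2 modulo \<open>cyc m\<close>.\<close>

lemma comaximal_one_plus_power: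
  assumes m: "m > 0" "odd m"
  shows "comaximal (1 + var ^ j) (cyc m :: 'k::field_char_0 poly)"
proof -
  have "comaximal [:2:] (cyc m :: 'k poly)" by (intro comaximal_const) simp
  moreover have "cyc m dvd ([:2:] - (1 - (- (var ^ j)) ^ m) :: 'k poly)"
  proof -
    have "[:2:] - (1 - (- (var ^ j)) ^ m) = (1 - var ^ (m * j) :: 'k poly)"
      using m(2) by (simp add: power_mult[symmetric] mult.commute numeral_poly)
    then show ?thesis using var_power_cong[OF m(1), of j, where 'k = 'k] by metis
  qed
  ultimately have "comaximal (1 - (- (var ^ j)) ^ m) (cyc m :: 'k poly)" by (rule comaximal_cong)
  moreover have "1 - (- (var ^ j)) dvd (1 - (- (var ^ j)) ^ m :: 'k poly)"
    by (simp add: one_diff_power_eq del: minus_minus diff_minus_eq_add)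
  then have "1 + var ^ j dvd (1 - (- (var ^ j)) ^ m :: 'k poly)" by simp
  ultimately show ?thesis by (rule comaximal_dvd)
qed

lemma comaximal_var:
  assumes m: "m > 0"
  shows "comaximal var (cyc m :: 'k::field_char_0 poly)"
proof -
  have "comaximal (var ^ m) (cyc m :: 'k poly)"
    by (rule comaximal_cong[OF comaximal_1 cyc_dvd[OF m]])
  then show ?thesis by (rule comaximal_dvd) (use m in \<open>simp add: dvd_power\<close>)
qed

lemma qnum_var:
  assumes "n > 0"
  shows "qnum var n = (\<Prod>d\<in>{d. d dvd n} - {1}. cyc d :: 'k::field_char_0 poly)"
proof -
  let ?x = "var :: 'k poly"
  have x1: "?x - 1 \<noteq> 0" by (simp add: one_pCons)
  have "(\<Prod>d | d dvd n. cyc d :: 'k poly) = cyc 1 * (\<Prod>d\<in>{d. d dvd n} - {1}. cyc d)"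
    using assms by (intro prod.remove) auto
  moreover have "cyc 1 = ?x - 1" using prod_cyc[of 1, where 'k = 'k] by simp
  ultimately have "(?x - 1) * (\<Prod>d\<in>{d. d dvd n} - {1}. cyc d) = ?x ^ n - 1"
    using prod_cyc[OF assms, where 'k = 'k] by simp
  also have "\<dots> = (?x - 1) * (\<Sum>i<n. ?x ^ i)" by (rule power_diff_1_eq)
  finally have "(\<Prod>d\<in>{d. d dvd n} - {1}. cyc d) = (\<Sum>i<n. ?x ^ i)" using x1 by simp
  moreover have "?x \<noteq> 1" using x1 by simp
  ultimately show ?thesis by (simp add: qnum_eq_sum)
qed

text \<open>With comaximality as the condition on denominators, closure is
  \<open>comaximal_mult\<close>. The fraction field inherits the order of the coefficient field and
  hence has characteristic zero, as \<open>local_subring\<close> demands.\<close>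

definition local_ring :: "nat \<Rightarrow> 'k::linordered_field poly fract set" where
  "local_ring m = {to_fract a / to_fract b | a b. comaximal b (cyc m)}"

lemma to_fract_power: "to_fract (x ^ k) = to_fract x ^ k"
  by (induction k) simp_all

lemma local_ringI: "comaximal b (cyc m) \<Longrightarrow> to_fract a / to_fract b \<in> local_ring m"
  unfolding local_ring_def by blast

lemma to_fract_unit:
  assumes "m > 0" "comaximal p (cyc m)"
  shows "to_fract p \<in> units_in (local_ring m)"
  using local_ringI[OF comaximal_1, of p m] local_ringI[OF assms(2), of 1] comaximal_cyc_nonzero[OF assms]
  by (simp add: units_in_def inverse_eq_divide)

text \<open>The indeterminates enter only as nonzero constants that are not roots of unity;
  \<open>comaximal_const_minus_power\<close> then makes every \<open>1 - q^j / c0\<close> a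
  unit.\<close>

lemma local_subring_local_ring:
  fixes c0 d0 :: "'k::linordered_field"
  assumes m: "m > 1" "odd m"
    and c0: "c0 \<noteq> 0" "\<And>k. k > 0 \<Longrightarrow> c0 ^ k \<noteq> 1" and d0: "d0 \<noteq> 0" "\<And>k. k > 0 \<Longrightarrow> d0 ^ k \<noteq> 1"
  shows "local_subring (local_ring m) (to_fract var) (to_fract [:c0:]) (to_fract [:d0:]) m"
proof
  let ?R = "local_ring m :: 'k poly fract set"
  have m0: "m > 0" using m by simp
  have const: "to_fract [:a:] \<in> units_in ?R" if "a \<noteq> 0" for a :: 'k
    by (intro to_fract_unit m0 comaximal_const that)
  have minus: "1 - to_fract var ^ j / to_fract [:a:] \<in> units_in ?R"
    if a: "a \<noteq> 0" "\<And>k. k > 0 \<Longrightarrow> a ^ k \<noteq> 1" for a :: 'k and j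
  proof -
    have "comaximal ([:1 / a:] * ([:a:] - var ^ j)) (cyc m)"
      using a m0 by (intro comaximal_mult comaximal_const comaximal_const_minus_power) auto
    then have "to_fract ([:1 / a:] * ([:a:] - var ^ j)) \<in> units_in ?R"
      by (intro to_fract_unit m0)
    moreover have "to_fract [:1 / a:] * to_fract [:a:] = 1"
    proof -
      have "[:1 / a:] * [:a:] = 1" using a(1) by simp
      then show ?thesis by (simp only: to_fract_mult[symmetric] to_fract_1)
    qed
    then have "to_fract [:1 / a:] = 1 / to_fract [:a:]" using a(1) by (simp add: eq_divide_eq)
    then have "to_fract ([:1 / a:] * ([:a:] - var ^ j)) = 1 - to_fract var ^ j / to_fract [:a:]"
      unfolding to_fract_mult to_fract_diff to_fract_power using a(1) by (simp add: diff_divide_distrib)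
    ultimately show ?thesis by simp
  qed
  show "1 \<in> ?R" using local_ringI[OF comaximal_1, of 1 m] by simp
  show "to_fract var \<in> units_in ?R" by (intro to_fract_unit comaximal_var m0)
  show "to_fract [:c0:] \<in> units_in ?R" "to_fract [:d0:] \<in> units_in ?R"
    by (intro const c0 d0)+
  show "odd m" "1 < m" by fact+
  show "1 - to_fract var ^ j / to_fract [:c0:] \<in> units_in ?R"
    "1 - to_fract var ^ j / to_fract [:d0:] \<in> units_in ?R" for j
    by (intro minus c0 d0; assumption)+
  show "1 - to_fract var ^ j \<in> units_in ?R" if "\<not> m dvd j" for j
    using to_fract_unit[OF m0 comaximal_one_minus_power[OF m0 that]] by (simp add: to_fract_power)
  show "1 + to_fract var ^ j \<in> units_in ?R" for j
    using to_fract_unit[OF m0 comaximal_one_plus_power[OF m0 m(2)]] by (simp add: to_fract_power)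
  show "of_nat (Suc k) \<in> units_in ?R" for k
  proof -
    have "(of_nat (Suc k) :: 'k poly fract) = to_fract [:of_nat (Suc k) :: 'k:]"
      by (simp add: to_fract_def of_nat_fract of_nat_poly)
    then show ?thesis using const[of "of_nat (Suc k)"] by (simp del: of_nat_Suc)
  qed
  show "to_fract var ^ Suc i \<noteq> (1 :: 'k poly fract)" for i
  proof
    assume "to_fract var ^ Suc i = (1 :: 'k poly fract)"
    then have "to_fract (var ^ Suc i) = (to_fract 1 :: 'k poly fract)"
      by (simp only: to_fract_power to_fract_1)
    then have "degree (var ^ Suc i :: 'k poly) = 0" by (simp only: to_fract_eq_iff) simp
    then show False by (subst (asm) degree_power_eq) simp_all
  qed
  fix x y :: "'k poly fract"
  assume "x \<in> ?R" "y \<in> ?R"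
  then obtain a b a' b' where xy: "x = to_fract a / to_fract b" "y = to_fract a' / to_fract b'"
    and com: "comaximal b (cyc m)" "comaximal b' (cyc m)"
    unfolding local_ring_def by auto
  have nz: "b \<noteq> 0" "b' \<noteq> 0" using com comaximal_cyc_nonzero[OF m0] by auto
  show "x * y \<in> ?R"
    using local_ringI[OF comaximal_mult[OF com], of "a * a'"] by (simp add: xy)
  have "x - y = to_fract (a * b' - a' * b) / to_fract (b * b')"
    unfolding xy using nz by (simp add: field_simps)
  then show "x - y \<in> ?R" using local_ringI[OF comaximal_mult[OF com]] by (simp only:)
qed

text \<open>Clearing denominators gives \<open>a t = (1 - x^m)^e s b\<close>. Here \<open>t\<close>
  is comaximal to \<open>cyc m\<close> and can be cancelled from the divisibility.\<close>

lemma cyc_power_dvd_numerator: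
  fixes A B c d :: "'k::linordered_field poly fract"
  assumes loc: "local_subring (local_ring m) (to_fract var) c d m"
    and cong: "local_subring.cg (local_ring m) (to_fract var) m e A B"
    and AB: "A - B = Fract a b" "b \<noteq> 0"
  shows "cyc m ^ e dvd a"
proof -
  interpret local_subring "local_ring m :: 'k poly fract set" "to_fract var" c d m by (rule loc)
  have m0: "m > 0" using n_gt_1 by simp
  obtain z where z: "z \<in> local_ring m" "A - B = \<psi> ^ e * z" using cong unfolding cg_def by blast
  from z(1) obtain s t where st: "z = to_fract s / to_fract t" "comaximal t (cyc m)"
    unfolding local_ring_def by blast
  have "to_fract a / to_fract b = to_fract ((1 - var ^ m) ^ e) * (to_fract s / to_fract t)"
    using z(2) unfolding AB Fract_conv_to_fract \<psi>_def st by (simp add: to_fract_power)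
  then have "to_fract (a * t) = to_fract ((1 - var ^ m) ^ e * s * b)"
    using AB(2) comaximal_cyc_nonzero[OF m0 st(2)] by (simp add: field_simps)
  then have "a * t = (1 - var ^ m) ^ e * s * b" by (simp only: to_fract_eq_iff)
  moreover have "cyc m ^ e dvd (1 - var ^ m :: 'k poly) ^ e" by (intro dvd_power_same cyc_dvd m0)
  ultimately have "cyc m ^ e dvd a * t" by simp
  then show ?thesis by (rule comaximal_power_dvd_mult[OF st(2)])
qed

section \<open>Lowest terms and assembly over the divisors\<close>

lemma lowest_terms:
  fixes x :: "'k::field poly fract"
  shows "\<exists>a b. b \<noteq> 0 \<and> coprime a b \<and> x = Fract a b"
proof -
  define Q where "Q b \<longleftrightarrow> b \<noteq> 0 \<and> (\<exists>a. x = Fract a b)" for b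
  obtain b0 where "Q b0" unfolding Q_def by (cases x) auto
  \<comment> \<open>A denominator of least degree: a nonconstant common factor would yield a smaller
    one.\<close>
  then obtain b where b: "Q b" and min: "\<And>b'. Q b' \<Longrightarrow> degree b \<le> degree b'"
    using exists_least_lemma[of "\<lambda>k. \<exists>b. Q b \<and> degree b = k"]
    by (metis arg_min_nat_lemma)
  from b obtain a where a: "b \<noteq> 0" "x = Fract a b" by (auto simp: Q_def)
  have "coprime a b"
  proof (rule coprimeI)
    fix g assume "g dvd a" "g dvd b"
    then obtain a' b' where g: "a = g * a'" "b = g * b'" by (auto elim!: dvdE)
    then have nz: "g \<noteq> 0" "b' \<noteq> 0" using a(1) by auto
    have "x = Fract a' b'" unfolding a g using nz by (simp add: eq_fract mult_ac)
    then have "degree b \<le> degree b'" using nz by (intro min) (auto simp: Q_def)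
    moreover have "degree b = degree g + degree b'" unfolding g using nz by (rule degree_mult_eq)
    ultimately have "degree g = 0" by simp
    then show "is_unit g" using nz(1) by (simp add: is_unit_iff_degree)
  qed
  with a show ?thesis by blast
qed

theorem supercongruence:
  fixes c0 d0 :: "'k::linordered_field" and n M :: nat
  assumes "n > 0" "odd n" and M: "M = (n - 1) div 2 \<or> M = n - 1"
    and c0: "c0 \<noteq> 0" "\<And>k. k > 0 \<Longrightarrow> c0 ^ k \<noteq> 1" and d0: "d0 \<noteq> 0" "\<And>k. k > 0 \<Longrightarrow> d0 ^ k \<noteq> 1"
  shows "ratfun_cong
    (supercong_lhs (to_fract var) (to_fract [:c0:]) (to_fract [:d0:]) M)
    (supercong_rhs (to_fract var) (to_fract [:c0:]) (to_fract [:d0:]) n)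
    (qnum var n * cyc n ^ 3)" (is "ratfun_cong ?A ?B _")
\<comment> \<open>The localizations are set up for index greater than 1; for \<open>n = 1\<close>
  both sides are equal to 1.\<close>
proof (cases "n = 1")
  case True
  then have "M = 0" using M by auto
  have "to_fract var \<noteq> (1 :: 'k poly fract)"
  proof -
    have "to_fract var \<noteq> to_fract (1 :: 'k poly)"
      by (simp only: to_fract_eq_iff) (simp add: one_pCons)
    then show ?thesis by simp
  qed
  then have "?A - ?B = Fract 0 1"
    unfolding supercong_lhs_def supercong_rhs_def True \<open>M = 0\<close>
    by (simp add: qnum_def Zero_fract_def[symmetric])
  then show ?thesis unfolding ratfun_cong_def by (intro exI[of _ 0] exI[of _ 1]) simp
next
  case False
  then have n1: "n > 1" using assms(1) by simp
  obtain a b where ab: "b \<noteq> 0" "coprime a b" "?A - ?B = Fract a b"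
    using lowest_terms by blast
  have loc: "local_subring (local_ring m) (to_fract var) (to_fract [:c0:]) (to_fract [:d0:]) m"
    if "m > 1" "odd m" for m
    by (rule local_subring_local_ring[OF that c0 d0])
  have top: "cyc n ^ 4 dvd a"
    using cyc_power_dvd_numerator[OF loc local_subring.supercongruence_at_n ab(3,1)]
      loc n1 assms(2) M by blast
  have other: "cyc m dvd a" if m: "m dvd n" "m > 1" for m
  proof -
    have "odd m" using m(1) assms(2) by (elim dvdE) simp
    obtain t where t: "n = m * t" using m(1) by (elim dvdE)
    have "cyc m ^ 1 dvd a"
      using cyc_power_dvd_numerator[OF loc local_subring.supercongruence_at_divisor ab(3,1)]
        loc m(2) \<open>odd m\<close> t assms(2) M by blast
    then show ?thesis by simp
  qed
  let ?S = "{d. d dvd n} - {1} - {n}"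
  have S: "m dvd n" "m > 1" "m \<noteq> n" if "m \<in> ?S" for m
    using that assms(1) dvd_pos_nat[of n m] by auto
  have "cyc n ^ 4 * prod cyc ?S dvd a"
  proof (rule comaximal_prod_dvd)
    show "finite ?S" using assms(1) by simp
    show "comaximal (cyc n ^ 4) (cyc i :: 'k poly)" if "i \<in> ?S" for i
      using S[OF that] assms(1) by (intro comaximal_power comaximal_cyc) auto
    show "comaximal (cyc i) (cyc j :: 'k poly)" if "i \<in> ?S" "j \<in> ?S" "i \<noteq> j" for i j
      using S[OF that(1)] S[OF that(2)] that(3) by (intro comaximal_cyc) auto
    show "cyc n ^ 4 dvd a" by (rule top)
    show "cyc i dvd a" if "i \<in> ?S" for i by (rule other[OF S(1,2)[OF that]])
  qed
  \<comment> \<open>\<open>[n]\<close> contributes one further factor \<open>cyc n\<close> and one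
    factor for each divisor other than 1 and \<open>n\<close>.\<close>
  moreover have "qnum var n * cyc n ^ 3 = (cyc n ^ 4 * prod cyc ?S :: 'k poly)"
  proof -
    have "qnum var n = (cyc n * prod cyc ?S :: 'k poly)"
      unfolding qnum_var[OF assms(1)] using n1 by (intro prod.remove) auto
    then show ?thesis by (simp add: eval_nat_numeral mult_ac)
  qed
  ultimately show ?thesis unfolding ratfun_cong_def using ab by auto
qed

theorem theorem1p1:
  fixes n M :: nat
  assumes "n > 0" and "odd n" and "M = (n - 1) div 2 \<or> M = n - 1"
  shows "ratfun_cong
    (\<Sum>k=0..M. qnum ind_q (4 * k + 1)
        * (qpoch ind_q (ind_q^2) k ^ 4
            * qpoch (ind_c * ind_q) (ind_q^2) k * qpoch (ind_d * ind_q) (ind_q^2) k)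
        / (qpoch (ind_q^2) (ind_q^2) k ^ 4
            * qpoch (ind_q^2 / ind_c) (ind_q^2) k * qpoch (ind_q^2 / ind_d) (ind_q^2) k)
        * (ind_q / (ind_c * ind_d)) ^ k)
    ((qnum ind_q n * ind_q powi ((1 - int n) div 2)
        + qnum ind_q n ^ 3 * ind_q powi ((1 - int n) div 2)
            * (((of_nat n)^2 - 1) * (1 - ind_q)^2 / 24))
      * (\<Sum>k=0..(n - 1) div 2.
          (qpoch ind_q (ind_q^2) k ^ 3 * qpoch (ind_q / (ind_c * ind_d)) (ind_q^2) k)
          / (qpoch (ind_q^2) (ind_q^2) k ^ 2
              * qpoch (ind_q^2 / ind_c) (ind_q^2) k * qpoch (ind_q^2 / ind_d) (ind_q^2) k)
          * ind_q ^ (2 * k)))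
    (qnum [:0, 1:] n * map_poly of_int (cyclotomic_poly n) ^ 3)"
proof -
  have not_root: "to_fract p ^ k \<noteq> 1" if "degree p > 0" "k > 0" for p :: "'b::idom poly" and k
  proof
    assume "to_fract p ^ k = 1"
    then have "to_fract (p ^ k) = to_fract 1" by (simp add: to_fract_power)
    then have "degree (p ^ k) = 0" by (simp only: to_fract_eq_iff) simp
    moreover have "p \<noteq> 0" using that(1) by auto
    ultimately show False using that by (simp add: degree_power_eq)
  qed
  \<comment> \<open>As a polynomial in the outer variable, \<open>c\<close> is constant, so degrees
    are compared one level further down.\<close>
  have c: "to_fract [:[:0, 1:]:] ^ k \<noteq> (1 :: coeff_field)" if "k > 0" for k
  proof
    assume "to_fract [:[:0, 1:]:] ^ k = (1 :: coeff_field)"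
    then have "to_fract ([:[:0, 1:]:] ^ k) = (to_fract 1 :: coeff_field)"
      by (simp only: to_fract_power to_fract_1)
    then have "[:[:0, 1:] ^ k:] = [:1 :: rat poly:]"
      by (simp only: to_fract_eq_iff poly_const_pow one_pCons)
    then have "degree ([:0, 1 :: rat:] ^ k) = 0" by simp
    then show False using that by (simp add: degree_power_eq)
  qed
  have "ratfun_cong
    (supercong_lhs (to_fract [:0, 1:]) (to_fract [:to_fract [:[:0, 1:]:]:]) (to_fract [:to_fract [:0, 1:]:]) M)
    (supercong_rhs (to_fract [:0, 1:]) (to_fract [:to_fract [:[:0, 1:]:]:]) (to_fract [:to_fract [:0, 1:]:]) n)
    (qnum [:0, 1:] n * map_poly of_int (cyclotomic_poly n) ^ 3 :: q_poly)"
    by (rule supercongruence[OF assms]) (use c not_root[of "[:0, 1:]"] in simp_all)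
  then show ?thesis
    unfolding supercong_lhs_def supercong_rhs_def ind_c_def ind_d_def ind_q_def .
qed

end
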